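(* Let $A=\Bbbk\mathcal{Q}/\mathcal{I}$ be a gentle or locally gentle algebra. The following are equivalent: (1) $\operatorname{GKdim}(A)=\operatorname{depth}(A)$. (2) There exist commuting, homogeneous, algebraically independent elements $x_1,\dots,x_d\in A$ with $d=\operatorname{GKdim}(A)$ such that $A$ is a finitely generated, free $\Bbbk[x_1,\dots,x_d]$-module. (3) $A$ has no finite maximal paths or $A$ has no infinite maximal paths.
   Context: $\Bbbk$ is a field of characteristic $0$. A quiver $\mathcal{Q}=(\mathcal{Q}_0,\mathcal{Q}_1,s,t)$ has vertex set $\mathcal{Q}_0$, arrow set $\mathcal{Q}_1$, source and target maps $s,t$; all quivers are finite and connected with $|\mathcal{Q}_0|,|\mathcal{Q}_1|\ge 1$. $\operatorname{indeg}(v)$, $\operatorname{outdeg}(v)$ are the numbers of arrows with target, respectively source, $v$. Paths are composed left to right; $\Bbbk\mathcal{Q}$ is the path algebra. $A=\Bbbk\mathcal{Q}/\mathcal{I}$ is gentle if: (i) $\operatorname{indeg}(v),\operatorname{outdeg}(v)\le 2$ for all $v$; (ii) whenever $s(\alpha)=t(\beta)=t(\beta')$ with $\beta\ne\beta'$ arrows, exactly one of $\beta\alpha,\beta'\alpha$ is in $\mathcal{I}$; (iii) whenever $t(\alpha)=s(\beta)=s(\beta')$ with $\beta\neq\beta'$, exactly one of $\alpha\beta,\alpha\beta'$ is in $\mathcal{I}$; (iv) $\mathcal{I}$ is generated by paths of length $2$; (v) $A$ is finite dimensional. It is locally gentle if it satisfies (i)-(iv) and is infinite dimensional. $A$ is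 graded by path length, $A_+=\bigoplus_{i\ge1}A_i$. A path $p\notin\mathcal{I}$ is a finite maximal path if $p\alpha\in\mathcal{I}$ and $\alpha p\in\mathcal{I}$ for every arrow $\alpha$. A cycle (closed path of positive length) $c$ is primitive if it is not $(c')^k$ for a cycle $c'$ and $k>1$; for a primitive cycle $c$ with $c^2\notin\mathcal{I}$, $c^\infty$ is called an infinite maximal path (rotations of $c$ give the same one). Modules are right modules. $S=A/A_+$ (the quotient of $A$ by its graded Jacobson radical). For graded modules, $\underline{\operatorname{Hom}}_A(M,N)=\bigoplus_{i\in\mathbb{Z}}\operatorname{Hom}^i_A(M,N)$, where $\operatorname{Hom}^i_A$ denotes graded homomorphisms of degree $i$, and $\underline{\operatorname{Ext}}^j_A=R^j\underline{\operatorname{Hom}}_A$. $\operatorname{depth}(A)=\min\{i:\underline{\operatorname{Ext}}^i_A(S,A)\ne0\}$. $\operatorname{GKdim}$ is the Gelfand-Kirillov dimension. *)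

theory Defs
  imports
    "HOL-Algebra.Embedded_Algebras"
    "HOL-Algebra.QuotRing"
    "HOL-Library.Extended_Real"
    "HOL-Library.Liminf_Limsup"
    "Graph_Theory.Digraph_Component"
    "Graph_Theory.Arc_Walk"
begin

section \<open>Graded rings and graded right modules\<close>

record 'a graded_ring = "'a ring" +
  rgrade :: "int \<Rightarrow> 'a set"

text \<open>A right module reuses the record of \<^theory>\<open>HOL-Algebra.Module\<close>, whose scalar
  multiplication takes the scalar first; \<open>r \<odot>\<^bsub>M\<^esub> m\<close> stands for \<open>m \<cdot> r\<close>. The ring
  multiplication and unit fields of the record carry no meaning.\<close>

record ('a, 'm) graded_module = "('a, 'm) module" +
  mgrade :: "int \<Rightarrow> 'm set"

locale right_module = R?: ring R + M?: abelian_group M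
  for R :: "('a, 'b) ring_scheme" (structure) and M :: "('a, 'm, 'c) module_scheme" (structure) +
  assumes smult_closed: "r \<in> carrier R \<Longrightarrow> m \<in> carrier M \<Longrightarrow> r \<odot>\<^bsub>M\<^esub> m \<in> carrier M"
    and smult_add_scalar: "r \<in> carrier R \<Longrightarrow> s \<in> carrier R \<Longrightarrow> m \<in> carrier M \<Longrightarrow>
      (r \<oplus>\<^bsub>R\<^esub> s) \<odot>\<^bsub>M\<^esub> m = r \<odot>\<^bsub>M\<^esub> m \<oplus>\<^bsub>M\<^esub> s \<odot>\<^bsub>M\<^esub> m"
    and smult_add_module: "r \<in> carrier R \<Longrightarrow> m \<in> carrier M \<Longrightarrow> n \<in> carrier M \<Longrightarrow>
      r \<odot>\<^bsub>M\<^esub> (m \<oplus>\<^bsub>M\<^esub> n) = r \<odot>\<^bsub>M\<^esub> m \<oplus>\<^bsub>M\<^esub> r \<odot>\<^bsub>M\<^esub> n"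
    and smult_assoc_right: "r \<in> carrier R \<Longrightarrow> s \<in> carrier R \<Longrightarrow> m \<in> carrier M \<Longrightarrow>
      (r \<otimes>\<^bsub>R\<^esub> s) \<odot>\<^bsub>M\<^esub> m = s \<odot>\<^bsub>M\<^esub> (r \<odot>\<^bsub>M\<^esub> m)"
    and smult_one_right: "m \<in> carrier M \<Longrightarrow> \<one>\<^bsub>R\<^esub> \<odot>\<^bsub>M\<^esub> m = m"

definition internal_direct_sum :: "('m, 'z) ring_scheme \<Rightarrow> (int \<Rightarrow> 'm set) \<Rightarrow> bool" where
  "internal_direct_sum M H \<longleftrightarrow>
     (\<forall>i. additive_subgroup (H i) M) \<and>
     (\<forall>m\<in>carrier M. \<exists>!f. (\<forall>i. f i \<in> H i) \<and> finite {i. f i \<noteq> \<zero>\<^bsub>M\<^esub>} \<and>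
        m = (\<Oplus>\<^bsub>M\<^esub>i\<in>{i. f i \<noteq> \<zero>\<^bsub>M\<^esub>}. f i))"

definition graded_right_module ::
  "('a, 'z) graded_ring_scheme \<Rightarrow> ('a, 'm, 'y) graded_module_scheme \<Rightarrow> bool" where
  "graded_right_module A M \<longleftrightarrow>
     right_module A M \<and> internal_direct_sum M (mgrade M) \<and>
     (\<forall>i j. \<forall>m\<in>mgrade M i. \<forall>a\<in>rgrade A j. a \<odot>\<^bsub>M\<^esub> m \<in> mgrade M (i + j))"

text \<open>The ring as a graded right module over itself.\<close>

definition regular_module :: "('a, 'z) graded_ring_scheme \<Rightarrow> ('a, 'a) graded_module" where
  "regular_module A =
     \<lparr>carrier = carrier A, monoid.mult = monoid.mult A, one = \<one>\<^bsub>A\<^esub>, zero = \<zero>\<^bsub>A\<^esub>, add = add A,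
      smult = (\<lambda>r m. m \<otimes>\<^bsub>A\<^esub> r), mgrade = rgrade A\<rparr>"

definition quotient_module ::
  "('a, 'm, 'y) graded_module_scheme \<Rightarrow> 'm set \<Rightarrow> ('a, 'm set) graded_module" where
  "quotient_module M N =
     \<lparr>carrier = a_rcosets\<^bsub>M\<^esub> N, monoid.mult = (\<lambda>_ _. N), one = N, zero = N, add = set_add M,
      smult = (\<lambda>r X. \<Union>x\<in>X. N +>\<^bsub>M\<^esub> (r \<odot>\<^bsub>M\<^esub> x)),
      mgrade = (\<lambda>i. (\<lambda>x. N +>\<^bsub>M\<^esub> x) ` mgrade M i)\<rparr>"

definition positive_part :: "('a, 'z) graded_ring_scheme \<Rightarrow> 'a set" where
  "positive_part A =
     {(\<Oplus>\<^bsub>A\<^esub>i\<in>F. f i) |F f. finite F \<and> F \<subseteq> {1..} \<and> (\<forall>i\<in>F. f i \<in> rgrade A i)}"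

definition top_module :: "('a, 'z) graded_ring_scheme \<Rightarrow> ('a, 'a set) graded_module" where
  "top_module A = quotient_module (regular_module A) (positive_part A)"


subsection \<open>Generators and bases\<close>

definition coefficients_on :: "('a, 'z) ring_scheme \<Rightarrow> 'm set \<Rightarrow> ('m \<Rightarrow> 'a) set" where
  "coefficients_on R B =
     {c. (\<forall>b. c b \<in> carrier R) \<and> finite {b. c b \<noteq> \<zero>\<^bsub>R\<^esub>} \<and> {b. c b \<noteq> \<zero>\<^bsub>R\<^esub>} \<subseteq> B}"

definition linear_combination ::
  "('a, 'z) ring_scheme \<Rightarrow> ('a, 'm, 'y) module_scheme \<Rightarrow> ('m \<Rightarrow> 'a) \<Rightarrow> 'm" where
  "linear_combination R M c = (\<Oplus>\<^bsub>M\<^esub>b\<in>{b. c b \<noteq> \<zero>\<^bsub>R\<^esub>}. c b \<odot>\<^bsub>M\<^esub> b)"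

definition finitely_generated_module ::
  "('a, 'z) ring_scheme \<Rightarrow> ('a, 'm, 'y) module_scheme \<Rightarrow> bool" where
  "finitely_generated_module R M \<longleftrightarrow>
     (\<exists>B. finite B \<and> B \<subseteq> carrier M \<and>
        (\<forall>m\<in>carrier M. \<exists>c\<in>coefficients_on R B. m = linear_combination R M c))"

definition module_basis ::
  "('a, 'z) ring_scheme \<Rightarrow> ('a, 'm, 'y) module_scheme \<Rightarrow> 'm set \<Rightarrow> bool" where
  "module_basis R M B \<longleftrightarrow>
     B \<subseteq> carrier M \<and>
     (\<forall>m\<in>carrier M. \<exists>!c. c \<in> coefficients_on R B \<and> m = linear_combination R M c)"

definition free_module :: "('a, 'z) ring_scheme \<Rightarrow> ('a, 'm, 'y) module_scheme \<Rightarrow> bool" where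
  "free_module R M \<longleftrightarrow> (\<exists>B. module_basis R M B)"

definition graded_free_module ::
  "('a, 'z) graded_ring_scheme \<Rightarrow> ('a, 'm, 'y) graded_module_scheme \<Rightarrow> bool" where
  "graded_free_module A M \<longleftrightarrow>
     graded_right_module A M \<and>
     (\<exists>B. module_basis A M B \<and> B \<subseteq> (\<Union>i. mgrade M i))"


subsection \<open>Graded homomorphisms\<close>

definition hom_of_degree ::
  "('a, 'z) graded_ring_scheme \<Rightarrow> int \<Rightarrow> ('a, 'm, 'y) graded_module_scheme \<Rightarrow>
   ('a, 'n, 'w) graded_module_scheme \<Rightarrow> ('m \<Rightarrow> 'n) set" where
  "hom_of_degree A i M N =
     {f \<in> carrier M \<rightarrow>\<^sub>E carrier N.
        (\<forall>x\<in>carrier M. \<forall>y\<in>carrier M. f (x \<oplus>\<^bsub>M\<^esub> y) = f x \<oplus>\<^bsub>N\<^esub> f y) \<and>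
        (\<forall>a\<in>carrier A. \<forall>x\<in>carrier M. f (a \<odot>\<^bsub>M\<^esub> x) = a \<odot>\<^bsub>N\<^esub> f x) \<and>
        (\<forall>j. f ` mgrade M j \<subseteq> mgrade N (j + i))}"

text \<open>The direct sum of the groups \<open>Hom\<^sup>i(M, N)\<close> over all integers \<open>i\<close>, formed inside the
  group of all module homomorphisms.\<close>

definition graded_hom ::
  "('a, 'z) graded_ring_scheme \<Rightarrow> ('a, 'm, 'y) graded_module_scheme \<Rightarrow>
   ('a, 'n, 'w) graded_module_scheme \<Rightarrow> ('m \<Rightarrow> 'n) monoid" where
  "graded_hom A M N =
     \<lparr>carrier =
        {(\<lambda>x\<in>carrier M. \<Oplus>\<^bsub>N\<^esub>i\<in>F. h i x) |F h.
           finite F \<and> (\<forall>i\<in>F. h i \<in> hom_of_degree A i M N)},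
      monoid.mult = (\<lambda>f g. \<lambda>x\<in>carrier M. f x \<oplus>\<^bsub>N\<^esub> g x),
      one = (\<lambda>x\<in>carrier M. \<zero>\<^bsub>N\<^esub>)\<rparr>"


subsection \<open>Ext and depth\<close>

record ('a, 'm, 'p) resolution =
  term_of :: "nat \<Rightarrow> ('a, 'p) graded_module"
  diff_of :: "nat \<Rightarrow> 'p \<Rightarrow> 'p"  \<comment> \<open>\<open>diff_of n\<close> maps term \<open>n + 1\<close> to term \<open>n\<close>\<close>
  aug_of :: "'p \<Rightarrow> 'm"

definition graded_free_resolution ::
  "('a, 'z) graded_ring_scheme \<Rightarrow> ('a, 'm, 'y) graded_module_scheme \<Rightarrow>
   ('a, 'm, 'p) resolution \<Rightarrow> bool" where
  "graded_free_resolution A M P \<longleftrightarrow>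
     (\<forall>n. graded_free_module A (term_of P n)) \<and>
     (\<forall>n. diff_of P n \<in> hom_of_degree A 0 (term_of P (Suc n)) (term_of P n)) \<and>
     aug_of P \<in> hom_of_degree A 0 (term_of P 0) M \<and>
     aug_of P ` carrier (term_of P 0) = carrier M \<and>
     diff_of P 0 ` carrier (term_of P (Suc 0)) =
       {x \<in> carrier (term_of P 0). aug_of P x = \<zero>\<^bsub>M\<^esub>} \<and>
     (\<forall>n. diff_of P (Suc n) ` carrier (term_of P (Suc (Suc n))) =
       {x \<in> carrier (term_of P (Suc n)). diff_of P n x = \<zero>\<^bsub>term_of P n\<^esub>})"

definition cocycles ::
  "('a, 'z) graded_ring_scheme \<Rightarrow> ('a, 'm, 'p) resolution \<Rightarrow>
   ('a, 'n, 'w) graded_module_scheme \<Rightarrow> nat \<Rightarrow> ('p \<Rightarrow> 'n) set" where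
  "cocycles A P N j =
     {f \<in> carrier (graded_hom A (term_of P j) N).
        compose (carrier (term_of P (Suc j))) f (diff_of P j) =
        \<one>\<^bsub>graded_hom A (term_of P (Suc j)) N\<^esub>}"

definition coboundaries ::
  "('a, 'z) graded_ring_scheme \<Rightarrow> ('a, 'm, 'p) resolution \<Rightarrow>
   ('a, 'n, 'w) graded_module_scheme \<Rightarrow> nat \<Rightarrow> ('p \<Rightarrow> 'n) set" where
  "coboundaries A P N j =
     (case j of
        0 \<Rightarrow> {\<one>\<^bsub>graded_hom A (term_of P 0) N\<^esub>}
      | Suc i \<Rightarrow> (\<lambda>f. compose (carrier (term_of P (Suc i))) f (diff_of P i)) `
                  carrier (graded_hom A (term_of P i) N))"

definition resolution_cohomology ::
  "('a, 'z) graded_ring_scheme \<Rightarrow> ('a, 'm, 'p) resolution \<Rightarrow>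
   ('a, 'n, 'w) graded_module_scheme \<Rightarrow> nat \<Rightarrow> ('p \<Rightarrow> 'n) set monoid" where
  "resolution_cohomology A P N j =
     (graded_hom A (term_of P j) N\<lparr>carrier := cocycles A P N j\<rparr>) Mod coboundaries A P N j"

text \<open>Ext is the cohomology of the graded Hom complex of a chosen graded free resolution; up to
  isomorphism it does not depend on the choice. The terms of the resolution live on the type
  \<open>'m + 'a + nat \<Rightarrow> 'a\<close>. Every graded module on the type \<open>'m\<close> has such a resolution, consisting
  of finitely supported functions on suitable subsets of the infinite index type
  \<open>'m + 'a + nat\<close>: the kernel of each stage has at most as many elements as the index type, so
  the index type is large enough for a homogeneous generating set of that kernel.\<close>

definition chosen_resolution ::
  "('a, 'z) graded_ring_scheme \<Rightarrow> ('a, 'm, 'y) graded_module_scheme \<Rightarrow>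
   ('a, 'm, 'm + 'a + nat \<Rightarrow> 'a) resolution" where
  "chosen_resolution A M = (SOME P. graded_free_resolution A M P)"

definition graded_Ext ::
  "('a, 'z) graded_ring_scheme \<Rightarrow> nat \<Rightarrow> ('a, 'm, 'y) graded_module_scheme \<Rightarrow>
   ('a, 'n, 'w) graded_module_scheme \<Rightarrow> (('m + 'a + nat \<Rightarrow> 'a) \<Rightarrow> 'n) set monoid" where
  "graded_Ext A j M N = resolution_cohomology A (chosen_resolution A M) N j"

definition depth :: "('a, 'z) graded_ring_scheme \<Rightarrow> enat" where
  "depth A = Inf {enat j |j.
     carrier (graded_Ext A j (top_module A) (regular_module A)) \<noteq>
     {\<one>\<^bsub>graded_Ext A j (top_module A) (regular_module A)\<^esub>}}"


section \<open>Gelfand--Kirillov dimension\<close>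

text \<open>An algebra over a field is given by a ring \<open>R\<close> and a (central) subfield \<open>K\<close>, as in
  \<^theory>\<open>HOL-Algebra.Embedded_Algebras\<close>. The space \<open>power_space K R V n\<close> is
  \<open>V\<^sup>0 + V\<^sup>1 + \<dots> + V\<^sup>n\<close>, the span of all products of at most \<open>n\<close> elements of \<open>V\<close>.\<close>

definition power_space :: "'a set \<Rightarrow> ('a, 'z) ring_scheme \<Rightarrow> 'a set \<Rightarrow> nat \<Rightarrow> 'a set" where
  "power_space K R V n =
     (\<Union>us\<in>{us. set us \<subseteq> {foldr (monoid.mult R) vs \<one>\<^bsub>R\<^esub> |vs. set vs \<subseteq> V \<and> length vs \<le> n}}.
        ring.Span R K us)"

definition GKdim :: "'a set \<Rightarrow> ('a, 'z) ring_scheme \<Rightarrow> ereal" where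
  "GKdim K R =
     (SUP V\<in>{V. ring.finite_dimension R K V}.
        limsup (\<lambda>n. ereal (log (real n) (real (ring.dim R K (power_space K R V n))))))"


section \<open>Polynomials in commuting elements\<close>

text \<open>A polynomial in \<open>d\<close> variables over \<open>K\<close> is a finitely supported family of coefficients
  indexed by exponent lists of length \<open>d\<close>.\<close>

definition polynomials :: "'a set \<Rightarrow> ('a, 'z) ring_scheme \<Rightarrow> nat \<Rightarrow> (nat list \<Rightarrow> 'a) set" where
  "polynomials K R d =
     {p. (\<forall>e. p e \<in> K) \<and> finite {e. p e \<noteq> \<zero>\<^bsub>R\<^esub>} \<and> (\<forall>e. p e \<noteq> \<zero>\<^bsub>R\<^esub> \<longrightarrow> length e = d)}"

definition monomial_value :: "('a, 'z) ring_scheme \<Rightarrow> 'a list \<Rightarrow> nat list \<Rightarrow> 'a" where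
  "monomial_value R xs e =
     foldr (\<lambda>(x, n) y. (x [^]\<^bsub>R\<^esub> (n::nat)) \<otimes>\<^bsub>R\<^esub> y) (zip xs e) \<one>\<^bsub>R\<^esub>"

definition polynomial_value :: "('a, 'z) ring_scheme \<Rightarrow> 'a list \<Rightarrow> (nat list \<Rightarrow> 'a) \<Rightarrow> 'a" where
  "polynomial_value R xs p =
     (\<Oplus>\<^bsub>R\<^esub>e\<in>{e. p e \<noteq> \<zero>\<^bsub>R\<^esub>}. p e \<otimes>\<^bsub>R\<^esub> monomial_value R xs e)"

definition pairwise_commuting :: "('a, 'z) ring_scheme \<Rightarrow> 'a list \<Rightarrow> bool" where
  "pairwise_commuting R xs \<longleftrightarrow> (\<forall>x\<in>set xs. \<forall>y\<in>set xs. x \<otimes>\<^bsub>R\<^esub> y = y \<otimes>\<^bsub>R\<^esub> x)"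

definition algebraically_independent :: "'a set \<Rightarrow> ('a, 'z) ring_scheme \<Rightarrow> 'a list \<Rightarrow> bool" where
  "algebraically_independent K R xs \<longleftrightarrow>
     (\<forall>p\<in>polynomials K R (length xs). polynomial_value R xs p = \<zero>\<^bsub>R\<^esub> \<longrightarrow> (\<forall>e. p e = \<zero>\<^bsub>R\<^esub>))"

definition generated_algebra ::
  "'a set \<Rightarrow> ('a, 'z) ring_scheme \<Rightarrow> 'a list \<Rightarrow> ('a, 'z) ring_scheme" where
  "generated_algebra K R xs =
     R\<lparr>carrier := polynomial_value R xs ` polynomials K R (length xs)\<rparr>"


section \<open>Path algebras\<close>

text \<open>Quivers are the directed multigraphs of \<^theory>\<open>Graph_Theory.Digraph\<close>; the source of an
  arrow is its \<^const>\<open>tail\<close>, its target is its \<^const>\<open>head\<close>. The library's \<open>connected\<close>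
  is connectedness of the underlying undirected graph and includes nonemptiness.\<close>

definition quiver :: "('v, 'e) pre_digraph \<Rightarrow> bool" where
  "quiver Q \<longleftrightarrow> fin_digraph Q \<and> Digraph_Component.connected Q \<and> arcs Q \<noteq> {}"

text \<open>A path is a start vertex together with the list of its arrows, from left to right; the
  start vertex matters only for the trivial paths.\<close>

type_synonym ('v, 'e) path = "'v \<times> 'e list"

definition paths :: "('v, 'e) pre_digraph \<Rightarrow> ('v, 'e) path set" where
  "paths Q = {(u, p). \<exists>v. pre_digraph.awalk Q u p v}"

abbreviation end_vertex :: "('v, 'e) pre_digraph \<Rightarrow> 'v \<Rightarrow> 'e list \<Rightarrow> 'v" where
  "end_vertex Q u p \<equiv> last (pre_digraph.awalk_verts Q u p)"

text \<open>The product sums over all factorisations of a path into an initial and a final segment,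
  which is the bilinear extension of concatenation of paths.\<close>

definition path_algebra ::
  "('v, 'e) pre_digraph \<Rightarrow> (('v, 'e) path \<Rightarrow> 'k::field) ring" where
  "path_algebra Q =
     \<lparr>carrier = {f. finite {p. f p \<noteq> 0} \<and> {p. f p \<noteq> 0} \<subseteq> paths Q},
      monoid.mult = (\<lambda>f g (u, p). \<Sum>i\<le>length p.
                f (u, take i p) * g (end_vertex Q u (take i p), drop i p)),
      one = (\<lambda>(u, p). if u \<in> verts Q \<and> p = [] then 1 else 0),
      zero = (\<lambda>_. 0),
      add = (\<lambda>f g p. f p + g p)\<rparr>"

definition path_element :: "('v, 'e) path \<Rightarrow> ('v, 'e) path \<Rightarrow> 'k::field" where
  "path_element p = (\<lambda>q. if q = p then 1 else 0)"

definition arrow_path :: "('v, 'e) pre_digraph \<Rightarrow> 'e list \<Rightarrow> ('v, 'e) path" where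
  "arrow_path Q es = (tail Q (hd es), es)"

definition quiver_algebra ::
  "('v, 'e) pre_digraph \<Rightarrow> (('v, 'e) path \<Rightarrow> 'k::field) set \<Rightarrow>
   (('v, 'e) path \<Rightarrow> 'k) set graded_ring" where
  "quiver_algebra Q I =
     (let B = path_algebra Q Quot I in
      \<lparr>carrier = carrier B, monoid.mult = monoid.mult B, one = \<one>\<^bsub>B\<^esub>, zero = \<zero>\<^bsub>B\<^esub>, add = add B,
       rgrade = (\<lambda>i. {I +>\<^bsub>path_algebra Q\<^esub> f |f. f \<in> carrier (path_algebra Q) \<and>
                        (\<forall>p. f p \<noteq> 0 \<longrightarrow> int (length (snd p)) = i)})\<rparr>)"

text \<open>The image of the ground field in the quotient.\<close>

definition scalars ::
  "('v, 'e) pre_digraph \<Rightarrow> (('v, 'e) path \<Rightarrow> 'k::field) set \<Rightarrow> (('v, 'e) path \<Rightarrow> 'k) set set" where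
  "scalars Q I =
     range (\<lambda>c. I +>\<^bsub>path_algebra Q\<^esub> (\<lambda>p. c * \<one>\<^bsub>path_algebra Q\<^esub> p))"


section \<open>Gentle and locally gentle algebras\<close>

definition gentle_relations ::
  "('v, 'e) pre_digraph \<Rightarrow> (('v, 'e) path \<Rightarrow> 'k::field) set \<Rightarrow> bool" where
  "gentle_relations Q I \<longleftrightarrow>
     (\<forall>v\<in>verts Q. in_degree Q v \<le> 2 \<and> out_degree Q v \<le> 2) \<and>
     (\<forall>\<alpha>\<in>arcs Q. \<forall>\<beta>\<in>arcs Q. \<forall>\<beta>'\<in>arcs Q.
        tail Q \<alpha> = head Q \<beta> \<and> tail Q \<alpha> = head Q \<beta>' \<and> \<beta> \<noteq> \<beta>' \<longrightarrow>
        (path_element (arrow_path Q [\<beta>, \<alpha>]) \<in> I) \<noteq>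
        (path_element (arrow_path Q [\<beta>', \<alpha>]) \<in> I)) \<and>
     (\<forall>\<alpha>\<in>arcs Q. \<forall>\<beta>\<in>arcs Q. \<forall>\<beta>'\<in>arcs Q.
        head Q \<alpha> = tail Q \<beta> \<and> head Q \<alpha> = tail Q \<beta>' \<and> \<beta> \<noteq> \<beta>' \<longrightarrow>
        (path_element (arrow_path Q [\<alpha>, \<beta>]) \<in> I) \<noteq>
        (path_element (arrow_path Q [\<alpha>, \<beta>']) \<in> I)) \<and>
     (\<exists>R. R \<subseteq> {p \<in> paths Q. length (snd p) = 2} \<and>
        I = Idl\<^bsub>path_algebra Q\<^esub> (path_element ` R))"

definition gentle ::
  "('v, 'e) pre_digraph \<Rightarrow> (('v, 'e) path \<Rightarrow> 'k::field) set \<Rightarrow> bool" where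
  "gentle Q I \<longleftrightarrow>
     gentle_relations Q I \<and>
     ring.finite_dimension (quiver_algebra Q I) (scalars Q I) (carrier (quiver_algebra Q I))"

definition locally_gentle ::
  "('v, 'e) pre_digraph \<Rightarrow> (('v, 'e) path \<Rightarrow> 'k::field) set \<Rightarrow> bool" where
  "locally_gentle Q I \<longleftrightarrow>
     gentle_relations Q I \<and>
     \<not> ring.finite_dimension (quiver_algebra Q I) (scalars Q I) (carrier (quiver_algebra Q I))"

definition finite_maximal_paths ::
  "('v, 'e) pre_digraph \<Rightarrow> (('v, 'e) path \<Rightarrow> 'k::field) set \<Rightarrow> ('v, 'e) path set" where
  "finite_maximal_paths Q I =
     {p \<in> paths Q. path_element p \<notin> I \<and>
        (\<forall>\<alpha>\<in>arcs Q.
           path_element p \<otimes>\<^bsub>path_algebra Q\<^esub> path_element (arrow_path Q [\<alpha>]) \<in> I \<and>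
           path_element (arrow_path Q [\<alpha>]) \<otimes>\<^bsub>path_algebra Q\<^esub> path_element p \<in> I)}"

definition cycles :: "('v, 'e) pre_digraph \<Rightarrow> 'e list set" where
  "cycles Q = {c. c \<noteq> [] \<and> pre_digraph.awalk Q (tail Q (hd c)) c (tail Q (hd c))}"

definition primitive_cycles :: "('v, 'e) pre_digraph \<Rightarrow> 'e list set" where
  "primitive_cycles Q =
     {c \<in> cycles Q. \<not> (\<exists>c'\<in>cycles Q. \<exists>k>1. c = concat (replicate k c'))}"

text \<open>The infinite path \<open>c\<^sup>\<infinity>\<close> is represented by the set of rotations of the primitive
  cycle \<open>c\<close>.\<close>

definition infinite_maximal_paths ::
  "('v, 'e) pre_digraph \<Rightarrow> (('v, 'e) path \<Rightarrow> 'k::field) set \<Rightarrow> 'e list set set" where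
  "infinite_maximal_paths Q I =
     {range (\<lambda>n. rotate n c) |c. c \<in> primitive_cycles Q \<and>
        path_element (arrow_path Q (c @ c)) \<notin> I}"

end

theory Submission
  imports Defs "HOL-Combinatorics.Cycles" "HOL-Computational_Algebra.Polynomial"
begin

text \<open>The nonzero paths of a gentle or locally gentle algebra form a basis. The depth is \<open>0\<close> iff
  a nonzero homogeneous element is annihilated by \<open>A\<^sub>+\<close>, which happens iff there is a finite
  maximal path; the Gelfand--Kirillov dimension is \<open>0\<close> or \<open>1\<close>, according to whether there is
  an infinite maximal path.

  If there is no finite maximal path, every arrow has exactly one successor with nonzero product, and
  this successor map permutes the arrows. Let \<open>x\<close> be the sum of all nonzero paths whose length is a
  fixed common period of this permutation. Then \<open>x\<close> is central and regular and \<open>A\<close> is free of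
  finite rank over \<open>K[x]\<close>. A homogeneous \<open>y \<notin> x A\<close> with \<open>y A\<^sub>+ \<subseteq> x A\<close> yields the map
  \<open>a \<mapsto> x\<^sup>-\<^sup>1 y a\<close> on \<open>A\<^sub>+\<close>, which does not extend to \<open>A\<close>, so the depth is \<open>1\<close>.

  If there are finite and infinite maximal paths, then the dimension is \<open>1\<close> and the depth is
  \<open>0\<close>. Moreover \<open>A\<close> is not free over any \<open>K[x]\<close>: a homogeneous \<open>x\<close> of positive
  degree kills a finite maximal path, and one of degree \<open>0\<close> is algebraic over \<open>K\<close>.\<close>

text \<open>Two obstacles shape the development. Ext is computed from a resolution picked by choice,
  of which only exactness and graded freeness are known. Resolutions are never compared: the
  augmentation of the term P_0 is lifted to a map l from P_0 to A of degree 0, and the cocycles that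
  are needed are built from l. It is enough that l sends the image of P_1 into A_+ and takes some
  value congruent to 1 modulo A_+. That a resolution exists on the prescribed type is a separate
  cardinality argument.

  The other obstacle is to find y. Division by x with a remainder supported on paths of length at
  most the period shows that xA contains every homogeneous element of degree above the period, so a
  homogeneous element of largest degree outside xA exists and serves as y. The same division yields
  the basis over K[x].

  Gentleness enters through the fact that an arrow has at most one nonzero continuation on each
  side. Finite dimension is the case d = 0: a longest nonzero path is a finite maximal path, no
  infinite one exists, and A is free over K.\<close>

lemma additive_finsum:
  assumes "abelian_group M" "abelian_group N" "f \<in> carrier M \<rightarrow> carrier N"
    and add: "\<And>x y. x \<in> carrier M \<Longrightarrow> y \<in> carrier M \<Longrightarrow> f (x \<oplus>\<^bsub>M\<^esub> y) = f x \<oplus>\<^bsub>N\<^esub> f y"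
    and "g \<in> F \<rightarrow> carrier M" "finite F"
  shows "f (finsum M g F) = finsum N (\<lambda>i. f (g i)) F"
proof -
  interpret M: abelian_group M by fact
  interpret N: abelian_group N by fact
  have "f \<zero>\<^bsub>M\<^esub> \<oplus>\<^bsub>N\<^esub> f \<zero>\<^bsub>M\<^esub> = f \<zero>\<^bsub>M\<^esub>"
    using add[of "\<zero>\<^bsub>M\<^esub>" "\<zero>\<^bsub>M\<^esub>"] assms(3) by (auto simp: Pi_iff)
  then have 0: "f \<zero>\<^bsub>M\<^esub> = \<zero>\<^bsub>N\<^esub>"
    using assms(3) by (metis M.zero_closed N.add.l_cancel_one Pi_mem)
  show ?thesis using assms(6,5)
  proof (induction F rule: finite_induct)
    case (insert i F)
    then have "f (finsum M g (insert i F)) = f (g i \<oplus>\<^bsub>M\<^esub> finsum M g F)"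
      by (subst M.finsum_insert) auto
    also have "\<dots> = f (g i) \<oplus>\<^bsub>N\<^esub> finsum N (\<lambda>i. f (g i)) F"
      using insert by (subst add) auto
    also have "\<dots> = finsum N (\<lambda>i. f (g i)) (insert i F)"
      using insert assms(3) by (subst N.finsum_insert) (auto simp: Pi_iff)
    finally show ?case .
  qed (simp add: 0)
qed

lemma additive_zero:
  assumes "abelian_group M" "abelian_group N" "f \<in> carrier M \<rightarrow> carrier N"
    and "\<And>x y. x \<in> carrier M \<Longrightarrow> y \<in> carrier M \<Longrightarrow> f (x \<oplus>\<^bsub>M\<^esub> y) = f x \<oplus>\<^bsub>N\<^esub> f y"
  shows "f \<zero>\<^bsub>M\<^esub> = \<zero>\<^bsub>N\<^esub>"
  using additive_finsum[OF assms, of "\<lambda>_. \<zero>\<^bsub>M\<^esub>" "{}"]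
    abelian_group.axioms(1)[OF assms(1)] abelian_group.axioms(1)[OF assms(2)]
  by (simp add: abelian_monoid.finsum_empty)

lemma (in abelian_group) finsum_support:
  assumes "finite F" "f \<in> F \<rightarrow> carrier G" "{i. f i \<noteq> \<zero>} \<subseteq> F"
  shows "finsum G f {i. f i \<noteq> \<zero>} = finsum G f F"
  using assms by (intro add.finprod_mono_neutral_cong_left) auto

lemma (in abelian_group) finsum_single:
  assumes "finite F" "f \<in> F \<rightarrow> carrier G" "a \<in> F" "\<And>i. i \<in> F \<Longrightarrow> i \<noteq> a \<Longrightarrow> f i = \<zero>"
  shows "finsum G f F = f a"
proof -
  have "finsum G f F = f a \<oplus> finsum G f (F - {a})"
    using assms by (subst finsum_insert[symmetric]) (auto simp: insert_absorb)
  moreover have "finsum G f (F - {a}) = \<zero>"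
    using assms by (intro add.finprod_one_eqI) auto
  ultimately show ?thesis using assms by (auto simp: Pi_iff)
qed

section \<open>Components in an internal direct sum\<close>

definition component ::
  "('m, 'z) ring_scheme \<Rightarrow> (int \<Rightarrow> 'm set) \<Rightarrow> int \<Rightarrow> 'm \<Rightarrow> 'm" where
  "component M H i m =
     (THE f. (\<forall>i. f i \<in> H i) \<and> finite {i. f i \<noteq> \<zero>\<^bsub>M\<^esub>} \<and>
        m = (\<Oplus>\<^bsub>M\<^esub>i\<in>{i. f i \<noteq> \<zero>\<^bsub>M\<^esub>}. f i)) i"

text \<open>Uniqueness holds because the additive map \<open>p j\<close>, applied to a finite
  decomposition of \<open>m\<close>, kills every summand except \<open>f j\<close>. The gradings of
  free modules, of quotients and of the quiver algebra are all verified by exhibiting such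
  projections.\<close>

lemma (in abelian_group) internal_direct_sumI:
  assumes sub: "\<And>i. additive_subgroup (H i) G"
    and p_in: "\<And>i m. m \<in> carrier G \<Longrightarrow> p i m \<in> H i"
    and p_add: "\<And>i m n. m \<in> carrier G \<Longrightarrow> n \<in> carrier G \<Longrightarrow> p i (m \<oplus> n) = p i m \<oplus> p i n"
    and p_same: "\<And>i m. m \<in> H i \<Longrightarrow> p i m = m"
    and p_other: "\<And>i j m. m \<in> H j \<Longrightarrow> i \<noteq> j \<Longrightarrow> p i m = \<zero>"
    and fin: "\<And>m. m \<in> carrier G \<Longrightarrow> finite {i. p i m \<noteq> \<zero>}"
    and sum: "\<And>m. m \<in> carrier G \<Longrightarrow> m = (\<Oplus>i\<in>{i. p i m \<noteq> \<zero>}. p i m)"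
  shows "internal_direct_sum G H"
  unfolding internal_direct_sum_def
proof (intro conjI allI ballI sub)
  have H_car: "\<And>i x. x \<in> H i \<Longrightarrow> x \<in> carrier G"
    using sub by (meson additive_subgroup.a_Hcarr)
  fix m assume m: "m \<in> carrier G"
  show "\<exists>!f. (\<forall>i. f i \<in> H i) \<and> finite {i. f i \<noteq> \<zero>} \<and> m = (\<Oplus>i\<in>{i. f i \<noteq> \<zero>}. f i)"
  proof (intro ex1I[of _ "\<lambda>i. p i m"] conjI allI)
    fix f assume f: "(\<forall>i. f i \<in> H i) \<and> finite {i. f i \<noteq> \<zero>} \<and> m = (\<Oplus>i\<in>{i. f i \<noteq> \<zero>}. f i)"
    show "f = (\<lambda>i. p i m)"
    proof
      fix j
      \<comment> \<open>\<open>f j\<close> may be zero, and then \<open>j\<close> is missing from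
        the support.\<close>
      let ?F = "insert j {i. f i \<noteq> \<zero>}"
      have fc: "f \<in> ?F \<rightarrow> carrier G" using f H_car by auto
      have "m = (\<Oplus>i\<in>?F. f i)"
        using f fc by (subst finsum_support[symmetric, of ?F f]) auto
      then have "p j m = (\<Oplus>i\<in>?F. p j (f i))"
        using additive_finsum[of G G "p j" f ?F] f fc p_in H_car p_add abelian_group_axioms by auto
      also have "\<dots> = p j (f j)"
      proof (rule finsum_single)
        have "\<And>i. f i \<in> carrier G" using f H_car by blast
        then show "(\<lambda>i. p j (f i)) \<in> ?F \<rightarrow> carrier G" using p_in H_car by blast
        show "p j (f i) = \<zero>" if "i \<noteq> j" for i using f p_other[of "f i" i j] that by auto
      qed (use f in auto)
      finally show "f j = p j m" using f p_same by auto
    qed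
  qed (use m p_in fin sum in auto)
qed

text \<open>An abelian group with a decomposition and no multiplication, so that the facts on
  components serve the ring and its modules alike.\<close>

locale graded_group = abelian_group M for M :: "('m, 'z) ring_scheme" (structure) +
  fixes H :: "int \<Rightarrow> 'm set"
  assumes direct: "internal_direct_sum M H"
begin

abbreviation cmp :: "int \<Rightarrow> 'm \<Rightarrow> 'm" where "cmp \<equiv> component M H"

lemma grade_subgroup: "additive_subgroup (H i) M"
  using direct unfolding internal_direct_sum_def by auto

lemma grade_carrier: "x \<in> H i \<Longrightarrow> x \<in> carrier M"
  using grade_subgroup additive_subgroup.a_Hcarr by metis

lemma grade_zero: "\<zero> \<in> H i"
  using grade_subgroup additive_subgroup.zero_closed by metis

lemma grade_add: "x \<in> H i \<Longrightarrow> y \<in> H i \<Longrightarrow> x \<oplus> y \<in> H i"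
  using grade_subgroup additive_subgroup.a_closed by metis

lemma component_spec:
  assumes "m \<in> carrier M"
  shows "(\<forall>i. cmp i m \<in> H i) \<and> finite {i. cmp i m \<noteq> \<zero>} \<and> m = (\<Oplus>i\<in>{i. cmp i m \<noteq> \<zero>}. cmp i m)"
proof -
  have "\<exists>!f. (\<forall>i. f i \<in> H i) \<and> finite {i. f i \<noteq> \<zero>} \<and> m = (\<Oplus>i\<in>{i. f i \<noteq> \<zero>}. f i)"
    using direct assms unfolding internal_direct_sum_def by auto
  from theI'[OF this] show ?thesis unfolding component_def .
qed

lemma component_in: "m \<in> carrier M \<Longrightarrow> cmp i m \<in> H i"
  and component_finite: "m \<in> carrier M \<Longrightarrow> finite {i. cmp i m \<noteq> \<zero>}"
  and component_sum: "m \<in> carrier M \<Longrightarrow> (\<Oplus>i\<in>{i. cmp i m \<noteq> \<zero>}. cmp i m) = m"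
  using component_spec by simp_all

lemma component_carrier: "m \<in> carrier M \<Longrightarrow> cmp i m \<in> carrier M"
  using component_in grade_carrier by blast

lemma component_sum': 
  assumes "m \<in> carrier M" "finite F" "{i. cmp i m \<noteq> \<zero>} \<subseteq> F"
  shows "(\<Oplus>i\<in>F. cmp i m) = m"
  using finsum_support[of F "\<lambda>i. cmp i m"] assms component_carrier component_sum by auto

text \<open>Any finite index set containing the support is allowed, because supports of sums and of
  images are only known up to such a bound.\<close>

lemma component_unique:
  assumes f: "\<And>i. f i \<in> H i" and F: "finite F" "{i. f i \<noteq> \<zero>} \<subseteq> F" and m: "m = (\<Oplus>i\<in>F. f i)"
  shows "cmp i m = f i"
proof -
  have fc: "f \<in> F \<rightarrow> carrier M" using f grade_carrier by auto
  then have mc: "m \<in> carrier M" using m by auto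
  have ex1: "\<exists>!f. (\<forall>i. f i \<in> H i) \<and> finite {i. f i \<noteq> \<zero>} \<and> m = (\<Oplus>i\<in>{i. f i \<noteq> \<zero>}. f i)"
    using direct mc unfolding internal_direct_sum_def by auto
  have "m = (\<Oplus>i\<in>{i. f i \<noteq> \<zero>}. f i)"
    using finsum_support[OF F(1) fc F(2)] m by simp
  moreover have "finite {i. f i \<noteq> \<zero>}" using F finite_subset by auto
  ultimately show ?thesis
    unfolding component_def using the1_equality[OF ex1, of f] f by simp
qed

lemma component_add:
  assumes "m \<in> carrier M" "n \<in> carrier M"
  shows "cmp i (m \<oplus> n) = cmp i m \<oplus> cmp i n"
proof -
  let ?F = "{i. cmp i m \<noteq> \<zero>} \<union> {i. cmp i n \<noteq> \<zero>}"
  have F: "finite ?F" using assms component_finite by auto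
  show ?thesis
  proof (rule component_unique[of "\<lambda>i. cmp i m \<oplus> cmp i n" ?F])
    show "m \<oplus> n = (\<Oplus>i\<in>?F. cmp i m \<oplus> cmp i n)"
      using assms component_carrier F by (subst finsum_addf) (auto simp: component_sum')
  qed (use assms component_in grade_add F in auto)
qed

lemma component_homogeneous:
  assumes "m \<in> H j"
  shows "cmp i m = (if i = j then m else \<zero>)"
proof (rule component_unique[of "\<lambda>i. if i = j then m else \<zero>" "{j}"])
  show "m = (\<Oplus>i\<in>{j}. if i = j then m else \<zero>)"
    using finsum_single[of "{j}" "\<lambda>i. if i = j then m else \<zero>" j] grade_carrier[OF assms] by simp
  show "(if i = j then m else \<zero>) \<in> H i" for i using assms grade_zero[of i] by simp
qed auto

lemma component_zero: "cmp i \<zero> = \<zero>"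
  using component_homogeneous[OF grade_zero[of i], of i] by simp

lemma component_finsum:
  assumes "finite F" "g \<in> F \<rightarrow> carrier M"
  shows "cmp i (finsum M g F) = (\<Oplus>j\<in>F. cmp i (g j))"
  by (rule additive_finsum) (use assms component_carrier component_add abelian_group_axioms in auto)

lemma homogeneous_iff: "m \<in> H j \<longleftrightarrow> m \<in> carrier M \<and> (\<forall>i. i \<noteq> j \<longrightarrow> cmp i m = \<zero>)"
proof
  assume *: "m \<in> carrier M \<and> (\<forall>i. i \<noteq> j \<longrightarrow> cmp i m = \<zero>)"
  then have "(\<Oplus>i\<in>{j}. cmp i m) = m" by (intro component_sum') auto
  then show "m \<in> H j" using * component_in[of m j] component_carrier[of m j]
    using finsum_single[of "{j}" "\<lambda>i. cmp i m" j] by simp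
qed (use component_homogeneous grade_carrier in auto)

end

text \<open>Apply \<open>f\<close> to the decomposition of \<open>m\<close>: the image of the
  component of degree \<open>j\<close> has degree \<open>j + d\<close>, so only \<open>j = i\<close>
  contributes in degree \<open>i + d\<close>.\<close>

lemma component_hom:
  assumes "graded_group M H" "graded_group N H'" "f \<in> carrier M \<rightarrow> carrier N"
    and "\<And>x y. x \<in> carrier M \<Longrightarrow> y \<in> carrier M \<Longrightarrow> f (x \<oplus>\<^bsub>M\<^esub> y) = f x \<oplus>\<^bsub>N\<^esub> f y"
    and deg: "\<And>j x. x \<in> H j \<Longrightarrow> f x \<in> H' (j + d)"
    and m: "m \<in> carrier M"
  shows "component N H' (i + d) (f m) = f (component M H i m)"
proof -
  interpret M: graded_group M H by fact
  interpret N: graded_group N H' by fact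
  let ?F = "insert i {i. M.cmp i m \<noteq> \<zero>\<^bsub>M\<^esub>}"
  have F: "finite ?F" using M.component_finite m by auto
  have "f m = f (\<Oplus>\<^bsub>M\<^esub>j\<in>?F. M.cmp j m)" using M.component_sum'[OF m F subset_insertI] by simp
  also have "\<dots> = (\<Oplus>\<^bsub>N\<^esub>j\<in>?F. f (M.cmp j m))"
    by (rule additive_finsum) (use assms F M.component_carrier M.abelian_group_axioms N.abelian_group_axioms in auto)
  finally have "f m = (\<Oplus>\<^bsub>N\<^esub>j\<in>?F. f (M.cmp j m))" .
  then have "N.cmp (i + d) (f m) = (\<Oplus>\<^bsub>N\<^esub>j\<in>?F. N.cmp (i + d) (f (M.cmp j m)))"
    using N.component_finsum[OF F, of "\<lambda>j. f (M.cmp j m)" "i + d"] assms(3) M.component_carrier[OF m]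
    by (simp add: Pi_iff)
  also have "\<dots> = N.cmp (i + d) (f (M.cmp i m))"
    by (rule N.finsum_single)
      (use F assms M.component_carrier N.component_carrier
        N.component_homogeneous[OF deg[OF M.component_in]] in \<open>auto simp: Pi_iff\<close>)
  also have "\<dots> = f (M.cmp i m)"
    using N.component_homogeneous[OF deg[OF M.component_in[OF m]]] by simp
  finally show ?thesis .
qed

section \<open>Graded rings and components of scalar multiples\<close>

locale graded_ring = ring A for A :: "('a, 'z) graded_ring_scheme" (structure) +
  assumes rgrade_direct: "internal_direct_sum A (rgrade A)"
    and rgrade_mult: "x \<in> rgrade A i \<Longrightarrow> y \<in> rgrade A j \<Longrightarrow> x \<otimes> y \<in> rgrade A (i + j)"
    and rgrade_one: "\<one> \<in> rgrade A 0"
begin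

sublocale G: graded_group A "rgrade A"
  by unfold_locales (rule rgrade_direct)

end

lemma graded_right_module_graded_group:
  "graded_right_module A M \<Longrightarrow> graded_group M (mgrade M)"
  unfolding graded_right_module_def graded_group_def graded_group_axioms_def right_module_def by auto

text \<open>For a fixed homogeneous \<open>b\<close> the map sending \<open>a\<close> to the scalar
  multiple of \<open>b\<close> by \<open>a\<close> is additive of degree \<open>j\<close>, so
  \<open>component_hom\<close> applies.\<close>

lemma component_smult_homogeneous:
  assumes A: "graded_ring A" and M: "graded_right_module A M" and b: "b \<in> mgrade M j" and a: "a \<in> carrier A"
  shows "component M (mgrade M) (i + j) (a \<odot>\<^bsub>M\<^esub> b) = component A (rgrade A) i a \<odot>\<^bsub>M\<^esub> b"
proof -
  interpret A: graded_ring A by fact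
  interpret M: graded_group M "mgrade M" using M by (rule graded_right_module_graded_group)
  interpret R: right_module A M using M by (simp add: graded_right_module_def)
  have bc: "b \<in> carrier M" using b M.grade_carrier by auto
  have deg: "\<And>k x. x \<in> rgrade A k \<Longrightarrow> x \<odot>\<^bsub>M\<^esub> b \<in> mgrade M (k + j)"
    using M b unfolding graded_right_module_def by (metis add.commute)
  show ?thesis
    by (rule component_hom[where f = "\<lambda>a. a \<odot>\<^bsub>M\<^esub> b" and H = "rgrade A"])
      (use A.G.graded_group_axioms M.graded_group_axioms bc R.smult_closed R.smult_add_scalar a deg in auto)
qed

section \<open>Graded free modules\<close>

text \<open>The direct sum of shifted copies of A, with generator \<open>s\<close> placed in degree
  \<open>\<delta> s\<close>. The functions live on the whole index type and are supported in
  \<open>S\<close>, so all free modules with index sets inside one type share a carrier type, as the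
  terms of a resolution must. Multiplication and unit are fillers demanded by the record.\<close>

definition free_graded ::
  "('a, 'z) graded_ring_scheme \<Rightarrow> 's set \<Rightarrow> ('s \<Rightarrow> int) \<Rightarrow> ('a, 's \<Rightarrow> 'a) graded_module" where
  "free_graded A S \<delta> =
     \<lparr>carrier = {f. (\<forall>s. f s \<in> carrier A) \<and> finite {s. f s \<noteq> \<zero>\<^bsub>A\<^esub>} \<and> {s. f s \<noteq> \<zero>\<^bsub>A\<^esub>} \<subseteq> S},
      monoid.mult = (\<lambda>f g. f), one = (\<lambda>_. \<zero>\<^bsub>A\<^esub>), zero = (\<lambda>_. \<zero>\<^bsub>A\<^esub>),
      add = (\<lambda>f g s. f s \<oplus>\<^bsub>A\<^esub> g s),
      module.smult = (\<lambda>r f s. f s \<otimes>\<^bsub>A\<^esub> r),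
      mgrade = (\<lambda>i. {f. (\<forall>s. f s \<in> rgrade A (i - \<delta> s)) \<and> finite {s. f s \<noteq> \<zero>\<^bsub>A\<^esub>} \<and>
                       {s. f s \<noteq> \<zero>\<^bsub>A\<^esub>} \<subseteq> S})\<rparr>"

definition free_generator :: "('a, 'z) graded_ring_scheme \<Rightarrow> 's \<Rightarrow> 's \<Rightarrow> 'a" where
  "free_generator A s = (\<lambda>t. if t = s then \<one>\<^bsub>A\<^esub> else \<zero>\<^bsub>A\<^esub>)"

lemma free_graded_simps [simp]:
  "carrier (free_graded A S \<delta>) =
     {f. (\<forall>s. f s \<in> carrier A) \<and> finite {s. f s \<noteq> \<zero>\<^bsub>A\<^esub>} \<and> {s. f s \<noteq> \<zero>\<^bsub>A\<^esub>} \<subseteq> S}"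
  "\<zero>\<^bsub>free_graded A S \<delta>\<^esub> = (\<lambda>_. \<zero>\<^bsub>A\<^esub>)"
  "f \<oplus>\<^bsub>free_graded A S \<delta>\<^esub> g = (\<lambda>s. f s \<oplus>\<^bsub>A\<^esub> g s)"
  "r \<odot>\<^bsub>free_graded A S \<delta>\<^esub> f = (\<lambda>s. f s \<otimes>\<^bsub>A\<^esub> r)"
  "mgrade (free_graded A S \<delta>) i =
     {f. (\<forall>s. f s \<in> rgrade A (i - \<delta> s)) \<and> finite {s. f s \<noteq> \<zero>\<^bsub>A\<^esub>} \<and> {s. f s \<noteq> \<zero>\<^bsub>A\<^esub>} \<subseteq> S}"
  by (simp_all add: free_graded_def)

context graded_ring
begin

lemma free_graded_abelian_group: "abelian_group (free_graded A S \<delta>)"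
proof (rule abelian_groupI)
  fix f g assume f: "f \<in> carrier (free_graded A S \<delta>)" and g: "g \<in> carrier (free_graded A S \<delta>)"
  have "{s. f s \<oplus> g s \<noteq> \<zero>} \<subseteq> {s. f s \<noteq> \<zero>} \<union> {s. g s \<noteq> \<zero>}" by auto
  then show "f \<oplus>\<^bsub>free_graded A S \<delta>\<^esub> g \<in> carrier (free_graded A S \<delta>)"
    using f g by (auto intro: finite_subset dest: finite_subset)
next
  fix f assume f: "f \<in> carrier (free_graded A S \<delta>)"
  have "{s. \<ominus> f s \<noteq> \<zero>} \<subseteq> {s. f s \<noteq> \<zero>}" by auto
  then have "(\<lambda>s. \<ominus> f s) \<in> carrier (free_graded A S \<delta>)"
    using f by (auto intro: finite_subset)
  moreover have "(\<lambda>s. \<ominus> f s) \<oplus>\<^bsub>free_graded A S \<delta>\<^esub> f = \<zero>\<^bsub>free_graded A S \<delta>\<^esub>"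
    using f by (auto simp: l_neg)
  ultimately show "\<exists>g\<in>carrier (free_graded A S \<delta>). g \<oplus>\<^bsub>free_graded A S \<delta>\<^esub> f = \<zero>\<^bsub>free_graded A S \<delta>\<^esub>"
    by blast
qed (auto simp: a_ac)

lemma free_graded_right_module: "right_module A (free_graded A S \<delta>)"
proof -
  interpret F: abelian_group "free_graded A S \<delta>" by (rule free_graded_abelian_group)
  show ?thesis
  proof unfold_locales
    fix r f assume r: "r \<in> carrier A" and f: "f \<in> carrier (free_graded A S \<delta>)"
    have "{s. f s \<otimes> r \<noteq> \<zero>} \<subseteq> {s. f s \<noteq> \<zero>}" using r by auto
    then show "r \<odot>\<^bsub>free_graded A S \<delta>\<^esub> f \<in> carrier (free_graded A S \<delta>)"
      using r f by (auto intro: finite_subset)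
  qed (auto simp: l_distr r_distr m_assoc)
qed

lemma free_graded_finsum:
  assumes "finite J" "h \<in> J \<rightarrow> carrier (free_graded A S \<delta>)"
  shows "finsum (free_graded A S \<delta>) h J s = (\<Oplus>j\<in>J. h j s)"
  by (rule additive_finsum[where f = "\<lambda>f. f s"])
    (use assms free_graded_abelian_group abelian_group_axioms in auto)

lemma free_graded_homogeneous_subgroup:
  "additive_subgroup (mgrade (free_graded A S \<delta>) i) (free_graded A S \<delta>)"
proof -
  interpret F: abelian_group "free_graded A S \<delta>" by (rule free_graded_abelian_group)
  have sub: "mgrade (free_graded A S \<delta>) i \<subseteq> carrier (free_graded A S \<delta>)"
    using G.grade_carrier by auto
  show ?thesis
  proof (intro additive_subgroup.intro F.add.subgroupI)
    show "mgrade (free_graded A S \<delta>) i \<noteq> {}" using G.grade_zero by (auto intro!: exI[of _ "\<lambda>_. \<zero>"])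
  next
    fix f assume f: "f \<in> mgrade (free_graded A S \<delta>) i"
    have "\<ominus>\<^bsub>free_graded A S \<delta>\<^esub> f = (\<lambda>s. \<ominus> f s)"
    proof (rule F.minus_equality)
      show "(\<lambda>s. \<ominus> f s) \<oplus>\<^bsub>free_graded A S \<delta>\<^esub> f = \<zero>\<^bsub>free_graded A S \<delta>\<^esub>"
        using f sub by (auto simp: l_neg)
      have "{s. \<ominus> f s \<noteq> \<zero>} \<subseteq> {s. f s \<noteq> \<zero>}" by auto
      then show "(\<lambda>s. \<ominus> f s) \<in> carrier (free_graded A S \<delta>)"
        using f G.grade_carrier by (auto intro!: a_inv_closed intro: finite_subset)
    qed (use f sub in blast)
    moreover have "{s. \<ominus> f s \<noteq> \<zero>} \<subseteq> {s. f s \<noteq> \<zero>}" by auto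
    ultimately show "\<ominus>\<^bsub>free_graded A S \<delta>\<^esub> f \<in> mgrade (free_graded A S \<delta>) i"
      using f additive_subgroup.a_inv_closed[OF G.grade_subgroup] by (auto intro: finite_subset)
  next
    fix f g assume f: "f \<in> mgrade (free_graded A S \<delta>) i" and g: "g \<in> mgrade (free_graded A S \<delta>) i"
    have "{s. f s \<oplus> g s \<noteq> \<zero>} \<subseteq> {s. f s \<noteq> \<zero>} \<union> {s. g s \<noteq> \<zero>}" by auto
    then show "f \<oplus>\<^bsub>free_graded A S \<delta>\<^esub> g \<in> mgrade (free_graded A S \<delta>) i"
      using f g by (auto intro: finite_subset dest: finite_subset G.grade_add)
  qed (use sub in auto)
qed

lemma free_graded_direct: "internal_direct_sum (free_graded A S \<delta>) (mgrade (free_graded A S \<delta>))"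
proof -
  interpret F: abelian_group "free_graded A S \<delta>" by (rule free_graded_abelian_group)
  let ?F = "free_graded A S \<delta>"
  define p where "p = (\<lambda>i f s. G.cmp (i - \<delta> s) (f s))"
  have p_in: "p i f \<in> mgrade ?F i" if "f \<in> carrier ?F" for i f
  proof -
    have "{s. p i f s \<noteq> \<zero>} \<subseteq> {s. f s \<noteq> \<zero>}" by (auto simp: p_def G.component_zero)
    then show ?thesis using that by (auto simp: p_def G.component_in intro: finite_subset)
  qed
  have sub: "f \<in> mgrade ?F i \<Longrightarrow> f \<in> carrier ?F" for f i
    using G.grade_carrier by auto
  \<comment> \<open>Finitely many coordinates are nonzero and each has finitely many components;
    degree \<open>j\<close> in coordinate \<open>s\<close> is seen in total degree
    \<open>j + \<delta> s\<close>.\<close>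
  have fin: "finite {i. p i f \<noteq> \<zero>\<^bsub>?F\<^esub>}" if f: "f \<in> carrier ?F" for f
  proof -
    have "{i. p i f \<noteq> \<zero>\<^bsub>?F\<^esub>} \<subseteq> (\<Union>s\<in>{s. f s \<noteq> \<zero>}. (\<lambda>j. j + \<delta> s) ` {j. G.cmp j (f s) \<noteq> \<zero>})"
    proof
      fix i assume "i \<in> {i. p i f \<noteq> \<zero>\<^bsub>?F\<^esub>}"
      then obtain s where s: "G.cmp (i - \<delta> s) (f s) \<noteq> \<zero>" by (auto simp: p_def)
      then have "f s \<noteq> \<zero>" using G.component_zero by metis
      moreover have "i \<in> (\<lambda>j. j + \<delta> s) ` {j. G.cmp j (f s) \<noteq> \<zero>}"
        using s by (intro image_eqI[of _ _ "i - \<delta> s"]) auto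
      ultimately show "i \<in> (\<Union>s\<in>{s. f s \<noteq> \<zero>}. (\<lambda>j. j + \<delta> s) ` {j. G.cmp j (f s) \<noteq> \<zero>})" by blast
    qed
    moreover have "finite (\<Union>s\<in>{s. f s \<noteq> \<zero>}. (\<lambda>j. j + \<delta> s) ` {j. G.cmp j (f s) \<noteq> \<zero>})"
      using f G.component_finite by auto
    ultimately show ?thesis by (rule finite_subset)
  qed
  show ?thesis
  proof (rule F.internal_direct_sumI[where p = p])
    show "m = (\<Oplus>\<^bsub>?F\<^esub>i\<in>{i. p i m \<noteq> \<zero>\<^bsub>?F\<^esub>}. p i m)" if m: "m \<in> carrier ?F" for m
    proof
      fix s
      let ?J = "{i. p i m \<noteq> \<zero>\<^bsub>?F\<^esub>}"
      have "finsum ?F (\<lambda>i. p i m) ?J s = (\<Oplus>i\<in>?J. p i m s)"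
        by (rule free_graded_finsum) (use fin[OF m] p_in[OF m] sub in blast)+
      also have "\<dots> = (\<Oplus>i\<in>(\<lambda>i. i - \<delta> s) ` ?J. G.cmp i (m s))"
        using m by (subst finsum_reindex) (auto simp: p_def inj_on_def G.component_carrier)
      also have "\<dots> = m s"
      proof (rule G.component_sum')
        show "{i. G.cmp i (m s) \<noteq> \<zero>} \<subseteq> (\<lambda>i. i - \<delta> s) ` ?J"
        proof
          fix i assume "i \<in> {i. G.cmp i (m s) \<noteq> \<zero>}"
          then have "p (i + \<delta> s) m s \<noteq> \<zero>" by (simp add: p_def)
          then have "p (i + \<delta> s) m \<noteq> \<zero>\<^bsub>?F\<^esub>" by auto
          then show "i \<in> (\<lambda>i. i - \<delta> s) ` ?J" by (intro image_eqI[of _ _ "i + \<delta> s"]) auto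
        qed
      qed (use m fin[OF m] in auto)
      finally show "m s = finsum ?F (\<lambda>i. p i m) ?J s" by simp
    qed
    show "p i m = m" if "m \<in> mgrade ?F i" for i m
    proof
      fix s show "p i m s = m s"
        using that G.component_homogeneous[of "m s" "i - \<delta> s" "i - \<delta> s"] by (simp add: p_def)
    qed
    show "p i m = \<zero>\<^bsub>?F\<^esub>" if "m \<in> mgrade ?F j" "i \<noteq> j" for i j m
      using that G.component_homogeneous[of "m s" "j - \<delta> s" "i - \<delta> s" for s] by (auto simp: p_def)
  qed (use p_in fin free_graded_homogeneous_subgroup in \<open>auto simp: p_def G.component_add\<close>)
qed

lemma free_graded_graded_right_module: "graded_right_module A (free_graded A S \<delta>)"
  unfolding graded_right_module_def
proof (intro conjI allI ballI)
  fix i j m a assume m: "m \<in> mgrade (free_graded A S \<delta>) i" and a: "a \<in> rgrade A j"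
  have "{s. m s \<otimes> a \<noteq> \<zero>} \<subseteq> {s. m s \<noteq> \<zero>}" using a G.grade_carrier by auto
  moreover have "m s \<otimes> a \<in> rgrade A (i + j - \<delta> s)" for s
    using m a rgrade_mult[of "m s" "i - \<delta> s" a j] by (simp add: algebra_simps)
  ultimately show "a \<odot>\<^bsub>free_graded A S \<delta>\<^esub> m \<in> mgrade (free_graded A S \<delta>) (i + j)"
    using m by (auto intro: finite_subset)
qed (rule free_graded_right_module free_graded_direct)+

lemma free_generator_grade: "s \<in> S \<Longrightarrow> free_generator A s \<in> mgrade (free_graded A S \<delta>) (\<delta> s)"
  using rgrade_one G.grade_zero by (auto simp: free_generator_def split: if_splits)

lemma inj_free_generator:
  assumes "\<one> \<noteq> \<zero>" shows "inj (free_generator A)"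
  by (rule injI) (metis (full_types) assms free_generator_def)

lemma free_graded_linear_combination:
  assumes nt: "\<one> \<noteq> \<zero>" and c: "c \<in> coefficients_on A (free_generator A ` S)"
  shows "linear_combination A (free_graded A S \<delta>) c s = c (free_generator A s)"
proof -
  let ?F = "free_graded A S \<delta>" and ?J = "{b. c b \<noteq> \<zero>}"
  have J: "finite ?J" "?J \<subseteq> free_generator A ` S" and cc: "\<And>b. c b \<in> carrier A"
    using c by (auto simp: coefficients_on_def)
  have in_car: "free_generator A t \<in> carrier ?F" if "t \<in> S" for t
    using free_generator_grade[OF that, of \<delta>] G.grade_carrier by auto
  have "(\<lambda>b. c b \<odot>\<^bsub>?F\<^esub> b) \<in> ?J \<rightarrow> carrier ?F"
    using J cc in_car right_module.smult_closed[OF free_graded_right_module] by blast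
  then have "linear_combination A ?F c s = (\<Oplus>b\<in>?J. (c b \<odot>\<^bsub>?F\<^esub> b) s)"
    unfolding linear_combination_def using J by (intro free_graded_finsum)
  \<comment> \<open>The generator of \<open>s\<close> is added to the index set, where its
    coefficient may vanish, so that the sum reduces to this one term.\<close>
  also have "\<dots> = (\<Oplus>b\<in>insert (free_generator A s) ?J. b s \<otimes> c b)"
    using J cc in_car nt
    by (intro add.finprod_mono_neutral_cong_left) (auto simp: free_generator_def split: if_splits)
  also have "\<dots> = free_generator A s s \<otimes> c (free_generator A s)"
  proof (rule finsum_single)
    fix b assume "b \<in> insert (free_generator A s) ?J" "b \<noteq> free_generator A s"
    then obtain t where "b = free_generator A t" "t \<noteq> s" using J by auto
    then show "b s \<otimes> c b = \<zero>" using cc by (simp add: free_generator_def)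
  qed (use J cc in \<open>auto simp: free_generator_def\<close>)
  finally show ?thesis using cc by (simp add: free_generator_def)
qed

lemma free_graded_basis:
  assumes nt: "\<one> \<noteq> \<zero>"
  shows "module_basis A (free_graded A S \<delta>) (free_generator A ` S)"
  unfolding module_basis_def
proof (intro conjI ballI)
  let ?F = "free_graded A S \<delta>"
  show "free_generator A ` S \<subseteq> carrier ?F"
    using free_generator_grade[of _ S \<delta>] by (auto simp: free_generator_def split: if_splits)
  fix m assume m: "m \<in> carrier ?F"
  \<comment> \<open>Coefficients are indexed by module elements instead of by \<open>S\<close>. The
    index is recovered by injectivity of \<open>free_generator\<close>, which rests on
    \<open>\<one> \<noteq> \<zero>\<close>.\<close>
  define c where "c b = (if b \<in> range (free_generator A) then m (inv_into UNIV (free_generator A) b) else \<zero>)" for b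
  note inj = inj_free_generator[OF nt]
  have c_gen: "c (free_generator A s) = m s" for s by (simp add: c_def inv_f_f[OF inj])
  have "{b. c b \<noteq> \<zero>} = free_generator A ` {s. m s \<noteq> \<zero>}"
  proof (intro subset_antisym subsetI)
    fix b assume b: "b \<in> {b. c b \<noteq> \<zero>}"
    then obtain s where "b = free_generator A s" unfolding c_def by (auto split: if_splits)
    then show "b \<in> free_generator A ` {s. m s \<noteq> \<zero>}" using b c_gen by auto
  qed (use c_gen in auto)
  then have c: "c \<in> coefficients_on A (free_generator A ` S)"
    using m by (auto simp: coefficients_on_def c_def)
  show "\<exists>!c. c \<in> coefficients_on A (free_generator A ` S) \<and> m = linear_combination A ?F c"
  proof (rule ex1I[of _ c])
    show "c \<in> coefficients_on A (free_generator A ` S) \<and> m = linear_combination A ?F c"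
      using c free_graded_linear_combination[OF nt c] c_gen by auto
  next
    fix d assume d: "d \<in> coefficients_on A (free_generator A ` S) \<and> m = linear_combination A ?F d"
    then have eq: "d (free_generator A s) = c (free_generator A s)" for s
      using free_graded_linear_combination[OF nt, of d S \<delta> s] c_gen by simp
    show "d = c"
    proof
      fix b show "d b = c b"
      proof (cases "b \<in> free_generator A ` S")
        case False
        then have "d b = \<zero>" "c b = \<zero>" using d c unfolding coefficients_on_def by blast+
        then show ?thesis by simp
      qed (use eq in auto)
    qed
  qed
qed

lemma free_graded_graded_free_module:
  "\<one> \<noteq> \<zero> \<Longrightarrow> graded_free_module A (free_graded A S \<delta>)"
proof -
  have "free_generator A s \<in> (\<Union>i. mgrade (free_graded A S \<delta>) i)" if "s \<in> S" for s
    using free_generator_grade[OF that] by (rule UN_I[OF UNIV_I])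
  then have "free_generator A ` S \<subseteq> (\<Union>i. mgrade (free_graded A S \<delta>) i)"
    by (rule image_subsetI)
  then show "graded_free_module A (free_graded A S \<delta>)" if "\<one> \<noteq> \<zero>"
    unfolding graded_free_module_def
    using free_graded_graded_right_module free_graded_basis[OF that]
    by (intro conjI exI[of _ "free_generator A ` S"])
qed

end

section \<open>Existence of graded free resolutions\<close>

text \<open>A finitely supported function is determined by a list of its support and the list of its
  values there, and lists over an infinite type inject into that type because pairs do. Hence
  kernels inside modules of functions on \<open>'s\<close> have generating sets that can again be
  indexed by \<open>'s\<close>.\<close>

lemma finite_support_embedding:
  fixes e :: "'a \<Rightarrow> 's" and z :: 'a
  assumes inf: "infinite (UNIV :: 's set)" and e: "inj e"
  obtains j :: "('s \<Rightarrow> 'a) \<Rightarrow> 's" where "inj_on j {f. finite {s. f s \<noteq> z}}"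
proof -
  have "(card_of (UNIV \<times> UNIV :: ('s \<times> 's) set), card_of (UNIV :: 's set)) \<in> ordLeq"
    using card_of_Times_same_infinite[OF inf] ordIso_iff_ordLeq by blast
  then obtain h :: "'s \<times> 's \<Rightarrow> 's" where h: "inj h"
    unfolding card_of_ordLeq[symmetric] by auto
  obtain nn :: "nat \<Rightarrow> 's" where nn: "inj nn"
    using inf infinite_countable_subset by blast
  define enc :: "'s list \<Rightarrow> 's" where "enc = rec_list (nn 0) (\<lambda>x _ r. h (x, r))"
  have enc_inj: "length xs = length ys \<Longrightarrow> enc xs = enc ys \<Longrightarrow> xs = ys" for xs ys
  proof (induction xs ys rule: list_induct2')
    case (4 x xs y ys)
    then have "h (x, enc xs) = h (y, enc ys)" by (simp add: enc_def)
    then show ?case using 4 injD[OF h] by auto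
  qed auto
  \<comment> \<open>\<open>nn 0\<close> may itself be a value of \<open>h\<close>, so
    \<open>enc\<close> separates only lists of equal length; the length is added as a tag.\<close>
  define code where "code xs = h (nn (length xs), enc xs)" for xs :: "'s list"
  have code: "inj code"
  proof (rule injI)
    fix xs ys assume "code xs = code ys"
    then have "nn (length xs) = nn (length ys)" "enc xs = enc ys"
      using injD[OF h] unfolding code_def by auto
    then show "xs = ys" using injD[OF nn] enc_inj by auto
  qed
  define lst :: "('s \<Rightarrow> 'a) \<Rightarrow> 's list" where "lst f = (SOME xs. set xs = {s. f s \<noteq> z})" for f
  define j where "j f = h (code (lst f), code (map (\<lambda>s. e (f s)) (lst f)))" for f
  have "inj_on j {f. finite {s. f s \<noteq> z}}"
  proof (rule inj_onI)
    fix f g assume f: "f \<in> {f. finite {s. f s \<noteq> z}}" and g: "g \<in> {f. finite {s. f s \<noteq> z}}"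
      and "j f = j g"
    then have "lst f = lst g \<and> map (\<lambda>s. e (f s)) (lst f) = map (\<lambda>s. e (g s)) (lst g)"
      unfolding j_def inj_eq[OF h] prod.inject inj_eq[OF code] by blast
    then have l: "lst f = lst g" and m: "map (\<lambda>s. e (f s)) (lst f) = map (\<lambda>s. e (g s)) (lst g)"
      by blast+
    have sf: "set (lst f) = {s. f s \<noteq> z}"
      unfolding lst_def by (rule someI_ex) (use f finite_list in auto)
    have sg: "set (lst g) = {s. g s \<noteq> z}"
      unfolding lst_def by (rule someI_ex) (use g finite_list in auto)
    show "f = g"
    proof
      fix s show "f s = g s"
      proof (cases "s \<in> set (lst f)")
        case True then show ?thesis using m l by (simp add: inj_eq[OF e])
      next
        case False then show ?thesis using sf sg l by auto
      qed
    qed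
  qed
  then show ?thesis by (rule that)
qed

section \<open>Graded submodules, kernels and free covers\<close>

definition graded_submodule ::
  "('a, 'z) graded_ring_scheme \<Rightarrow> ('a, 'm, 'y) graded_module_scheme \<Rightarrow> 'm set \<Rightarrow> bool" where
  "graded_submodule A M Z \<longleftrightarrow>
     Z \<subseteq> carrier M \<and> \<zero>\<^bsub>M\<^esub> \<in> Z \<and> (\<forall>x\<in>Z. \<forall>y\<in>Z. x \<oplus>\<^bsub>M\<^esub> y \<in> Z) \<and>
     (\<forall>x\<in>Z. \<forall>a\<in>carrier A. a \<odot>\<^bsub>M\<^esub> x \<in> Z) \<and> (\<forall>x\<in>Z. \<forall>i. component M (mgrade M) i x \<in> Z)"

lemma finsum_closed_in:
  assumes "abelian_group M" "\<zero>\<^bsub>M\<^esub> \<in> Z" "\<And>x y. x \<in> Z \<Longrightarrow> y \<in> Z \<Longrightarrow> x \<oplus>\<^bsub>M\<^esub> y \<in> Z" "Z \<subseteq> carrier M"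
    and "finite F" "\<And>i. i \<in> F \<Longrightarrow> g i \<in> Z"
  shows "finsum M g F \<in> Z"
proof -
  interpret M: abelian_group M by fact
  show ?thesis using assms(5,6)
  proof (induction F rule: finite_induct)
    case (insert i F)
    have "finsum M g (insert i F) = g i \<oplus>\<^bsub>M\<^esub> finsum M g F"
      using insert assms(4) by (intro M.finsum_insert) auto
    then show ?case using insert assms(3) by auto
  qed (use assms(2) in simp)
qed

lemma hom_of_degree_D:
  assumes "f \<in> hom_of_degree A i M N"
  shows "f \<in> carrier M \<rightarrow> carrier N" "f \<in> extensional (carrier M)"
    "\<And>x. x \<in> carrier M \<Longrightarrow> f x \<in> carrier N"
    "\<And>x y. x \<in> carrier M \<Longrightarrow> y \<in> carrier M \<Longrightarrow> f (x \<oplus>\<^bsub>M\<^esub> y) = f x \<oplus>\<^bsub>N\<^esub> f y"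
    "\<And>a x. a \<in> carrier A \<Longrightarrow> x \<in> carrier M \<Longrightarrow> f (a \<odot>\<^bsub>M\<^esub> x) = a \<odot>\<^bsub>N\<^esub> f x"
    "\<And>j x. x \<in> mgrade M j \<Longrightarrow> f x \<in> mgrade N (j + i)"
  using assms unfolding hom_of_degree_def PiE_def by (auto, blast)

text \<open>A homogeneous map commutes with components up to the shift of degree, so the components
  of a kernel element stay in the kernel.\<close>

lemma kernel_graded_submodule:
  assumes A: "ring A" and M: "graded_right_module A M" and N: "graded_right_module A N"
    and f: "f \<in> hom_of_degree A i M N"
  shows "graded_submodule A M {x \<in> carrier M. f x = \<zero>\<^bsub>N\<^esub>}"
proof -
  interpret M: graded_group M "mgrade M" using M by (rule graded_right_module_graded_group)
  interpret N: graded_group N "mgrade N" using N by (rule graded_right_module_graded_group)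
  interpret RM: right_module A M using M by (simp add: graded_right_module_def)
  interpret RN: right_module A N using N by (simp add: graded_right_module_def)
  note h = hom_of_degree_D[OF f]
  have f0: "f \<zero>\<^bsub>M\<^esub> = \<zero>\<^bsub>N\<^esub>"
    by (rule additive_zero) (use h M.abelian_group_axioms N.abelian_group_axioms in auto)
  have s0: "a \<odot>\<^bsub>N\<^esub> \<zero>\<^bsub>N\<^esub> = \<zero>\<^bsub>N\<^esub>" if "a \<in> carrier A" for a
    by (rule additive_zero[where f = "\<lambda>x. a \<odot>\<^bsub>N\<^esub> x"])
      (use that N.abelian_group_axioms RN.smult_closed RN.smult_add_module in auto)
  have "f (M.cmp j x) = \<zero>\<^bsub>N\<^esub>" if x: "x \<in> carrier M" "f x = \<zero>\<^bsub>N\<^esub>" for j x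
    using component_hom[OF M.graded_group_axioms N.graded_group_axioms h(1,4,6) x(1)] x(2)
      N.component_zero by auto
  then show ?thesis
    unfolding graded_submodule_def
    using f0 h s0 RM.smult_closed M.component_carrier by auto
qed

lemma carrier_graded_submodule:
  assumes M: "graded_right_module A M" "ring A"
  shows "graded_submodule A M (carrier M)"
proof -
  interpret M: graded_group M "mgrade M" using M(1) by (rule graded_right_module_graded_group)
  interpret RM: right_module A M using M by (simp add: graded_right_module_def)
  show ?thesis unfolding graded_submodule_def using RM.smult_closed M.component_carrier by auto
qed

context graded_ring
begin

lemma smult_zero_left:
  assumes "right_module A M" "m \<in> carrier M"
  shows "\<zero> \<odot>\<^bsub>M\<^esub> m = \<zero>\<^bsub>M\<^esub>"
proof -
  interpret R: right_module A M by fact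
  show ?thesis
    by (rule additive_zero[where f = "\<lambda>a. a \<odot>\<^bsub>M\<^esub> m"])
      (use assms R.smult_closed R.smult_add_scalar R.M.abelian_group_axioms abelian_group_axioms in auto)
qed

text \<open>This is the universal property of the graded free module, for prescribed homogeneous
  images of the generators.\<close>

lemma free_graded_eval_hom:
  assumes M: "graded_right_module A M" and g: "\<And>s. s \<in> S \<Longrightarrow> g s \<in> mgrade M (\<delta> s)"
  shows "(\<lambda>f\<in>carrier (free_graded A S \<delta>). \<Oplus>\<^bsub>M\<^esub>s\<in>{s. f s \<noteq> \<zero>}. f s \<odot>\<^bsub>M\<^esub> g s)
         \<in> hom_of_degree A 0 (free_graded A S \<delta>) M"
proof -
  let ?F = "free_graded A S \<delta>"
  interpret M: graded_group M "mgrade M" using M by (rule graded_right_module_graded_group)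
  interpret R: right_module A M using M by (simp add: graded_right_module_def)
  interpret F: right_module A ?F by (rule free_graded_right_module)
  have gc: "s \<in> S \<Longrightarrow> g s \<in> carrier M" for s using g M.grade_carrier by blast
  define E where "E f = (\<Oplus>\<^bsub>M\<^esub>s\<in>{s. f s \<noteq> \<zero>}. f s \<odot>\<^bsub>M\<^esub> g s)" for f
  \<comment> \<open>The support of a sum or of a multiple may shrink, so sums are compared over any
    finite superset of the support.\<close>
  have E_eq: "E f = (\<Oplus>\<^bsub>M\<^esub>s\<in>J. f s \<odot>\<^bsub>M\<^esub> g s)"
    if "f \<in> carrier ?F" "finite J" "{s. f s \<noteq> \<zero>} \<subseteq> J" "J \<subseteq> S" for f J
    unfolding E_def using that gc R.smult_closed smult_zero_left[OF R.right_module_axioms]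
    by (intro M.add.finprod_mono_neutral_cong_left) auto
  have E_car: "E f \<in> carrier M" if "f \<in> carrier ?F" for f
    unfolding E_def using that gc R.smult_closed by (intro M.finsum_closed) auto
  have E_add: "E (\<lambda>s. f s \<oplus> f' s) = E f \<oplus>\<^bsub>M\<^esub> E f'" if f: "f \<in> carrier ?F" "f' \<in> carrier ?F" for f f'
  proof -
    let ?J = "{s. f s \<noteq> \<zero>} \<union> {s. f' s \<noteq> \<zero>}"
    have J: "finite ?J" "?J \<subseteq> S" using f by auto
    have sum: "(\<lambda>s. f s \<oplus> f' s) \<in> carrier ?F" using F.M.a_closed[OF f] by simp
    have "{s. f s \<oplus> f' s \<noteq> \<zero>} \<subseteq> ?J" by auto
    then have "E (\<lambda>s. f s \<oplus> f' s) = (\<Oplus>\<^bsub>M\<^esub>s\<in>?J. (f s \<oplus> f' s) \<odot>\<^bsub>M\<^esub> g s)"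
      by (rule E_eq[OF sum J(1) _ J(2)])
    also have "\<dots> = (\<Oplus>\<^bsub>M\<^esub>s\<in>?J. f s \<odot>\<^bsub>M\<^esub> g s \<oplus>\<^bsub>M\<^esub> f' s \<odot>\<^bsub>M\<^esub> g s)"
      using f gc J R.smult_closed R.smult_add_scalar by (intro M.finsum_cong') auto
    also have "\<dots> = E f \<oplus>\<^bsub>M\<^esub> E f'"
      using f gc J R.smult_closed
      by (subst M.finsum_addf) (auto simp: E_eq[OF f(1) J(1) _ J(2)] E_eq[OF f(2) J(1) _ J(2)])
    finally show ?thesis .
  qed
  have E_smult: "E (\<lambda>s. f s \<otimes> r) = r \<odot>\<^bsub>M\<^esub> E f" if f: "f \<in> carrier ?F" and r: "r \<in> carrier A" for f r
  proof -
    let ?J = "{s. f s \<noteq> \<zero>}"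
    have J: "finite ?J" "?J \<subseteq> S" using f by auto
    have fr: "(\<lambda>s. f s \<otimes> r) \<in> carrier ?F" using F.smult_closed[OF r f] by simp
    have "{s. f s \<otimes> r \<noteq> \<zero>} \<subseteq> ?J" using r by auto
    then have "E (\<lambda>s. f s \<otimes> r) = (\<Oplus>\<^bsub>M\<^esub>s\<in>?J. (f s \<otimes> r) \<odot>\<^bsub>M\<^esub> g s)"
      by (rule E_eq[OF fr J(1) _ J(2)])
    also have "\<dots> = (\<Oplus>\<^bsub>M\<^esub>s\<in>?J. r \<odot>\<^bsub>M\<^esub> (f s \<odot>\<^bsub>M\<^esub> g s))"
      using f r gc J R.smult_closed R.smult_assoc_right by (intro M.finsum_cong') auto
    also have "\<dots> = r \<odot>\<^bsub>M\<^esub> E f"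
      unfolding E_def using f r gc J R.smult_closed R.smult_add_module M.abelian_group_axioms
      by (intro additive_finsum[symmetric, where f = "\<lambda>x. r \<odot>\<^bsub>M\<^esub> x"]) auto
    finally show ?thesis .
  qed
  have E_deg: "E f \<in> mgrade M j" if f: "f \<in> mgrade ?F j" for f j
    unfolding E_def
  proof (rule finsum_closed_in)
    fix s assume "s \<in> {s. f s \<noteq> \<zero>}"
    then have "s \<in> S" "f s \<in> rgrade A (j - \<delta> s)" using f by auto
    then have "f s \<odot>\<^bsub>M\<^esub> g s \<in> mgrade M (\<delta> s + (j - \<delta> s))"
      using M g unfolding graded_right_module_def by blast
    then show "f s \<odot>\<^bsub>M\<^esub> g s \<in> mgrade M j" by simp
  qed (use f M.abelian_group_axioms M.grade_zero M.grade_add M.grade_carrier in auto)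
  have sub: "mgrade ?F j \<subseteq> carrier ?F" for j using G.grade_carrier by auto
  have "(\<lambda>f\<in>carrier ?F. E f) \<in> hom_of_degree A 0 ?F M"
    unfolding hom_of_degree_def
  proof (intro CollectI conjI ballI allI)
    show "(\<lambda>f\<in>carrier ?F. E f) \<in> carrier ?F \<rightarrow>\<^sub>E carrier M" using E_car by auto
    fix f f' assume f: "f \<in> carrier ?F" "f' \<in> carrier ?F"
    then show "restrict E (carrier ?F) (f \<oplus>\<^bsub>?F\<^esub> f') = restrict E (carrier ?F) f \<oplus>\<^bsub>M\<^esub> restrict E (carrier ?F) f'"
      using F.M.a_closed[OF f] E_add[OF f] by (simp del: free_graded_simps(1))
  next
    fix r f assume r: "r \<in> carrier A" and f: "f \<in> carrier ?F"
    then show "restrict E (carrier ?F) (r \<odot>\<^bsub>?F\<^esub> f) = r \<odot>\<^bsub>M\<^esub> restrict E (carrier ?F) f"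
      using F.smult_closed[OF r f] E_smult[OF f r] by (simp del: free_graded_simps(1))
  next
    fix j show "restrict E (carrier ?F) ` mgrade ?F j \<subseteq> mgrade M (j + 0)"
      using sub E_deg by (auto simp del: free_graded_simps)
  qed
  then show ?thesis unfolding E_def .
qed

text \<open>All homogeneous elements of \<open>Z\<close> serve as generators, indexed through
  \<open>j\<close>. They generate because \<open>Z\<close> contains the components of its
  elements.\<close>

lemma free_cover:
  fixes M :: "('a, 'm, 'y) graded_module_scheme" and j :: "'m \<Rightarrow> 's"
  assumes M: "graded_right_module A M" and Z: "graded_submodule A M Z"
    and j: "inj_on j (carrier M)" and nt: "\<one> \<noteq> \<zero>"
  obtains S \<delta> d where
    "d \<in> hom_of_degree A 0 (free_graded A (S :: 's set) \<delta>) M" "d ` carrier (free_graded A S \<delta>) = Z"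
proof -
  interpret M: graded_group M "mgrade M" using M by (rule graded_right_module_graded_group)
  interpret R: right_module A M using M by (simp add: graded_right_module_def)
  define Y where "Y = Z \<inter> (\<Union>i. mgrade M i)"
  define S where "S = j ` Y"
  define g where "g = inv_into Y j"
  \<comment> \<open>The degree has to be chosen, since zero lies in every homogeneous part.\<close>
  define \<delta> where "\<delta> s = (SOME i. g s \<in> mgrade M i)" for s
  have Yc: "Y \<subseteq> carrier M" using M.grade_carrier unfolding Y_def by auto
  have jY: "inj_on j Y" using j Yc inj_on_subset by blast
  have gY: "g s \<in> Y" if "s \<in> S" for s using that unfolding g_def S_def by (rule inv_into_into)
  have gj: "g (j y) = y" if "y \<in> Y" for y using that jY unfolding g_def by simp
  have g: "g s \<in> mgrade M (\<delta> s)" if "s \<in> S" for s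
    unfolding \<delta>_def by (rule someI_ex) (use gY[OF that] in \<open>auto simp: Y_def\<close>)
  let ?F = "free_graded A S \<delta>"
  define d where "d = (\<lambda>f\<in>carrier ?F. \<Oplus>\<^bsub>M\<^esub>s\<in>{s. f s \<noteq> \<zero>}. f s \<odot>\<^bsub>M\<^esub> g s)"
  have hom: "d \<in> hom_of_degree A 0 ?F M"
    unfolding d_def by (rule free_graded_eval_hom[OF M g])
  have Zp: "Z \<subseteq> carrier M" "\<zero>\<^bsub>M\<^esub> \<in> Z" "\<And>x y. x \<in> Z \<Longrightarrow> y \<in> Z \<Longrightarrow> x \<oplus>\<^bsub>M\<^esub> y \<in> Z"
    "\<And>x a. x \<in> Z \<Longrightarrow> a \<in> carrier A \<Longrightarrow> a \<odot>\<^bsub>M\<^esub> x \<in> Z" "\<And>x i. x \<in> Z \<Longrightarrow> M.cmp i x \<in> Z"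
    using Z unfolding graded_submodule_def by auto
  have "d ` carrier ?F = Z"
  proof (intro subset_antisym subsetI)
    fix x assume "x \<in> d ` carrier ?F"
    then obtain f where f: "f \<in> carrier ?F" "x = (\<Oplus>\<^bsub>M\<^esub>s\<in>{s. f s \<noteq> \<zero>}. f s \<odot>\<^bsub>M\<^esub> g s)"
      unfolding d_def by auto
    have "g s \<in> Z" if "s \<in> {s. f s \<noteq> \<zero>}" for s using gY f that unfolding Y_def by auto
    then show "x \<in> Z"
      unfolding f(2) using f(1) Zp M.abelian_group_axioms by (intro finsum_closed_in[of M Z]) auto
  next
    fix x assume x: "x \<in> Z"
    then have xc: "x \<in> carrier M" using Zp by auto
    have gen: "y \<in> d ` carrier ?F" if y: "y \<in> Y" for y
    proof -
      have sS: "j y \<in> S" using y S_def by auto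
      have *: "{s. free_generator A (j y) s \<noteq> \<zero>} = {j y}" using nt by (auto simp: free_generator_def)
      have c: "free_generator A (j y) \<in> carrier ?F" using sS nt by (auto simp: free_generator_def)
      have "d (free_generator A (j y)) = free_generator A (j y) (j y) \<odot>\<^bsub>M\<^esub> g (j y)"
      proof -
        have "g (j y) \<in> carrier M" "free_generator A (j y) (j y) \<in> carrier A"
          using y Yc gj by (auto simp: free_generator_def)
        then have "(\<Oplus>\<^bsub>M\<^esub>s\<in>{j y}. free_generator A (j y) s \<odot>\<^bsub>M\<^esub> g s) = free_generator A (j y) (j y) \<odot>\<^bsub>M\<^esub> g (j y)"
          using R.smult_closed by (intro M.finsum_single) auto
        then show ?thesis using c * by (simp add: d_def del: free_graded_simps)
      qed
      also have "\<dots> = y" using y Yc gj R.smult_one_right by (auto simp: free_generator_def)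
      finally show ?thesis using c by (metis image_eqI)
    qed
    have dF: "abelian_group ?F" by (rule free_graded_abelian_group)
    then interpret F: abelian_group ?F .
    have im: "\<zero>\<^bsub>M\<^esub> \<in> d ` carrier ?F" "\<And>x y. x \<in> d ` carrier ?F \<Longrightarrow> y \<in> d ` carrier ?F \<Longrightarrow> x \<oplus>\<^bsub>M\<^esub> y \<in> d ` carrier ?F"
      "d ` carrier ?F \<subseteq> carrier M"
    proof -
      have "d \<zero>\<^bsub>?F\<^esub> = \<zero>\<^bsub>M\<^esub>"
        by (rule additive_zero[OF dF M.abelian_group_axioms]) (use hom_of_degree_D[OF hom] in auto)
      then show "\<zero>\<^bsub>M\<^esub> \<in> d ` carrier ?F" using F.zero_closed by (metis image_eqI)
      fix x y assume "x \<in> d ` carrier ?F" "y \<in> d ` carrier ?F"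
      then show "x \<oplus>\<^bsub>M\<^esub> y \<in> d ` carrier ?F"
        using hom_of_degree_D(4)[OF hom] F.a_closed by (smt (verit) imageE image_eqI)
    qed (use hom_of_degree_D[OF hom] in auto)
    have "(\<Oplus>\<^bsub>M\<^esub>i\<in>{i. M.cmp i x \<noteq> \<zero>\<^bsub>M\<^esub>}. M.cmp i x) \<in> d ` carrier ?F"
    proof (rule finsum_closed_in[OF M.abelian_group_axioms im])
      show "M.cmp i x \<in> d ` carrier ?F" for i
        using gen Zp(5)[OF x] M.component_in[OF xc] unfolding Y_def by blast
    qed (use M.component_finite[OF xc] in auto)
    then show "x \<in> d ` carrier ?F" using M.component_sum[OF xc] by simp
  qed
  with hom show ?thesis by (rule that)
qed

text \<open>The inductive step in building a resolution: \<open>i\<close> embeds the carrier of the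
  free module into the index type, so the kernel is covered by a free module indexed in the same
  type.\<close>

lemma free_cover_kernel:
  fixes i :: "('s \<Rightarrow> 'a) \<Rightarrow> 's" and S :: "'s set"
  assumes nt: "\<one> \<noteq> \<zero>" and i: "inj_on i {f. finite {s. f s \<noteq> \<zero>}}"
    and N: "graded_right_module A N" and d: "d \<in> hom_of_degree A 0 (free_graded A S \<delta>) N"
  shows "\<exists>S' \<delta>' d'. d' \<in> hom_of_degree A 0 (free_graded A (S' :: 's set) \<delta>') (free_graded A S \<delta>) \<and>
      d' ` carrier (free_graded A S' \<delta>') = {x \<in> carrier (free_graded A S \<delta>). d x = \<zero>\<^bsub>N\<^esub>}"
proof -
  have i': "inj_on i (carrier (free_graded A S \<delta>))"
    by (rule inj_on_subset[OF i]) auto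
  show ?thesis
    by (rule free_cover[OF free_graded_graded_right_module kernel_graded_submodule[OF ring_axioms
        free_graded_graded_right_module N d] i' nt]) blast
qed

lemma graded_free_resolution_exists:
  fixes M :: "('a, 'm, 'y) graded_module_scheme" and e :: "'a \<Rightarrow> 's" and j :: "'m \<Rightarrow> 's"
  assumes M: "graded_right_module A M" and nt: "\<one> \<noteq> \<zero>"
    and inf: "infinite (UNIV :: 's set)" and e: "inj e" and j: "inj_on j (carrier M)"
  shows "\<exists>P :: ('a, 'm, 's \<Rightarrow> 'a) resolution. graded_free_resolution A M P"
proof -
  obtain i :: "('s \<Rightarrow> 'a) \<Rightarrow> 's" where i: "inj_on i {f. finite {s. f s \<noteq> \<zero>}}"
    using finite_support_embedding[OF inf e] by blast
  obtain S0 \<delta>0 a where a: "a \<in> hom_of_degree A 0 (free_graded A (S0 :: 's set) \<delta>0) M"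
    "a ` carrier (free_graded A S0 \<delta>0) = carrier M"
    using free_cover[OF M carrier_graded_submodule[OF M ring_axioms] j nt] by metis
  note step = free_cover_kernel[OF nt i]
  define T where "T = (\<lambda>t :: ('s set \<times> ('s \<Rightarrow> int)). free_graded A (fst t) (snd t))"
  \<comment> \<open>States are triples of target data, source data and differential.
    \<open>PP\<close> types the differential and at stage 0 ties it to the augmentation;
    \<open>QQ\<close> makes consecutive triples overlap and be exact where they meet. The pairs
    \<open>(S, \<delta>)\<close> are carried along in place of the modules.\<close>
  define PP where "PP = (\<lambda>n (t, t', d). d \<in> hom_of_degree A 0 (T t') (T t) \<and>
    (n = (0::nat) \<longrightarrow> t = (S0, \<delta>0) \<and> d ` carrier (T t') = {x \<in> carrier (T t). a x = \<zero>\<^bsub>M\<^esub>}))"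
  define QQ where "QQ = (\<lambda>(n::nat) (t, t', d) (u, u', d'). u = t' \<and>
    d' ` carrier (T u') = {x \<in> carrier (T t'). d x = \<zero>\<^bsub>T t\<^esub>})"
  have "\<exists>x. PP 0 x"
    using step[OF M a(1)] by (auto simp: PP_def T_def)
  moreover have "\<exists>y. PP (Suc n) y \<and> QQ n x y" if "PP n x" for n x
    using that step[OF free_graded_graded_right_module]
    by (cases x) (auto simp: PP_def QQ_def T_def simp del: free_graded_simps)
  ultimately obtain f where f: "\<And>n. PP n (f n) \<and> QQ n (f n) (f (Suc n))"
    using dependent_nat_choice[of PP QQ] by blast
  define t where "t n = fst (f n)" for n
  define d where "d n = snd (snd (f n))" for n
  have t': "fst (snd (f n)) = t (Suc n)" for n
    using f[of n] by (auto simp: QQ_def t_def split: prod.splits)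
  have d: "d n \<in> hom_of_degree A 0 (T (t (Suc n))) (T (t n))" for n
    using f[of n] t'[of n] by (auto simp: PP_def t_def d_def split: prod.splits)
  have t0: "t 0 = (S0, \<delta>0)" and d0: "d 0 ` carrier (T (t (Suc 0))) = {x \<in> carrier (T (t 0)). a x = \<zero>\<^bsub>M\<^esub>}"
    using f[of 0] t'[of 0] by (auto simp: PP_def t_def d_def split: prod.splits)
  have dS: "d (Suc n) ` carrier (T (t (Suc (Suc n)))) = {x \<in> carrier (T (t (Suc n))). d n x = \<zero>\<^bsub>T (t n)\<^esub>}" for n
  proof -
    have fn: "f n = (t n, t (Suc n), d n)" for n
      by (simp add: prod_eq_iff t') (simp add: t_def d_def)
    have "QQ n (t n, t (Suc n), d n) (t (Suc n), t (Suc (Suc n)), d (Suc n))"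
      using f[of n] fn by metis
    then show ?thesis unfolding QQ_def prod.case by (rule conjunct2)
  qed
  have "graded_free_resolution A M \<lparr>term_of = (\<lambda>n. T (t n)), diff_of = d, aug_of = a\<rparr>"
    unfolding graded_free_resolution_def
    using d d0 dS a t0
    by (simp add: T_def free_graded_graded_free_module[OF nt] del: free_graded_simps)
  then show ?thesis by blast
qed

end

section \<open>The top of a nonnegatively graded ring\<close>

lemma quotient_module_simps:
  "carrier (quotient_module M N) = a_rcosets\<^bsub>M\<^esub> N"
  "\<zero>\<^bsub>quotient_module M N\<^esub> = N"
  "X \<oplus>\<^bsub>quotient_module M N\<^esub> Y = X <+>\<^bsub>M\<^esub> Y"
  "r \<odot>\<^bsub>quotient_module M N\<^esub> X = (\<Union>x\<in>X. N +>\<^bsub>M\<^esub> (r \<odot>\<^bsub>M\<^esub> x))"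
  "mgrade (quotient_module M N) i = (\<lambda>x. N +>\<^bsub>M\<^esub> x) ` mgrade M i"
  by (simp_all add: quotient_module_def)

locale module_quotient =
  fixes A :: "('a, 'z) graded_ring_scheme" and M :: "('a, 'm, 'y) graded_module_scheme" and Z
  assumes A: "graded_ring A" and M: "graded_right_module A M" and Z: "graded_submodule A M Z"
begin

interpretation A: graded_ring A by (rule A)
interpretation M: graded_group M "mgrade M" using M by (rule graded_right_module_graded_group)
interpretation R: right_module A M using M by (simp add: graded_right_module_def)

abbreviation "MZ \<equiv> quotient_module M Z"
abbreviation cs :: "'m \<Rightarrow> 'm set" where "cs x \<equiv> Z +>\<^bsub>M\<^esub> x"

lemma submodule_facts:
  "Z \<subseteq> carrier M" "\<zero>\<^bsub>M\<^esub> \<in> Z" "\<And>x y. x \<in> Z \<Longrightarrow> y \<in> Z \<Longrightarrow> x \<oplus>\<^bsub>M\<^esub> y \<in> Z"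
  "\<And>x a. x \<in> Z \<Longrightarrow> a \<in> carrier A \<Longrightarrow> a \<odot>\<^bsub>M\<^esub> x \<in> Z" "\<And>x i. x \<in> Z \<Longrightarrow> M.cmp i x \<in> Z"
  using Z unfolding graded_submodule_def by auto

text \<open>\<open>graded_submodule\<close> does not list negatives; they arise as multiples by
  -1.\<close>

lemma submodule_minus_closed: assumes "x \<in> Z" shows "\<ominus>\<^bsub>M\<^esub> x \<in> Z"
proof -
  have xc: "x \<in> carrier M" using assms submodule_facts by auto
  have "(\<ominus>\<^bsub>A\<^esub> \<one>\<^bsub>A\<^esub>) \<odot>\<^bsub>M\<^esub> x \<oplus>\<^bsub>M\<^esub> x = (\<ominus>\<^bsub>A\<^esub> \<one>\<^bsub>A\<^esub> \<oplus>\<^bsub>A\<^esub> \<one>\<^bsub>A\<^esub>) \<odot>\<^bsub>M\<^esub> x"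
    using xc R.smult_add_scalar[of "\<ominus>\<^bsub>A\<^esub> \<one>\<^bsub>A\<^esub>" "\<one>\<^bsub>A\<^esub>" x] R.smult_one_right by simp
  also have "\<dots> = \<zero>\<^bsub>M\<^esub>"
    using A.smult_zero_left[OF R.right_module_axioms xc] by (simp add: A.l_neg)
  finally have "\<ominus>\<^bsub>M\<^esub> x = (\<ominus>\<^bsub>A\<^esub> \<one>\<^bsub>A\<^esub>) \<odot>\<^bsub>M\<^esub> x"
    using xc by (intro M.minus_equality) (auto intro: R.smult_closed)
  then show ?thesis using submodule_facts(4)[OF assms, of "\<ominus>\<^bsub>A\<^esub> \<one>\<^bsub>A\<^esub>"] by simp
qed

lemma sub: "additive_subgroup Z M"
  by (intro additive_subgroup.intro M.add.subgroupI) (use submodule_facts submodule_minus_closed in auto)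

interpretation ZS: abelian_subgroup Z M
  by (rule abelian_subgroupI3[OF sub M.abelian_group_axioms])

lemma carrier_MZ: "carrier MZ = cs ` carrier M"
  by (auto simp: quotient_module_simps A_RCOSETS_def RCOSETS_def a_r_coset_def)

lemma cs_add: "x \<in> carrier M \<Longrightarrow> y \<in> carrier M \<Longrightarrow> cs x <+>\<^bsub>M\<^esub> cs y = cs (x \<oplus>\<^bsub>M\<^esub> y)"
  by (rule ZS.a_rcos_sum)

lemma cs_eq_iff: "x \<in> carrier M \<Longrightarrow> y \<in> carrier M \<Longrightarrow> cs x = cs y \<longleftrightarrow> (\<exists>z\<in>Z. x = z \<oplus>\<^bsub>M\<^esub> y)"
  using ZS.a_rcos_self[of x] M.a_repr_independence[OF _ _ sub[THEN additive_subgroup.a_subgroup], of x y]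
  by (auto simp: a_r_coset_def')

lemma cs_zero_iff: "x \<in> carrier M \<Longrightarrow> cs x = Z \<longleftrightarrow> x \<in> Z"
  using cs_eq_iff[of x "\<zero>\<^bsub>M\<^esub>"] submodule_facts(1) by (auto simp: M.a_coset_add_zero)

text \<open>The union that defines scalar multiplication on the quotient runs over copies of a
  single coset, because \<open>Z\<close> is stable under scalars.\<close>

lemma cs_smult:
  assumes r: "r \<in> carrier A" and x: "x \<in> carrier M"
  shows "(\<Union>y\<in>cs x. cs (r \<odot>\<^bsub>M\<^esub> y)) = cs (r \<odot>\<^bsub>M\<^esub> x)"
proof -
  have "cs (r \<odot>\<^bsub>M\<^esub> y) = cs (r \<odot>\<^bsub>M\<^esub> x)" if y: "y \<in> cs x" for y
  proof -
    obtain z where z: "z \<in> Z" "y = z \<oplus>\<^bsub>M\<^esub> x" using y by (auto simp: a_r_coset_def')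
    then have "r \<odot>\<^bsub>M\<^esub> y = r \<odot>\<^bsub>M\<^esub> z \<oplus>\<^bsub>M\<^esub> r \<odot>\<^bsub>M\<^esub> x" "y \<in> carrier M"
      using R.smult_add_module[OF r _ x, of z] submodule_facts(1) x by auto
    then show ?thesis using r x z submodule_facts(4)[OF z(1) r] R.smult_closed by (subst cs_eq_iff) auto
  qed
  then show ?thesis using ZS.a_rcos_self[OF x] by blast
qed

lemma MZ_abelian_group: "abelian_group MZ"
proof (rule abelian_groupI)
  fix X assume "X \<in> carrier MZ"
  then obtain x where x: "x \<in> carrier M" "X = cs x" by (auto simp: carrier_MZ)
  show "\<exists>Y\<in>carrier MZ. Y \<oplus>\<^bsub>MZ\<^esub> X = \<zero>\<^bsub>MZ\<^esub>"
    using x cs_add[of "\<ominus>\<^bsub>M\<^esub> x" x]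
    by (intro bexI[of _ "cs (\<ominus>\<^bsub>M\<^esub> x)"])
      (auto simp: carrier_MZ quotient_module_simps(2,3) M.l_neg M.a_coset_add_zero submodule_facts(1))
next
  show "\<zero>\<^bsub>MZ\<^esub> \<in> carrier MZ"
    using cs_zero_iff[of "\<zero>\<^bsub>M\<^esub>"] submodule_facts(2) by (auto simp: carrier_MZ quotient_module_simps(2) intro!: image_eqI[of _ _ "\<zero>\<^bsub>M\<^esub>"])
next
  fix X assume "X \<in> carrier MZ"
  then obtain x where x: "x \<in> carrier M" "X = cs x" by (auto simp: carrier_MZ)
  have "cs \<zero>\<^bsub>M\<^esub> = Z" using cs_zero_iff[of "\<zero>\<^bsub>M\<^esub>"] submodule_facts(2) by auto
  then show "\<zero>\<^bsub>MZ\<^esub> \<oplus>\<^bsub>MZ\<^esub> X = X"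
    using cs_add[of "\<zero>\<^bsub>M\<^esub>" x] x by (simp add: quotient_module_simps(2,3))
qed (auto simp: carrier_MZ quotient_module_simps(3) cs_add M.a_ac)

lemma MZ_right_module: "right_module A MZ"
proof -
  interpret Q: abelian_group MZ by (rule MZ_abelian_group)
  show ?thesis
  proof unfold_locales
    have sm: "r \<odot>\<^bsub>MZ\<^esub> cs x = cs (r \<odot>\<^bsub>M\<^esub> x)" if "r \<in> carrier A" "x \<in> carrier M" for r x
      unfolding quotient_module_simps(4) by (rule cs_smult[OF that])
    have ad: "cs x \<oplus>\<^bsub>MZ\<^esub> cs y = cs (x \<oplus>\<^bsub>M\<^esub> y)" if "x \<in> carrier M" "y \<in> carrier M" for x y
      unfolding quotient_module_simps(3) by (rule cs_add[OF that])
    have mem: "cs x \<in> carrier MZ" if "x \<in> carrier M" for x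
      using that by (simp add: carrier_MZ)
    fix r s X assume r: "r \<in> carrier A" and X: "X \<in> carrier MZ"
    obtain x where x: "x \<in> carrier M" "X = cs x" using X by (auto simp: carrier_MZ)
    show "r \<odot>\<^bsub>MZ\<^esub> X \<in> carrier MZ" using sm r x mem R.smult_closed by simp
    show "r \<odot>\<^bsub>MZ\<^esub> (X \<oplus>\<^bsub>MZ\<^esub> Y) = r \<odot>\<^bsub>MZ\<^esub> X \<oplus>\<^bsub>MZ\<^esub> r \<odot>\<^bsub>MZ\<^esub> Y" if Y: "Y \<in> carrier MZ" for Y
    proof -
      obtain y where y: "y \<in> carrier M" "Y = cs y" using Y by (auto simp: carrier_MZ)
      show ?thesis using sm ad r x y R.smult_closed R.smult_add_module by simp
    qed
    assume s: "s \<in> carrier A"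
    show "(r \<oplus>\<^bsub>A\<^esub> s) \<odot>\<^bsub>MZ\<^esub> X = r \<odot>\<^bsub>MZ\<^esub> X \<oplus>\<^bsub>MZ\<^esub> s \<odot>\<^bsub>MZ\<^esub> X"
      using sm ad r s x R.smult_closed R.smult_add_scalar by simp
    show "(r \<otimes>\<^bsub>A\<^esub> s) \<odot>\<^bsub>MZ\<^esub> X = s \<odot>\<^bsub>MZ\<^esub> (r \<odot>\<^bsub>MZ\<^esub> X)"
      using sm ad r s x R.smult_closed R.smult_assoc_right by simp
  next
    fix X assume "X \<in> carrier MZ"
    then obtain x where x: "x \<in> carrier M" "X = cs x" by (auto simp: carrier_MZ)
    then show "\<one>\<^bsub>A\<^esub> \<odot>\<^bsub>MZ\<^esub> X = X"
      unfolding x(2) quotient_module_simps(4) using cs_smult[of "\<one>\<^bsub>A\<^esub>" x] R.smult_one_right by simp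
  qed
qed

lemma cs_hom: "(\<lambda>x\<in>carrier M. cs x) \<in> hom_of_degree A 0 M MZ"
  unfolding hom_of_degree_def
proof (intro CollectI conjI ballI allI)
  show "restrict cs (carrier M) \<in> carrier M \<rightarrow>\<^sub>E carrier MZ" by (auto simp: carrier_MZ)
  show "restrict cs (carrier M) ` mgrade M j \<subseteq> mgrade MZ (j + 0)" for j
    using M.grade_carrier by (auto simp: quotient_module_simps(5))
qed (simp_all add: quotient_module_simps(3,4) cs_add cs_smult R.smult_closed)

lemma MZ_graded_right_module: "graded_right_module A MZ"
proof -
  interpret Q: abelian_group MZ by (rule MZ_abelian_group)
  have Qg: "x \<in> mgrade M i \<Longrightarrow> cs x \<in> mgrade MZ i" for x i
    by (auto simp: quotient_module_simps(5))
  have gr: "additive_subgroup (mgrade MZ i) MZ" for i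
  proof (intro additive_subgroup.intro Q.add.subgroupI)
    show "mgrade MZ i \<subseteq> carrier MZ"
      using M.grade_carrier by (auto simp: carrier_MZ quotient_module_simps(5))
    show "mgrade MZ i \<noteq> {}" using M.grade_zero by (auto simp: quotient_module_simps(5))
  next
    fix X assume "X \<in> mgrade MZ i"
    then obtain x where x: "x \<in> mgrade M i" "X = cs x" by (auto simp: quotient_module_simps(5))
    then have xc: "x \<in> carrier M" using M.grade_carrier by auto
    have "\<ominus>\<^bsub>MZ\<^esub> X = cs (\<ominus>\<^bsub>M\<^esub> x)"
      using xc x cs_add[of "\<ominus>\<^bsub>M\<^esub> x" x] cs_zero_iff[of "\<zero>\<^bsub>M\<^esub>"] submodule_facts(2)
      by (intro Q.minus_equality) (auto simp: carrier_MZ quotient_module_simps(2,3) M.l_neg)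
    then show "\<ominus>\<^bsub>MZ\<^esub> X \<in> mgrade MZ i"
      using x additive_subgroup.a_inv_closed[OF M.grade_subgroup] Qg by auto
  next
    fix X Y assume "X \<in> mgrade MZ i" "Y \<in> mgrade MZ i"
    then obtain x y where "x \<in> mgrade M i" "X = cs x" "y \<in> mgrade M i" "Y = cs y"
      by (auto simp: quotient_module_simps(5))
    then show "X \<oplus>\<^bsub>MZ\<^esub> Y \<in> mgrade MZ i"
      using cs_add M.grade_carrier M.grade_add by (auto simp: quotient_module_simps(3,5))
  qed
  \<comment> \<open>The component of a coset is computed on a chosen representative; another choice
    changes it by a component of an element of \<open>Z\<close>, which lies in \<open>Z\<close>
    again.\<close>
  define p where "p i X = cs (M.cmp i (SOME x. x \<in> carrier M \<and> X = cs x))" for i X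
  have p: "p i (cs x) = cs (M.cmp i x)" if x: "x \<in> carrier M" for i x
  proof -
    define y where "y = (SOME y. y \<in> carrier M \<and> cs x = cs y)"
    have y: "y \<in> carrier M \<and> cs x = cs y" unfolding y_def by (rule someI_ex) (use x in auto)
    then obtain z where z: "z \<in> Z" "y = z \<oplus>\<^bsub>M\<^esub> x" using x cs_eq_iff[of y x] by auto
    then have "M.cmp i y = M.cmp i z \<oplus>\<^bsub>M\<^esub> M.cmp i x"
      using x submodule_facts(1) M.component_add by auto
    then have "cs (M.cmp i y) = cs (M.cmp i x)"
      using x y z submodule_facts(5) M.component_carrier by (subst cs_eq_iff) auto
    then show ?thesis by (simp add: p_def y_def)
  qed
  have zz: "cs \<zero>\<^bsub>M\<^esub> = Z" using cs_zero_iff[of "\<zero>\<^bsub>M\<^esub>"] submodule_facts(2) by auto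
  have sub': "{i. cs (M.cmp i x) \<noteq> Z} \<subseteq> {i. M.cmp i x \<noteq> \<zero>\<^bsub>M\<^esub>}" for x
  proof (rule Collect_mono, rule impI)
    fix i assume "cs (M.cmp i x) \<noteq> Z"
    then show "M.cmp i x \<noteq> \<zero>\<^bsub>M\<^esub>" using zz by metis
  qed
  have "internal_direct_sum MZ (mgrade MZ)"
  proof (rule Q.internal_direct_sumI[where p = p])
    fix i X assume "X \<in> carrier MZ"
    then obtain x where x: "x \<in> carrier M" "X = cs x" by (auto simp: carrier_MZ)
    then show "p i X \<in> mgrade MZ i" using p Qg M.component_in by auto
  next
    fix i X Y assume "X \<in> carrier MZ" "Y \<in> carrier MZ"
    then obtain x y where "x \<in> carrier M" "X = cs x" "y \<in> carrier M" "Y = cs y" by (auto simp: carrier_MZ)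
    then show "p i (X \<oplus>\<^bsub>MZ\<^esub> Y) = p i X \<oplus>\<^bsub>MZ\<^esub> p i Y"
      using p M.component_carrier by (simp add: quotient_module_simps(3) cs_add M.component_add)
  next
    fix i X assume "X \<in> mgrade MZ i"
    then obtain x where x: "x \<in> mgrade M i" "X = cs x" by (auto simp: quotient_module_simps(5))
    then show "p i X = X" using p M.grade_carrier M.component_homogeneous[OF x(1), of i] by simp
  next
    fix i j X assume "X \<in> mgrade MZ j" and ij: "i \<noteq> j"
    then obtain x where x: "x \<in> mgrade M j" "X = cs x" by (auto simp: quotient_module_simps(5))
    then show "p i X = \<zero>\<^bsub>MZ\<^esub>"
      using p M.grade_carrier M.component_homogeneous[OF x(1), of i] ij zz
      by (simp add: quotient_module_simps(2))
  next
    fix X assume "X \<in> carrier MZ"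
    then obtain x where x: "x \<in> carrier M" "X = cs x" by (auto simp: carrier_MZ)
    show fin: "finite {i. p i X \<noteq> \<zero>\<^bsub>MZ\<^esub>}"
      using x p finite_subset[OF sub' M.component_finite[OF x(1)]] by (simp add: quotient_module_simps(2))
    let ?J = "{i. M.cmp i x \<noteq> \<zero>\<^bsub>M\<^esub>}"
    have "X = cs (finsum M (\<lambda>i. M.cmp i x) ?J)" using M.component_sum x by simp
    also have "\<dots> = finsum MZ (\<lambda>i. cs (M.cmp i x)) ?J"
      using x M.component_carrier M.component_finite M.abelian_group_axioms Q.abelian_group_axioms
      by (intro additive_finsum) (auto simp: carrier_MZ quotient_module_simps(3) cs_add)
    also have "\<dots> = finsum MZ (\<lambda>i. p i X) ?J" using p x by simp
    also have "\<dots> = finsum MZ (\<lambda>i. p i X) {i. p i X \<noteq> \<zero>\<^bsub>MZ\<^esub>}"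
      using x p M.component_carrier M.component_finite sub'
      by (intro Q.finsum_support[symmetric]) (auto simp: carrier_MZ quotient_module_simps(2))
    finally show "X = finsum MZ (\<lambda>i. p i X) {i. p i X \<noteq> \<zero>\<^bsub>MZ\<^esub>}" .
  qed (rule gr)
  moreover have "a \<odot>\<^bsub>MZ\<^esub> m \<in> mgrade MZ (i + j)" if m: "m \<in> mgrade MZ i" and a: "a \<in> rgrade A j" for i j m a
  proof -
    obtain x where x: "x \<in> mgrade M i" "m = cs x" using m by (auto simp: quotient_module_simps(5))
    then have "a \<odot>\<^bsub>M\<^esub> x \<in> mgrade M (i + j)" using M a unfolding graded_right_module_def by blast
    then show ?thesis
      using x a cs_smult[of a x] A.G.grade_carrier M.grade_carrier Qg by (simp add: quotient_module_simps(4))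
  qed
  ultimately show ?thesis unfolding graded_right_module_def using MZ_right_module by blast
qed

end

section \<open>The regular module\<close>

lemma regular_module_simps [simp]:
  "carrier (regular_module A) = carrier A" "\<zero>\<^bsub>regular_module A\<^esub> = \<zero>\<^bsub>A\<^esub>"
  "x \<oplus>\<^bsub>regular_module A\<^esub> y = x \<oplus>\<^bsub>A\<^esub> y" "r \<odot>\<^bsub>regular_module A\<^esub> x = x \<otimes>\<^bsub>A\<^esub> r"
  "mgrade (regular_module A) = rgrade A"
  by (simp_all add: regular_module_def)

text \<open>The regular module shares the additive structure of the ring, so subgroups, sums and
  components coincide and the grading of \<open>A\<close> transfers.\<close>

lemma regular_module_subgroup:
  "subgroup H (add_monoid (regular_module A)) = subgroup H (add_monoid A)"
  by (simp add: regular_module_def subgroup_def m_inv_def)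

lemma regular_module_finsum: "finsum (regular_module A) f F = finsum A f F"
  by (simp add: finsum_def finprod_def regular_module_def)

lemma regular_module_component: "component (regular_module A) H = component A H"
  by (simp add: component_def[abs_def] regular_module_finsum)

lemma (in graded_ring) regular_module_abelian_group: "abelian_group (regular_module A)"
  by (rule abelian_groupI) (auto simp: a_ac intro: bexI[of _ "\<ominus> x" for x] l_neg)

lemma (in graded_ring) regular_module_graded: "graded_right_module A (regular_module A)"
proof -
  interpret N: abelian_group "regular_module A" by (rule regular_module_abelian_group)
  have "right_module A (regular_module A)"
    by unfold_locales (auto simp: r_distr l_distr m_assoc)
  moreover have "internal_direct_sum (regular_module A) (rgrade A)"
    using rgrade_direct unfolding internal_direct_sum_def additive_subgroup_def regular_module_subgroup
    by (simp add: regular_module_finsum)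
  ultimately show ?thesis
    unfolding graded_right_module_def using rgrade_mult by auto
qed

section \<open>Nonnegatively graded rings and the positive part\<close>

locale nonneg_graded_ring = graded_ring +
  assumes nonneg: "i < 0 \<Longrightarrow> rgrade A i = {\<zero>}" and nontrivial: "\<one> \<noteq> \<zero>"
begin

text \<open>As no degree is negative, an element without component in degree 0 is already a sum of
  terms of positive degree. Membership in A_+ becomes a single equation.\<close>

lemma positive_part_iff: "a \<in> positive_part A \<longleftrightarrow> a \<in> carrier A \<and> G.cmp 0 a = \<zero>"
proof
  assume "a \<in> positive_part A"
  then obtain F f where F: "finite F" "F \<subseteq> {1..}" "\<And>i. i \<in> F \<Longrightarrow> f i \<in> rgrade A i" "a = (\<Oplus>i\<in>F. f i)"
    unfolding positive_part_def by auto
  then have fc: "f \<in> F \<rightarrow> carrier A" using G.grade_carrier by auto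
  have "G.cmp 0 a = (\<Oplus>i\<in>F. G.cmp 0 (f i))" using F(4) G.component_finsum[OF F(1) fc] by simp
  also have "\<dots> = \<zero>"
  proof (intro add.finprod_one_eqI)
    fix i assume "i \<in> F"
    then have "f i \<in> rgrade A i" "i \<noteq> 0" using F by auto
    then show "G.cmp 0 (f i) = \<zero>" using G.component_homogeneous[of "f i" i 0] by simp
  qed
  finally show "a \<in> carrier A \<and> G.cmp 0 a = \<zero>" using F fc by simp
next
  assume a: "a \<in> carrier A \<and> G.cmp 0 a = \<zero>"
  let ?F = "{i. G.cmp i a \<noteq> \<zero>}"
  have "?F \<subseteq> {1..}"
  proof
    fix i assume i: "i \<in> ?F"
    have "\<not> i < 0" using nonneg[of i] G.component_in[of a i] a i by auto
    moreover have "i \<noteq> 0" using a i by auto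
    ultimately show "i \<in> {1..}" by auto
  qed
  then show "a \<in> positive_part A"
    unfolding positive_part_def
    using a G.component_finite[of a] G.component_sum[of a] G.component_in[of a]
    by (auto intro!: exI[of _ ?F] exI[of _ "\<lambda>i. G.cmp i a"])
qed

lemma grade_in_positive_part: "0 < i \<Longrightarrow> a \<in> rgrade A i \<Longrightarrow> a \<in> positive_part A"
  using G.component_homogeneous[of a i 0] G.grade_carrier by (auto simp: positive_part_iff)

lemma positive_part_graded_submodule: "graded_submodule A (regular_module A) (positive_part A)"
proof -
  have "G.cmp 0 (a \<otimes> r) = \<zero>" if a: "a \<in> carrier A" "G.cmp 0 a = \<zero>" and r: "r \<in> carrier A" for a r
  proof -
    let ?F = "{i. G.cmp i a \<noteq> \<zero>}"
    have F: "finite ?F" using G.component_finite a by auto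
    have cc: "\<And>i. G.cmp i a \<in> carrier A" using G.component_carrier a by auto
    have "a \<otimes> r = (\<Oplus>i\<in>?F. G.cmp i a) \<otimes> r" using G.component_sum a by simp
    also have "\<dots> = (\<Oplus>i\<in>?F. G.cmp i a \<otimes> r)" using F cc r by (intro finsum_ldistr) auto
    finally have "G.cmp 0 (a \<otimes> r) = (\<Oplus>i\<in>?F. G.cmp 0 (G.cmp i a \<otimes> r))"
      using G.component_finsum[OF F, of "\<lambda>i. G.cmp i a \<otimes> r" 0] cc r by simp
    also have "\<dots> = \<zero>"
    proof (intro add.finprod_one_eqI)
      fix i assume i: "i \<in> ?F"
      have "\<not> i < 0" using nonneg[of i] G.component_in[of a i] a i by auto
      moreover have "i \<noteq> 0" using a i by auto
      \<comment> \<open>A contribution of \<open>G.cmp i a \<otimes> r\<close> to degree 0 with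
        \<open>i > 0\<close> would have to use the part of \<open>r\<close> in degree
        \<open>- i\<close>, which is zero.\<close>
      ultimately have "G.cmp (- i) r = \<zero>" using nonneg[of "- i"] G.component_in[OF r, of "- i"] by auto
      then show "G.cmp 0 (G.cmp i a \<otimes> r) = \<zero>"
        using component_smult_homogeneous[OF graded_ring_axioms regular_module_graded _ r, of "G.cmp i a" i "- i"]
          G.component_in[OF a(1)] cc by (simp add: regular_module_component)
    qed
    finally show ?thesis .
  qed
  then show ?thesis
    unfolding graded_submodule_def
    using G.component_zero G.component_add G.component_carrier G.component_homogeneous[OF G.component_in, of _ 0]
    by (auto simp: positive_part_iff regular_module_component G.component_homogeneous[OF G.component_in])
qed

text \<open>\<open>positive_part_graded_submodule\<close> makes A_+ a right ideal. That it is a left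
  ideal too is what makes A_+ act as zero on the right module \<open>A/A_+\<close>.\<close>

lemma positive_part_l_closed:
  assumes a: "a \<in> positive_part A" and r: "r \<in> carrier A"
  shows "r \<otimes> a \<in> positive_part A"
proof -
  have ac: "a \<in> carrier A" "G.cmp 0 a = \<zero>" using a by (auto simp: positive_part_iff)
  let ?F = "{i. G.cmp i a \<noteq> \<zero>}"
  have F: "finite ?F" using G.component_finite ac by auto
  have cc: "\<And>i. G.cmp i a \<in> carrier A" using G.component_carrier ac by auto
  have "r \<otimes> a = r \<otimes> (\<Oplus>i\<in>?F. G.cmp i a)" using G.component_sum ac by simp
  also have "\<dots> = (\<Oplus>i\<in>?F. r \<otimes> G.cmp i a)" using F cc r by (intro finsum_rdistr) auto
  finally have "G.cmp 0 (r \<otimes> a) = (\<Oplus>i\<in>?F. G.cmp 0 (r \<otimes> G.cmp i a))"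
    using G.component_finsum[OF F, of "\<lambda>i. r \<otimes> G.cmp i a" 0] cc r by simp
  also have "\<dots> = \<zero>"
  proof (intro add.finprod_one_eqI)
    fix i assume i: "i \<in> ?F"
    have "\<not> i < 0" using nonneg[of i] G.component_in[of a i] ac i by auto
    moreover have "i \<noteq> 0" using ac i by auto
    ultimately have z: "G.cmp (- i) r = \<zero>" using nonneg[of "- i"] G.component_in[OF r, of "- i"] by auto
    have "G.cmp (- i + i) (r \<otimes> G.cmp i a) = G.cmp (- i) r \<otimes> G.cmp i a"
      by (rule component_hom[where f = "\<lambda>x. x \<otimes> G.cmp i a" and H = "rgrade A"])
        (use r cc l_distr rgrade_mult G.component_in[OF ac(1)] G.graded_group_axioms in auto)
    then show "G.cmp 0 (r \<otimes> G.cmp i a) = \<zero>" using z cc by simp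
  qed
  finally show ?thesis using ac r by (simp add: positive_part_iff)
qed

sublocale T: module_quotient A "regular_module A" "positive_part A"
  by unfold_locales (rule graded_ring_axioms regular_module_graded positive_part_graded_submodule)+

lemma top_module_graded: "graded_right_module A (top_module A)"
  unfolding top_module_def by (rule T.MZ_graded_right_module)

end

section \<open>Lifting along surjections from free modules\<close>

text \<open>Graded projectivity: basis elements are lifted to homogeneous preimages of the same
  degree and the lift is extended linearly. Surjectivity is assumed in each degree because the lift
  has to preserve degrees.\<close>

lemma (in graded_ring) graded_free_lift:
  assumes P: "graded_free_module A P" and M: "graded_right_module A M" and L: "graded_right_module A L"
    and f: "f \<in> hom_of_degree A 0 P M" and q: "q \<in> hom_of_degree A 0 L M"
    and surj: "\<And>i. mgrade M i \<subseteq> q ` mgrade L i"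
  obtains l where "l \<in> hom_of_degree A 0 P L" "\<And>x. x \<in> carrier P \<Longrightarrow> q (l x) = f x"
proof -
  have Pg: "graded_right_module A P" using P by (simp add: graded_free_module_def)
  obtain B where B: "module_basis A P B" "B \<subseteq> (\<Union>i. mgrade P i)"
    using P by (auto simp: graded_free_module_def)
  interpret P: graded_group P "mgrade P" using Pg by (rule graded_right_module_graded_group)
  interpret M: graded_group M "mgrade M" using M by (rule graded_right_module_graded_group)
  interpret L: graded_group L "mgrade L" using L by (rule graded_right_module_graded_group)
  interpret RP: right_module A P using Pg by (simp add: graded_right_module_def)
  interpret RL: right_module A L using L by (simp add: graded_right_module_def)
  interpret RM: right_module A M using M by (simp add: graded_right_module_def)
  note hf = hom_of_degree_D[OF f] and hq = hom_of_degree_D[OF q]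
  define \<delta> where "\<delta> b = (SOME i. b \<in> mgrade P i)" for b
  have \<delta>: "b \<in> mgrade P (\<delta> b)" if "b \<in> B" for b
    unfolding \<delta>_def by (rule someI_ex) (use B that in auto)
  have "\<exists>u. u \<in> mgrade L (\<delta> b) \<and> q u = f b" if "b \<in> B" for b
  proof -
    have "f b \<in> mgrade M (\<delta> b)" using hf(6)[OF \<delta>[OF that]] by simp
    then have "f b \<in> q ` mgrade L (\<delta> b)" using surj by blast
    then show ?thesis by (metis imageE)
  qed
  then obtain u where u: "\<And>b. b \<in> B \<Longrightarrow> u b \<in> mgrade L (\<delta> b)" "\<And>b. b \<in> B \<Longrightarrow> q (u b) = f b"
    by metis
  let ?F = "free_graded A B \<delta>"
  interpret F: graded_group ?F "mgrade ?F"
    by (rule graded_right_module_graded_group[OF free_graded_graded_right_module])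
  interpret RF: right_module A ?F by (rule free_graded_right_module)
  \<comment> \<open>The given module is compared with the concrete free module on its basis:
    \<open>eP\<close> is an isomorphism with inverse \<open>co\<close>, and the lift is
    \<open>eL\<close> after \<open>co\<close>.\<close>
  define eP where "eP = (\<lambda>c\<in>carrier ?F. \<Oplus>\<^bsub>P\<^esub>b\<in>{b. c b \<noteq> \<zero>}. c b \<odot>\<^bsub>P\<^esub> b)"
  define eL where "eL = (\<lambda>c\<in>carrier ?F. \<Oplus>\<^bsub>L\<^esub>b\<in>{b. c b \<noteq> \<zero>}. c b \<odot>\<^bsub>L\<^esub> u b)"
  have eP: "eP \<in> hom_of_degree A 0 ?F P" unfolding eP_def by (rule free_graded_eval_hom[OF Pg \<delta>])
  have eL: "eL \<in> hom_of_degree A 0 ?F L" unfolding eL_def by (rule free_graded_eval_hom[OF L u(1)])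
  note hP = hom_of_degree_D[OF eP] and hL = hom_of_degree_D[OF eL]
  have coeff: "coefficients_on A B = carrier ?F" by (auto simp: coefficients_on_def)
  have lc: "linear_combination A P c = eP c" if "c \<in> carrier ?F" for c
    using that by (simp add: linear_combination_def eP_def)
  have ex1: "\<exists>!c. c \<in> carrier ?F \<and> x = eP c" if "x \<in> carrier P" for x
  proof -
    have "\<exists>!c. c \<in> carrier ?F \<and> x = linear_combination A P c"
      using B(1) that unfolding module_basis_def coeff by blast
    then show ?thesis using lc by metis
  qed
  define co where "co x = (THE c. c \<in> carrier ?F \<and> x = eP c)" for x
  have co: "co x \<in> carrier ?F" "eP (co x) = x" if "x \<in> carrier P" for x
    using theI'[OF ex1[OF that]] unfolding co_def by auto
  have inj: "c = c'" if "c \<in> carrier ?F" "c' \<in> carrier ?F" "eP c = eP c'" for c c'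
    using ex1[OF hP(3)[OF that(1)]] that by auto
  have co_add: "co (x \<oplus>\<^bsub>P\<^esub> y) = co x \<oplus>\<^bsub>?F\<^esub> co y" if "x \<in> carrier P" "y \<in> carrier P" for x y
    by (rule inj) (use that co hP(4) F.a_closed in \<open>simp_all del: free_graded_simps\<close>)
  have co_smult: "co (a \<odot>\<^bsub>P\<^esub> x) = a \<odot>\<^bsub>?F\<^esub> co x" if "a \<in> carrier A" "x \<in> carrier P" for a x
    by (rule inj) (use that co hP(5) RF.smult_closed RP.smult_closed in \<open>simp_all del: free_graded_simps\<close>)
  \<comment> \<open>\<open>eP\<close> is injective and commutes with components, so the coordinates
    of a homogeneous element form a homogeneous element of \<open>?F\<close>.\<close>
  have co_grade: "co x \<in> mgrade ?F i" if x: "x \<in> mgrade P i" for x i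
  proof -
    have xc: "x \<in> carrier P" using x P.grade_carrier by auto
    have "eP (F.cmp i (co x)) = P.cmp i (eP (co x))"
      using component_hom[OF F.graded_group_axioms P.graded_group_axioms hP(1,4,6) co(1)[OF xc], of i] by simp
    also have "\<dots> = x" using co(2)[OF xc] P.component_homogeneous[OF x, of i] by simp
    finally have "F.cmp i (co x) = co x"
      by (intro inj) (use co[OF xc] F.component_carrier in \<open>simp_all del: free_graded_simps\<close>)
    then show ?thesis using F.component_in[OF co(1)[OF xc], of i] by (simp del: free_graded_simps)
  qed
  define l where "l = (\<lambda>x\<in>carrier P. eL (co x))"
  have "l \<in> hom_of_degree A 0 P L"
    unfolding hom_of_degree_def
  proof (intro CollectI conjI ballI allI)
    show "l \<in> carrier P \<rightarrow>\<^sub>E carrier L" using co hL(3) by (auto simp: l_def)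
    show "l ` mgrade P j \<subseteq> mgrade L (j + 0)" for j
      using co_grade hL(6)[of _ j] P.grade_carrier by (auto simp: l_def simp del: free_graded_simps)
  qed (use co co_add co_smult hL RP.smult_closed in \<open>simp_all add: l_def del: free_graded_simps\<close>)
  moreover have "q (l x) = f x" if x: "x \<in> carrier P" for x
  proof -
    let ?c = "co x" let ?J = "{b. ?c b \<noteq> \<zero>}"
    have c: "\<And>b. ?c b \<in> carrier A" "finite ?J" "?J \<subseteq> B" using co(1)[OF x] by auto
    have uc: "b \<in> B \<Longrightarrow> u b \<in> carrier L" "b \<in> B \<Longrightarrow> b \<in> carrier P" for b
      using u \<delta> L.grade_carrier P.grade_carrier by blast+
    have "q (l x) = q (\<Oplus>\<^bsub>L\<^esub>b\<in>?J. ?c b \<odot>\<^bsub>L\<^esub> u b)"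
      using x co(1)[OF x] by (simp add: l_def eL_def del: free_graded_simps)
    also have "\<dots> = (\<Oplus>\<^bsub>M\<^esub>b\<in>?J. q (?c b \<odot>\<^bsub>L\<^esub> u b))"
      using c uc RL.smult_closed hq L.abelian_group_axioms M.abelian_group_axioms
      by (intro additive_finsum) auto
    also have "\<dots> = (\<Oplus>\<^bsub>M\<^esub>b\<in>?J. f (?c b \<odot>\<^bsub>P\<^esub> b))"
    proof (rule M.finsum_cong')
      fix b assume "b \<in> ?J"
      then have "b \<in> B" using c by auto
      then show "q (?c b \<odot>\<^bsub>L\<^esub> u b) = f (?c b \<odot>\<^bsub>P\<^esub> b)" using hq(5) hf(5) u uc c by simp
    next
      have "f (?c b \<odot>\<^bsub>P\<^esub> b) \<in> carrier M" if "b \<in> ?J" for b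
        using that c uc by (intro hf(3) RP.smult_closed) auto
      then show "(\<lambda>b. f (?c b \<odot>\<^bsub>P\<^esub> b)) \<in> ?J \<rightarrow> carrier M" by blast
    qed simp
    also have "\<dots> = f (\<Oplus>\<^bsub>P\<^esub>b\<in>?J. ?c b \<odot>\<^bsub>P\<^esub> b)"
      using c uc RP.smult_closed hf P.abelian_group_axioms M.abelian_group_axioms
      by (intro additive_finsum[symmetric]) auto
    also have "\<dots> = f x" using co[OF x] by (simp add: eP_def del: free_graded_simps)
    finally show ?thesis .
  qed
  ultimately show ?thesis by (rule that)
qed

section \<open>Depth\<close>

lemma graded_hom_simps:
  "monoid.mult (graded_hom A M N) f g = (\<lambda>x\<in>carrier M. f x \<oplus>\<^bsub>N\<^esub> g x)"
  "\<one>\<^bsub>graded_hom A M N\<^esub> = (\<lambda>x\<in>carrier M. \<zero>\<^bsub>N\<^esub>)"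
  by (simp_all add: graded_hom_def)

text \<open>\<open>M\<close> is a bare record here, so closure under sums and scalar multiples
  appears as a premise of the rules.\<close>

lemma graded_hom_D:
  assumes f: "f \<in> carrier (graded_hom A M N)" and N: "right_module A N"
  shows "f \<in> carrier M \<rightarrow>\<^sub>E carrier N"
    "\<And>x y. x \<in> carrier M \<Longrightarrow> y \<in> carrier M \<Longrightarrow> x \<oplus>\<^bsub>M\<^esub> y \<in> carrier M \<Longrightarrow> f (x \<oplus>\<^bsub>M\<^esub> y) = f x \<oplus>\<^bsub>N\<^esub> f y"
    "\<And>a x. a \<in> carrier A \<Longrightarrow> x \<in> carrier M \<Longrightarrow> a \<odot>\<^bsub>M\<^esub> x \<in> carrier M \<Longrightarrow> f (a \<odot>\<^bsub>M\<^esub> x) = a \<odot>\<^bsub>N\<^esub> f x"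
proof -
  interpret N: right_module A N by (rule N)
  obtain F h where F: "finite F" "\<And>i. i \<in> F \<Longrightarrow> h i \<in> hom_of_degree A i M N"
    and fe: "f = (\<lambda>x\<in>carrier M. \<Oplus>\<^bsub>N\<^esub>i\<in>F. h i x)"
    using f by (auto simp: graded_hom_def)
  note h = hom_of_degree_D[OF F(2)]
  show "f \<in> carrier M \<rightarrow>\<^sub>E carrier N" using h F by (auto simp: fe)
  show "f (x \<oplus>\<^bsub>M\<^esub> y) = f x \<oplus>\<^bsub>N\<^esub> f y"
    if xy: "x \<in> carrier M" "y \<in> carrier M" "x \<oplus>\<^bsub>M\<^esub> y \<in> carrier M" for x y
  proof -
    have "f (x \<oplus>\<^bsub>M\<^esub> y) = (\<Oplus>\<^bsub>N\<^esub>i\<in>F. h i (x \<oplus>\<^bsub>M\<^esub> y))"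
      using xy by (simp add: fe)
    also have "\<dots> = (\<Oplus>\<^bsub>N\<^esub>i\<in>F. h i x \<oplus>\<^bsub>N\<^esub> h i y)"
      by (rule N.M.finsum_cong') (use xy h in auto)
    also have "\<dots> = f x \<oplus>\<^bsub>N\<^esub> f y"
      using xy h by (simp add: fe N.M.finsum_addf Pi_iff)
    finally show ?thesis .
  qed
  show "f (a \<odot>\<^bsub>M\<^esub> x) = a \<odot>\<^bsub>N\<^esub> f x"
    if xy: "a \<in> carrier A" "x \<in> carrier M" "a \<odot>\<^bsub>M\<^esub> x \<in> carrier M" for a x
  proof -
    have "f (a \<odot>\<^bsub>M\<^esub> x) = (\<Oplus>\<^bsub>N\<^esub>i\<in>F. h i (a \<odot>\<^bsub>M\<^esub> x))"
      using xy by (simp add: fe)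
    also have "\<dots> = (\<Oplus>\<^bsub>N\<^esub>i\<in>F. a \<odot>\<^bsub>N\<^esub> h i x)"
      by (rule N.M.finsum_cong') (use xy h N.smult_closed in auto)
    also have "\<dots> = a \<odot>\<^bsub>N\<^esub> (\<Oplus>\<^bsub>N\<^esub>i\<in>F. h i x)"
      using xy h F N.smult_closed N.smult_add_module N.M.abelian_group_axioms
      by (intro additive_finsum[symmetric, where f = "\<lambda>x. a \<odot>\<^bsub>N\<^esub> x"]) auto
    finally show ?thesis using xy by (simp add: fe)
  qed
qed

lemma hom_of_degree_in_graded_hom:
  assumes f: "f \<in> hom_of_degree A i M N" and N: "abelian_group N"
  shows "f \<in> carrier (graded_hom A M N)"
proof -
  interpret N: abelian_group N by (rule N)
  have "f = (\<lambda>x\<in>carrier M. \<Oplus>\<^bsub>N\<^esub>j\<in>{i}. f x)"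
    using hom_of_degree_D(2,3)[OF f]
    by (auto simp: fun_eq_iff extensional_def N.finsum_single[of "{i}" "\<lambda>j. f x" i for x])
  then show ?thesis
    unfolding graded_hom_def using f by (auto intro!: exI[of _ "{i}"] exI[of _ "\<lambda>_. f"])
qed

text \<open>The argument uses cosets directly: the coset of \<open>f\<close> contains the product of
  the unit and \<open>f\<close>, which is \<open>f\<close>. If it equalled the coboundaries,
  \<open>f\<close> would be one of them.\<close>

lemma resolution_cohomology_nontrivial:
  assumes "f \<in> cocycles A P N j" "f \<notin> coboundaries A P N j"
    and "\<one>\<^bsub>graded_hom A (term_of P j) N\<^esub> \<in> coboundaries A P N j"
    and "monoid.mult (graded_hom A (term_of P j) N) \<one>\<^bsub>graded_hom A (term_of P j) N\<^esub> f = f"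
  shows "carrier (resolution_cohomology A P N j) \<noteq> {\<one>\<^bsub>resolution_cohomology A P N j\<^esub>}"
proof
  let ?G = "graded_hom A (term_of P j) N\<lparr>carrier := cocycles A P N j\<rparr>"
  assume "carrier (resolution_cohomology A P N j) = {\<one>\<^bsub>resolution_cohomology A P N j\<^esub>}"
  moreover have "coboundaries A P N j #>\<^bsub>?G\<^esub> f \<in> carrier (resolution_cohomology A P N j)"
    using assms(1) by (auto simp: resolution_cohomology_def FactGroup_def RCOSETS_def)
  ultimately have "coboundaries A P N j #>\<^bsub>?G\<^esub> f = coboundaries A P N j"
    by (simp add: resolution_cohomology_def FactGroup_def)
  moreover have "f \<in> coboundaries A P N j #>\<^bsub>?G\<^esub> f"
    using assms(3,4) by (auto simp: r_coset_def intro!: bexI[of _ "\<one>\<^bsub>graded_hom A (term_of P j) N\<^esub>"])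
  ultimately show False using assms(2) by simp
qed

text \<open>In degree 0 the zero map is the only coboundary; once it is also the only cocycle, the
  quotient consists of one coset.\<close>

lemma resolution_cohomology_0_trivial:
  assumes "cocycles A P N 0 = {\<one>\<^bsub>graded_hom A (term_of P 0) N\<^esub>}"
    and "monoid.mult (graded_hom A (term_of P 0) N) \<one>\<^bsub>graded_hom A (term_of P 0) N\<^esub>
      \<one>\<^bsub>graded_hom A (term_of P 0) N\<^esub> = \<one>\<^bsub>graded_hom A (term_of P 0) N\<^esub>"
  shows "carrier (resolution_cohomology A P N 0) = {\<one>\<^bsub>resolution_cohomology A P N 0\<^esub>}"
  using assms by (simp add: resolution_cohomology_def FactGroup_def RCOSETS_def r_coset_def coboundaries_def)

context nonneg_graded_ring
begin

abbreviation "Top \<equiv> top_module A"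
abbreviation "Reg \<equiv> regular_module A"
abbreviation "Res \<equiv> chosen_resolution A Top"

text \<open>The summand \<open>nat\<close> makes the index type infinite, the summand
  \<open>'a\<close> hosts the scalars, and the summand \<open>'a set\<close> hosts the cosets that
  form the top module.\<close>

lemma resolution: "graded_free_resolution A Top Res"
proof -
  have "infinite (UNIV :: ('a set + 'a + nat) set)"
    using inj_on_finite[of "\<lambda>n. Inr (Inr n) :: 'a set + 'a + nat" "UNIV :: nat set" UNIV]
    by (auto simp: inj_on_def)
  then have "\<exists>P :: ('a, 'a set, 'a set + 'a + nat \<Rightarrow> 'a) resolution. graded_free_resolution A Top P"
    by (rule graded_free_resolution_exists[OF top_module_graded nontrivial, where e = "\<lambda>a. Inr (Inl a)" and j = Inl])
      (auto simp: inj_on_def)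
  then show ?thesis unfolding chosen_resolution_def by (rule someI_ex)
qed

lemma res_free: "graded_free_module A (term_of Res n)"
  and res_diff: "diff_of Res n \<in> hom_of_degree A 0 (term_of Res (Suc n)) (term_of Res n)"
  and res_aug: "aug_of Res \<in> hom_of_degree A 0 (term_of Res 0) Top"
  and res_surj: "aug_of Res ` carrier (term_of Res 0) = carrier Top"
  and res_exact_0: "diff_of Res 0 ` carrier (term_of Res (Suc 0)) =
       {x \<in> carrier (term_of Res 0). aug_of Res x = \<zero>\<^bsub>Top\<^esub>}"
  and res_exact: "diff_of Res (Suc n) ` carrier (term_of Res (Suc (Suc n))) =
       {x \<in> carrier (term_of Res (Suc n)). diff_of Res n x = \<zero>\<^bsub>term_of Res n\<^esub>}"
  using resolution unfolding graded_free_resolution_def by blast+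

lemma res_graded: "graded_right_module A (term_of Res n)"
  using res_free by (simp add: graded_free_module_def)

lemma res_right_module: "right_module A (term_of Res n)"
  using res_graded by (simp add: graded_right_module_def)

lemma reg_right_module: "right_module A Reg"
  using regular_module_graded by (simp add: graded_right_module_def)

lemma reg_abelian_group: "abelian_group Reg"
  by (rule regular_module_abelian_group)

text \<open>The chosen resolution is opaque, but its first term is projective and A maps onto the
  top in each degree. Through \<open>l\<close>, multiplications on A become maps out of that
  term.\<close>

lemma augmentation_lift:
  obtains l where "l \<in> hom_of_degree A 0 (term_of Res 0) Reg"
    "\<And>x. x \<in> carrier (term_of Res 0) \<Longrightarrow> aug_of Res x = T.cs (l x)"
proof -
  show ?thesis
  proof (rule graded_free_lift[OF res_free top_module_graded regular_module_graded res_aug])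
    show "(\<lambda>x\<in>carrier Reg. T.cs x) \<in> hom_of_degree A 0 Reg Top"
      unfolding top_module_def by (rule T.cs_hom)
    show "mgrade Top i \<subseteq> (\<lambda>x\<in>carrier Reg. T.cs x) ` mgrade Reg i" for i
      using G.grade_carrier unfolding top_module_def quotient_module_simps(5)
      by (auto simp: image_iff)
    fix l assume l: "l \<in> hom_of_degree A 0 (term_of Res 0) Reg"
      "\<And>x. x \<in> carrier (term_of Res 0) \<Longrightarrow> (\<lambda>x\<in>carrier Reg. T.cs x) (l x) = aug_of Res x"
    show ?thesis
    proof (rule that[OF l(1)])
      fix x assume x: "x \<in> carrier (term_of Res 0)"
      show "aug_of Res x = T.cs (l x)"
        using l(2)[OF x] hom_of_degree_D(3)[OF l(1) x] by (simp only: restrict_apply if_True)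
    qed
  qed
qed

lemma top_zero: "\<zero>\<^bsub>Top\<^esub> = positive_part A"
  by (simp add: top_module_def quotient_module_simps)

text \<open>Surjectivity of the augmentation, seen through \<open>l\<close>. A value congruent to 1
  modulo A_+ suffices: the multiplications applied to it later send the part \<open>n\<close> to
  zero, or to a multiple of the central element.\<close>

lemma aug_generator:
  assumes l: "l \<in> hom_of_degree A 0 (term_of Res 0) Reg"
    "\<And>x. x \<in> carrier (term_of Res 0) \<Longrightarrow> aug_of Res x = T.cs (l x)"
  obtains x n where "x \<in> carrier (term_of Res 0)" "n \<in> positive_part A" "l x = n \<oplus> \<one>"
proof -
  have "T.cs \<one> \<in> carrier Top" unfolding top_module_def by (subst T.carrier_MZ) auto
  then have "T.cs \<one> \<in> aug_of Res ` carrier (term_of Res 0)" unfolding res_surj .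
  then obtain x where x: "T.cs \<one> = aug_of Res x" "x \<in> carrier (term_of Res 0)" by (rule imageE)
  then have "T.cs (l x) = T.cs \<one>" using l(2)[OF x(2)] by simp
  then have "\<exists>z\<in>positive_part A. l x = z \<oplus> \<one>"
    using T.cs_eq_iff[of "l x" \<one>] hom_of_degree_D(3)[OF l(1) x(2)] by simp
  then show ?thesis using x that by blast
qed

lemma positive_part_carrier: "a \<in> positive_part A \<Longrightarrow> a \<in> carrier A"
  by (simp add: positive_part_iff)

text \<open>Multiplication by \<open>z\<close> kills A_+, hence factors through the top and gives a
  nonzero element of Ext^0. On the resolution it is the map \<open>z \<otimes> l x\<close>,
  homogeneous because \<open>z\<close> is.\<close>

lemma depth_zero:
  assumes z: "z \<in> rgrade A i" "z \<noteq> \<zero>" and ann: "\<And>a. a \<in> positive_part A \<Longrightarrow> z \<otimes> a = \<zero>"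
  shows "depth A = 0"
proof -
  obtain l where l: "l \<in> hom_of_degree A 0 (term_of Res 0) Reg"
    "\<And>x. x \<in> carrier (term_of Res 0) \<Longrightarrow> aug_of Res x = T.cs (l x)"
    using augmentation_lift by blast
  note hl = hom_of_degree_D[OF l(1), simplified]
  interpret P0: right_module A "term_of Res 0" by (rule res_right_module)
  have zc: "z \<in> carrier A" using z G.grade_carrier by auto
  define f where "f = (\<lambda>x\<in>carrier (term_of Res 0). z \<otimes> l x)"
  have pg: "x \<in> mgrade (term_of Res 0) j \<Longrightarrow> x \<in> carrier (term_of Res 0)" for x j
    using graded_group.grade_carrier[OF graded_right_module_graded_group[OF res_graded]] by blast
  have f: "f \<in> hom_of_degree A i (term_of Res 0) Reg"
    unfolding hom_of_degree_def f_def
    using zc hl rgrade_mult[OF z(1)] pg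
    by (auto simp: r_distr m_assoc P0.smult_closed add.commute)
  then have fg: "f \<in> carrier (graded_hom A (term_of Res 0) Reg)"
    by (rule hom_of_degree_in_graded_hom[OF _ reg_abelian_group])
  have "f \<in> cocycles A Res Reg 0"
  proof -
    have "f (diff_of Res 0 y) = \<zero>" if y: "y \<in> carrier (term_of Res (Suc 0))" for y
    proof -
      \<comment> \<open>Exactness puts the image of the differential into the kernel of the
        augmentation, and \<open>l\<close> maps this kernel into A_+.\<close>
      have d: "diff_of Res 0 y \<in> carrier (term_of Res 0)" "aug_of Res (diff_of Res 0 y) = \<zero>\<^bsub>Top\<^esub>"
        using y res_exact_0 by blast+
      then have "T.cs (l (diff_of Res 0 y)) = positive_part A" using l(2) top_zero by simp
      then have "l (diff_of Res 0 y) \<in> positive_part A"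
        using T.cs_zero_iff[of "l (diff_of Res 0 y)"] hl(3)[OF d(1)] by simp
      then show ?thesis using ann d by (simp add: f_def)
    qed
    then show ?thesis
      unfolding cocycles_def using fg by (auto simp: graded_hom_simps compose_def)
  qed
  moreover have "f \<noteq> \<one>\<^bsub>graded_hom A (term_of Res 0) Reg\<^esub>"
  proof -
    obtain x n where x: "x \<in> carrier (term_of Res 0)" "n \<in> positive_part A" "l x = n \<oplus> \<one>"
      using aug_generator[OF l] by blast
    \<comment> \<open>\<open>z\<close> kills the part \<open>n\<close> of
      \<open>l x = n \<oplus> \<one>\<close>.\<close>
    have "f x = z"
      using x zc ann positive_part_carrier by (simp add: f_def r_distr)
    then show ?thesis using z x by (auto simp: graded_hom_simps)
  qed
  moreover have "monoid.mult (graded_hom A (term_of Res 0) Reg) \<one>\<^bsub>graded_hom A (term_of Res 0) Reg\<^esub> f = f"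
    using hom_of_degree_D(2,3)[OF f] by (auto simp: graded_hom_simps fun_eq_iff extensional_def)
  ultimately have "carrier (graded_Ext A 0 Top Reg) \<noteq> {\<one>\<^bsub>graded_Ext A 0 Top Reg\<^esub>}"
    unfolding graded_Ext_def by (intro resolution_cohomology_nontrivial) (auto simp: coboundaries_def)
  then have "enat 0 \<in> {enat j |j. carrier (graded_Ext A j Top Reg) \<noteq> {\<one>\<^bsub>graded_Ext A j Top Reg\<^esub>}}"
    by blast
  from Inf_lower[OF this] show ?thesis unfolding depth_def by (simp add: zero_enat_def[symmetric])
qed

text \<open>A_+ acts as zero on the top, so the multiple of \<open>x\<close> by an element
  \<open>a\<close> of A_+ lies in the kernel of the augmentation, that is, in the image of the
  differential. Hence \<open>f x \<otimes> a = \<zero>\<close>. The function \<open>f\<close> is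
  left general because the lemma serves both for cocycles in degree 0 and for a difference of two
  maps when Ext^1 is examined.\<close>

lemma socle_cocycle_vanishes:
  assumes soc: "\<And>s. s \<in> carrier A \<Longrightarrow> (\<And>a. a \<in> positive_part A \<Longrightarrow> s \<otimes> a = \<zero>) \<Longrightarrow> s = \<zero>"
    and f: "f \<in> carrier (term_of Res 0) \<rightarrow> carrier A"
      "\<And>a x. a \<in> carrier A \<Longrightarrow> x \<in> carrier (term_of Res 0) \<Longrightarrow> f (a \<odot>\<^bsub>term_of Res 0\<^esub> x) = f x \<otimes> a"
      "\<And>y. y \<in> carrier (term_of Res (Suc 0)) \<Longrightarrow> f (diff_of Res 0 y) = \<zero>"
    and x: "x \<in> carrier (term_of Res 0)"
  shows "f x = \<zero>"
proof (rule soc)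
  interpret P0: right_module A "term_of Res 0" by (rule res_right_module)
  show "f x \<in> carrier A" using f x by auto
  fix a assume a: "a \<in> positive_part A"
  have ac: "a \<in> carrier A" using a positive_part_carrier by auto
  have "aug_of Res x \<in> carrier Top" using hom_of_degree_D(3)[OF res_aug x] .
  then have "aug_of Res x \<in> T.cs ` carrier Reg" unfolding top_module_def T.carrier_MZ .
  then obtain t where t: "aug_of Res x = T.cs t" "t \<in> carrier A" by auto
  have "aug_of Res (a \<odot>\<^bsub>term_of Res 0\<^esub> x) = a \<odot>\<^bsub>Top\<^esub> T.cs t"
    using hom_of_degree_D(5)[OF res_aug ac x] t by simp
  also have "\<dots> = T.cs (a \<odot>\<^bsub>Reg\<^esub> t)"
    unfolding top_module_def quotient_module_simps(4) using ac t by (intro T.cs_smult) auto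
  also have "\<dots> = positive_part A"
    using positive_part_l_closed[OF a t(2)] ac t T.cs_zero_iff[of "t \<otimes> a"] by simp
  finally have "a \<odot>\<^bsub>term_of Res 0\<^esub> x \<in> diff_of Res 0 ` carrier (term_of Res (Suc 0))"
    using res_exact_0 top_zero P0.smult_closed[OF ac x] by simp
  then have "f (a \<odot>\<^bsub>term_of Res 0\<^esub> x) = \<zero>" using f(3) by auto
  then show "f x \<otimes> a = \<zero>" using f(2)[OF ac x] by simp
qed

text \<open>Ext^0 vanishes because whatever is killed by A_+ is killed by the regular element
  \<open>x\<close>. In degree 1 the cocycle is \<open>\<psi>\<close> with x \<psi> = y l d, where d
  is the first differential. If it were \<theta> d, then y l - x \<theta> would vanish on the image
  of d, hence everywhere, and its value at an element that \<open>l\<close> sends to 1 modulo A_+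
  would put \<open>y\<close> into xA.\<close>

lemma depth_one:
  assumes x: "x \<in> rgrade A n" "0 < n" and central: "\<And>a. a \<in> carrier A \<Longrightarrow> x \<otimes> a = a \<otimes> x"
    and regular: "\<And>a. a \<in> carrier A \<Longrightarrow> x \<otimes> a = \<zero> \<Longrightarrow> a = \<zero>"
    and y: "y \<in> rgrade A j" "\<And>w. w \<in> carrier A \<Longrightarrow> y \<noteq> x \<otimes> w"
    and socle: "\<And>a. a \<in> positive_part A \<Longrightarrow> \<exists>w\<in>carrier A. y \<otimes> a = x \<otimes> w"
  shows "depth A = 1"
proof -
  interpret P0: right_module A "term_of Res 0" by (rule res_right_module)
  interpret P1: right_module A "term_of Res (Suc 0)" by (rule res_right_module)
  interpret P2: right_module A "term_of Res (Suc (Suc 0))" by (rule res_right_module)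
  have xc: "x \<in> carrier A" and yc: "y \<in> carrier A" using x y G.grade_carrier by auto
  \<comment> \<open>\<open>x\<close> has positive degree, so it is among the elements that
    \<open>s\<close> kills; centrality then allows regularity of \<open>x\<close> to be applied to
    \<open>s\<close>.\<close>
  have soc: "s = \<zero>" if "s \<in> carrier A" "\<And>a. a \<in> positive_part A \<Longrightarrow> s \<otimes> a = \<zero>" for s
    using that regular central grade_in_positive_part[OF x(2,1)] by metis
  have cancel: "w = w'" if "w \<in> carrier A" "w' \<in> carrier A" "x \<otimes> w = x \<otimes> w'" for w w'
  proof -
    have "x \<otimes> (w \<ominus> w') = \<zero>" using that xc by (simp add: minus_eq r_distr r_minus r_neg)
    then have "w \<ominus> w' = \<zero>" using regular that by simp
    then show ?thesis using that r_right_minus_eq by blast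
  qed
  have "carrier (graded_Ext A 0 Top Reg) = {\<one>\<^bsub>graded_Ext A 0 Top Reg\<^esub>}"
    unfolding graded_Ext_def
  proof (rule resolution_cohomology_0_trivial)
    show one: "monoid.mult (graded_hom A (term_of Res 0) Reg) \<one>\<^bsub>graded_hom A (term_of Res 0) Reg\<^esub>
      \<one>\<^bsub>graded_hom A (term_of Res 0) Reg\<^esub> = \<one>\<^bsub>graded_hom A (term_of Res 0) Reg\<^esub>"
      by (auto simp: graded_hom_simps)
    show "cocycles A Res Reg 0 = {\<one>\<^bsub>graded_hom A (term_of Res 0) Reg\<^esub>}"
    proof (intro subset_antisym subsetI)
      fix f assume f: "f \<in> cocycles A Res Reg 0"
      then have fg: "f \<in> carrier (graded_hom A (term_of Res 0) Reg)"
        and fd: "compose (carrier (term_of Res (Suc 0))) f (diff_of Res 0) = \<one>\<^bsub>graded_hom A (term_of Res (Suc 0)) Reg\<^esub>"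
        by (auto simp: cocycles_def)
      note hf = graded_hom_D[OF fg reg_right_module]
      have "f p = \<zero>" if p: "p \<in> carrier (term_of Res 0)" for p
      proof (rule socle_cocycle_vanishes[OF soc _ _ _ p])
        show "f \<in> carrier (term_of Res 0) \<rightarrow> carrier A" using hf(1) by auto
        show "f (diff_of Res 0 q) = \<zero>" if "q \<in> carrier (term_of Res (Suc 0))" for q
          using fun_cong[OF fd, of q] that by (simp add: compose_def graded_hom_simps)
      qed (use hf(3) P0.smult_closed in auto)
      then have "f = \<one>\<^bsub>graded_hom A (term_of Res 0) Reg\<^esub>"
        using hf(1) by (auto simp: graded_hom_simps PiE_def extensional_def)
      then show "f \<in> {\<one>\<^bsub>graded_hom A (term_of Res 0) Reg\<^esub>}" by blast
    next
      have "(\<lambda>p\<in>carrier (term_of Res 0). \<zero>) \<in> hom_of_degree A 0 (term_of Res 0) Reg"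
        unfolding hom_of_degree_def using P0.smult_closed G.grade_zero
          graded_group.grade_carrier[OF graded_right_module_graded_group[OF res_graded]] by auto
      then have "\<one>\<^bsub>graded_hom A (term_of Res 0) Reg\<^esub> \<in> carrier (graded_hom A (term_of Res 0) Reg)"
        unfolding graded_hom_simps using hom_of_degree_in_graded_hom[OF _ reg_abelian_group] by simp
      moreover have "diff_of Res 0 q \<in> carrier (term_of Res 0)" if "q \<in> carrier (term_of Res (Suc 0))" for q
        using hom_of_degree_D(3)[OF res_diff that] .
      ultimately have "\<one>\<^bsub>graded_hom A (term_of Res 0) Reg\<^esub> \<in> cocycles A Res Reg 0"
        unfolding cocycles_def by (auto simp: graded_hom_simps compose_def)
      then show "f \<in> cocycles A Res Reg 0" if "f \<in> {\<one>\<^bsub>graded_hom A (term_of Res 0) Reg\<^esub>}" for f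
        using that by blast
    qed
  qed
  moreover have "carrier (graded_Ext A 1 Top Reg) \<noteq> {\<one>\<^bsub>graded_Ext A 1 Top Reg\<^esub>}"
  proof -
    obtain l where l: "l \<in> hom_of_degree A 0 (term_of Res 0) Reg"
      "\<And>x. x \<in> carrier (term_of Res 0) \<Longrightarrow> aug_of Res x = T.cs (l x)"
      using augmentation_lift by blast
    note hl = hom_of_degree_D[OF l(1), simplified]
    note hd = hom_of_degree_D[OF res_diff[of 0]]
    have lc: "l (diff_of Res 0 p) \<in> carrier A" if "p \<in> carrier (term_of Res (Suc 0))" for p
      using hd(3)[OF that] hl(3) by blast
    have ex: "\<exists>w. w \<in> carrier A \<and> y \<otimes> l (diff_of Res 0 p) = x \<otimes> w" if p: "p \<in> carrier (term_of Res (Suc 0))" for p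
    proof -
      have d: "diff_of Res 0 p \<in> carrier (term_of Res 0)" "aug_of Res (diff_of Res 0 p) = \<zero>\<^bsub>Top\<^esub>"
        using p res_exact_0 by blast+
      then have "T.cs (l (diff_of Res 0 p)) = positive_part A" using l(2) top_zero by simp
      then have "l (diff_of Res 0 p) \<in> positive_part A"
        using T.cs_zero_iff[of "l (diff_of Res 0 p)"] hl(3)[OF d(1)] by simp
      then show ?thesis using socle by blast
    qed
    \<comment> \<open>Division by \<open>x\<close>: the quotient exists by \<open>socle\<close> and
      is unique by \<open>cancel\<close>. Properties of \<open>\<psi>\<close> are therefore checked
      after multiplication by \<open>x\<close>.\<close>
    define \<psi> where "\<psi> = (\<lambda>p\<in>carrier (term_of Res (Suc 0)). SOME w. w \<in> carrier A \<and> y \<otimes> l (diff_of Res 0 p) = x \<otimes> w)"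
    have \<psi>: "\<psi> p \<in> carrier A" "y \<otimes> l (diff_of Res 0 p) = x \<otimes> \<psi> p" if "p \<in> carrier (term_of Res (Suc 0))" for p
      using someI_ex[OF ex[OF that]] that by (simp_all add: \<psi>_def)
    have \<psi>_eq: "\<psi> p = w" if "p \<in> carrier (term_of Res (Suc 0))" "w \<in> carrier A" "y \<otimes> l (diff_of Res 0 p) = x \<otimes> w" for p w
      using cancel[OF \<psi>(1)[OF that(1)] that(2)] \<psi>(2)[OF that(1)] that(3) by simp
    have gc1: "p \<in> carrier (term_of Res (Suc 0))" if "p \<in> mgrade (term_of Res (Suc 0)) i" for i p
      using graded_group.grade_carrier[OF graded_right_module_graded_group[OF res_graded]] that by blast
    have \<psi>_hom: "\<psi> \<in> hom_of_degree A (j - n) (term_of Res (Suc 0)) Reg"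
      unfolding hom_of_degree_def
    proof (intro CollectI conjI ballI allI)
      show "\<psi> \<in> carrier (term_of Res (Suc 0)) \<rightarrow>\<^sub>E carrier Reg"
        using \<psi>(1) by (auto simp: \<psi>_def)
    next
      fix p q assume p: "p \<in> carrier (term_of Res (Suc 0))" and q: "q \<in> carrier (term_of Res (Suc 0))"
      have "y \<otimes> l (diff_of Res 0 (p \<oplus>\<^bsub>term_of Res (Suc 0)\<^esub> q)) = x \<otimes> (\<psi> p \<oplus> \<psi> q)"
        using p q \<psi> hd(3,4) hl(4) lc yc xc by (simp add: r_distr)
      then show "\<psi> (p \<oplus>\<^bsub>term_of Res (Suc 0)\<^esub> q) = \<psi> p \<oplus>\<^bsub>Reg\<^esub> \<psi> q"
        using p q \<psi>(1) by (intro \<psi>_eq) auto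
    next
      fix a p assume a: "a \<in> carrier A" and p: "p \<in> carrier (term_of Res (Suc 0))"
      have "y \<otimes> l (diff_of Res 0 (a \<odot>\<^bsub>term_of Res (Suc 0)\<^esub> p)) = y \<otimes> (l (diff_of Res 0 p) \<otimes> a)"
        using a p hd(3,5) hl(5) by simp
      also have "\<dots> = x \<otimes> (\<psi> p \<otimes> a)"
        using a p \<psi> lc yc xc by (simp add: m_assoc[symmetric])
      finally show "\<psi> (a \<odot>\<^bsub>term_of Res (Suc 0)\<^esub> p) = a \<odot>\<^bsub>Reg\<^esub> \<psi> p"
        using a p \<psi>(1) P1.smult_closed by (auto intro!: \<psi>_eq)
    next
      fix i show "\<psi> ` mgrade (term_of Res (Suc 0)) i \<subseteq> mgrade Reg (i + (j - n))"
      proof (rule image_subsetI)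
        fix p assume p: "p \<in> mgrade (term_of Res (Suc 0)) i"
        note pc = gc1[OF p]
        have "l (diff_of Res 0 p) \<in> rgrade A i" using hl(6) hd(6)[OF p] by simp
        then have deg: "x \<otimes> \<psi> p \<in> rgrade A (j + i)"
          using rgrade_mult[OF y(1)] \<psi>(2)[OF pc] by metis
        \<comment> \<open>Multiplication by \<open>x\<close> shifts degrees by \<open>n\<close> and
          is injective, so \<open>\<psi> p\<close> inherits homogeneity from
          \<open>x \<otimes> \<psi> p\<close>, which has degree \<open>j + i\<close>.\<close>
        have "G.cmp k (\<psi> p) = \<zero>" if k: "k \<noteq> i + (j - n)" for k
        proof (rule regular)
          have "x \<otimes> G.cmp k (\<psi> p) = G.cmp (k + n) (x \<otimes> \<psi> p)"
            by (rule component_hom[symmetric, where f = "\<lambda>w. x \<otimes> w" and H = "rgrade A"])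
              (use xc \<psi>(1)[OF pc] rgrade_mult[OF x(1)] G.graded_group_axioms r_distr in \<open>auto simp: add.commute\<close>)
          then show "x \<otimes> G.cmp k (\<psi> p) = \<zero>"
            using G.component_homogeneous[OF deg, of "k + n"] k by simp
        qed (use G.component_carrier \<psi>(1)[OF pc] in auto)
        then show "\<psi> p \<in> mgrade Reg (i + (j - n))"
          using \<psi>(1)[OF pc] G.homogeneous_iff by simp
      qed
    qed
    have "\<psi> \<in> cocycles A Res Reg 1"
    proof -
      have "\<psi> (diff_of Res 1 q) = \<zero>" if q: "q \<in> carrier (term_of Res (Suc 1))" for q
      proof (rule \<psi>_eq)
        have d: "diff_of Res 1 q \<in> carrier (term_of Res (Suc 0))"
          "diff_of Res 0 (diff_of Res 1 q) = \<zero>\<^bsub>term_of Res 0\<^esub>"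
          using res_exact[of 0] q by auto
        show "diff_of Res 1 q \<in> carrier (term_of Res (Suc 0))" by (rule d)
        have "l \<zero>\<^bsub>term_of Res 0\<^esub> = \<zero>"
          using additive_zero[OF P0.M.abelian_group_axioms reg_abelian_group, of l] hl by simp
        then show "y \<otimes> l (diff_of Res 0 (diff_of Res 1 q)) = x \<otimes> \<zero>" using d xc yc by simp
      qed simp
      then show ?thesis
        unfolding cocycles_def using hom_of_degree_in_graded_hom[OF \<psi>_hom reg_abelian_group]
        by (auto simp: graded_hom_simps compose_def)
    qed
    moreover have "\<psi> \<notin> coboundaries A Res Reg 1"
    proof
      assume "\<psi> \<in> coboundaries A Res Reg 1"
      then obtain \<theta> where \<theta>: "\<theta> \<in> carrier (graded_hom A (term_of Res 0) Reg)"
        "\<psi> = compose (carrier (term_of Res (Suc 0))) \<theta> (diff_of Res 0)"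
        by (auto simp: coboundaries_def)
      note ht = graded_hom_D[OF \<theta>(1) reg_right_module, simplified]
      have tc: "\<theta> p \<in> carrier A" if "p \<in> carrier (term_of Res 0)" for p using ht(1) that by auto
      \<comment> \<open>The two terms agree on the image of the first differential; as no nonzero
        element is killed by A_+, they agree everywhere.\<close>
      have eq: "y \<otimes> l p \<ominus> x \<otimes> \<theta> p = \<zero>" if p: "p \<in> carrier (term_of Res 0)" for p
      proof (rule socle_cocycle_vanishes[OF soc _ _ _ p, where f = "\<lambda>p. y \<otimes> l p \<ominus> x \<otimes> \<theta> p"])
        show "(\<lambda>p. y \<otimes> l p \<ominus> x \<otimes> \<theta> p) \<in> carrier (term_of Res 0) \<rightarrow> carrier A"
          using hl(3) tc xc yc by auto
        show "y \<otimes> l (a \<odot>\<^bsub>term_of Res 0\<^esub> q) \<ominus> x \<otimes> \<theta> (a \<odot>\<^bsub>term_of Res 0\<^esub> q) = (y \<otimes> l q \<ominus> x \<otimes> \<theta> q) \<otimes> a"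
          if "a \<in> carrier A" "q \<in> carrier (term_of Res 0)" for a q
          using that hl(3,5) ht(3) tc xc yc P0.smult_closed
          by (simp add: minus_eq l_distr l_minus m_assoc)
        show "y \<otimes> l (diff_of Res 0 q) \<ominus> x \<otimes> \<theta> (diff_of Res 0 q) = \<zero>"
          if q: "q \<in> carrier (term_of Res (Suc 0))" for q
        proof -
          have "\<psi> q = \<theta> (diff_of Res 0 q)" using fun_cong[OF \<theta>(2), of q] q by (simp add: compose_def)
          then show ?thesis using \<psi>[OF q] xc by (simp add: r_right_minus_eq)
        qed
      qed
      obtain p n' where p: "p \<in> carrier (term_of Res 0)" "n' \<in> positive_part A" "l p = n' \<oplus> \<one>"
        using aug_generator[OF l] by blast
      \<comment> \<open>The A_+ part of \<open>l p\<close> contributes a multiple of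
        \<open>x\<close>, which leaves \<open>y\<close> itself equal to \<open>x\<close> times
        \<open>\<theta> p \<ominus> w\<close>.\<close>
      obtain w where w: "w \<in> carrier A" "y \<otimes> n' = x \<otimes> w" using socle[OF p(2)] by blast
      have "x \<otimes> \<theta> p = y \<otimes> l p"
        using eq[OF p(1)] tc[OF p(1)] hl(3)[OF p(1)] xc yc r_right_minus_eq[of "y \<otimes> l p" "x \<otimes> \<theta> p"] by simp
      also have "\<dots> = x \<otimes> w \<oplus> y" using p w yc positive_part_carrier by (simp add: r_distr)
      finally have "x \<otimes> (\<theta> p \<ominus> w) = y"
        using w xc yc tc[OF p(1)] by (simp add: minus_eq r_distr r_minus) (simp add: a_ac r_neg r_neg1 l_neg r_neg2)
      then show False using y(2)[of "\<theta> p \<ominus> w"] tc[OF p(1)] w by simp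
    qed
    moreover have "\<one>\<^bsub>graded_hom A (term_of Res 1) Reg\<^esub> \<in> coboundaries A Res Reg 1"
    proof -
      have "(\<lambda>p\<in>carrier (term_of Res 0). \<zero>) \<in> hom_of_degree A 0 (term_of Res 0) Reg"
        unfolding hom_of_degree_def using P0.smult_closed G.grade_zero
          graded_group.grade_carrier[OF graded_right_module_graded_group[OF res_graded]] by auto
      then have "(\<lambda>p\<in>carrier (term_of Res 0). \<zero>) \<in> carrier (graded_hom A (term_of Res 0) Reg)"
        by (rule hom_of_degree_in_graded_hom[OF _ reg_abelian_group])
      moreover have "\<one>\<^bsub>graded_hom A (term_of Res 1) Reg\<^esub> =
        compose (carrier (term_of Res (Suc 0))) (\<lambda>p\<in>carrier (term_of Res 0). \<zero>) (diff_of Res 0)"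
        using hd(3) by (auto simp: graded_hom_simps compose_def)
      ultimately show ?thesis by (auto simp: coboundaries_def)
    qed
    moreover have "monoid.mult (graded_hom A (term_of Res 1) Reg) \<one>\<^bsub>graded_hom A (term_of Res 1) Reg\<^esub> \<psi> = \<psi>"
      using hom_of_degree_D(2,3)[OF \<psi>_hom] by (auto simp: graded_hom_simps fun_eq_iff extensional_def)
    ultimately show ?thesis
      unfolding graded_Ext_def by (intro resolution_cohomology_nontrivial)
  qed
  ultimately have *: "enat j \<in> {enat j |j. carrier (graded_Ext A j Top Reg) \<noteq> {\<one>\<^bsub>graded_Ext A j Top Reg\<^esub>}} \<Longrightarrow> 1 \<le> j"
    and **: "enat 1 \<in> {enat j |j. carrier (graded_Ext A j Top Reg) \<noteq> {\<one>\<^bsub>graded_Ext A j Top Reg\<^esub>}}" for j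
    by (auto simp: Suc_le_eq intro: gr0I)
  have "1 \<le> depth A"
    unfolding depth_def
  proof (rule Inf_greatest)
    fix k assume k: "k \<in> {enat j |j. carrier (graded_Ext A j Top Reg) \<noteq> {\<one>\<^bsub>graded_Ext A j Top Reg\<^esub>}}"
    then obtain m where "k = enat m" by blast
    then show "1 \<le> k" using k *[of m] by (simp add: one_enat_def)
  qed
  moreover have "depth A \<le> 1" unfolding depth_def one_enat_def by (rule Inf_lower[OF **])
  ultimately show ?thesis by simp
qed

end

section \<open>Path algebras\<close>

definition single :: "'k \<Rightarrow> 'p \<Rightarrow> 'p \<Rightarrow> 'k::zero" where
  "single c p = (\<lambda>q. if q = p then c else 0)"

lemma path_element_single: "path_element p = single 1 p"
  by (simp add: path_element_def single_def)

lemma path_algebra_simps: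
  "carrier (path_algebra Q) = {f. finite {p. f p \<noteq> 0} \<and> {p. f p \<noteq> 0} \<subseteq> paths Q}"
  "(f \<otimes>\<^bsub>path_algebra Q\<^esub> g) (u, p) =
     (\<Sum>i\<le>length p. f (u, take i p) * g (end_vertex Q u (take i p), drop i p))"
  "\<one>\<^bsub>path_algebra Q\<^esub> (u, p) = (if u \<in> verts Q \<and> p = [] then 1 else 0)"
  "\<zero>\<^bsub>path_algebra Q\<^esub> = (\<lambda>_. 0)"
  "f \<oplus>\<^bsub>path_algebra Q\<^esub> g = (\<lambda>p. f p + g p)"
  by (simp_all add: path_algebra_def)

lemma end_vertex_eq: "end_vertex Q u p = (if p = [] then u else head Q (last p))"
  by (induction p arbitrary: u) (auto simp: pre_digraph.awalk_verts.simps pre_digraph.awalk_verts_non_Nil)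

lemma end_vertex_append: "end_vertex Q u (p @ q) = end_vertex Q (end_vertex Q u p) q"
  by (auto simp: end_vertex_eq)

lemma successively_cex:
  "\<not> successively P xs \<Longrightarrow> \<exists>x a b y. xs = x @ a # b # y \<and> \<not> P a b"
proof (induction xs rule: induct_list012)
  case (3 a b zs)
  then show ?case by (metis append_Cons append_Nil successively.simps(3))
qed auto

text \<open>Two ways to record two cuts of a path of length \<open>n\<close>: the later cut
  \<open>i\<close> and then \<open>j \<le> i\<close>, or the earlier cut \<open>j\<close> and then
  the length \<open>k\<close> of the middle piece. This is what associativity of the path product
  comes down to.\<close>

lemma sum_triangle_reindex:
  fixes F :: "nat \<Rightarrow> nat \<Rightarrow> 'a::comm_monoid_add"
  shows "(\<Sum>i\<le>n. \<Sum>j\<le>i. F j i) = (\<Sum>j\<le>n. \<Sum>k\<le>n - j. F j (j + k))"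
  unfolding sum.Sigma[OF finite_atMost ballI[OF finite_atMost]]
  by (rule sum.reindex_bij_witness[where i = "\<lambda>(j, k). (j + k, j)" and j = "\<lambda>(i, j). (j, i - j)"]) auto

context fin_digraph
begin

text \<open>Turns the recursion of \<open>awalk\<close> into a condition on consecutive arrows, the
  form in which forbidden pairs can be expressed.\<close>

lemma paths_iff:
  "(u, p) \<in> paths G \<longleftrightarrow> u \<in> verts G \<and> set p \<subseteq> arcs G \<and>
     successively (\<lambda>a b. head G a = tail G b) p \<and> (p \<noteq> [] \<longrightarrow> u = tail G (hd p))"
proof (induction p arbitrary: u)
  case (Cons a p)
  have "(u, a # p) \<in> paths G \<longleftrightarrow> a \<in> arcs G \<and> u = tail G a \<and> (head G a, p) \<in> paths G"
    by (auto simp: paths_def awalk_Cons_iff)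
  then show ?case
    using Cons[of "head G a"] by (cases p) auto
qed (auto simp: paths_def awalk_Nil_iff)

lemma paths_append_iff:
  "(u, p @ q) \<in> paths G \<longleftrightarrow> (u, p) \<in> paths G \<and> (end_vertex G u p, q) \<in> paths G"
proof -
  have "p \<noteq> [] \<Longrightarrow> set p \<subseteq> arcs G \<Longrightarrow> head G (last p) \<in> verts G"
    using last_in_set[of p] head_in_verts by blast
  then show ?thesis
    by (auto simp: paths_iff end_vertex_eq successively_append_iff hd_append split: if_splits)
qed

lemma path_mult_support:
  assumes "(f \<otimes>\<^bsub>path_algebra G\<^esub> g) w \<noteq> 0"
  shows "\<exists>u p q. w = (u, p @ q) \<and> f (u, p) \<noteq> 0 \<and> g (end_vertex G u p, q) \<noteq> 0"
proof -
  obtain u r where w: "w = (u, r)" by fastforce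
  then have "(\<Sum>i\<le>length r. f (u, take i r) * g (end_vertex G u (take i r), drop i r)) \<noteq> 0"
    using assms by (simp add: path_algebra_simps)
  then obtain i where "f (u, take i r) * g (end_vertex G u (take i r), drop i r) \<noteq> 0"
    by (metis (mono_tags, lifting) sum.neutral)
  then show ?thesis
    using w by (intro exI[of _ u] exI[of _ "take i r"] exI[of _ "drop i r"]) auto
qed

lemma path_mult_closed:
  fixes f g :: "('a, 'b) path \<Rightarrow> 'k::field"
  assumes f: "f \<in> carrier (path_algebra G)" and g: "g \<in> carrier (path_algebra G)"
  shows "f \<otimes>\<^bsub>path_algebra G\<^esub> g \<in> carrier (path_algebra G)"
proof -
  let ?h = "f \<otimes>\<^bsub>path_algebra G\<^esub> g"
  have "{w. ?h w \<noteq> 0} \<subseteq> (\<lambda>((u, p), (x, q)). (u, p @ q)) ` ({w. f w \<noteq> 0} \<times> {w. g w \<noteq> 0})"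
  proof
    fix w assume "w \<in> {w. ?h w \<noteq> 0}"
    then obtain u p q where "w = (u, p @ q)" "f (u, p) \<noteq> 0" "g (end_vertex G u p, q) \<noteq> 0"
      using path_mult_support by blast
    then show "w \<in> (\<lambda>((u, p), (x, q)). (u, p @ q)) ` ({w. f w \<noteq> 0} \<times> {w. g w \<noteq> 0})"
      by (intro image_eqI[of _ _ "((u, p), (end_vertex G u p, q))"]) auto
  qed
  then have "finite {w. ?h w \<noteq> 0}"
    by (rule finite_subset) (use f g in \<open>simp add: path_algebra_simps\<close>)
  moreover have "w \<in> paths G" if w: "?h w \<noteq> 0" for w
  proof -
    obtain u p q where "w = (u, p @ q)" "f (u, p) \<noteq> 0" "g (end_vertex G u p, q) \<noteq> 0"
      using path_mult_support[OF w] by blast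
    then show ?thesis using f g by (auto simp: path_algebra_simps paths_append_iff)
  qed
  ultimately show ?thesis by (auto simp: path_algebra_simps)
qed

lemma path_mult_assoc:
  fixes f g h :: "('a, 'b) path \<Rightarrow> 'k::field"
  shows "f \<otimes>\<^bsub>path_algebra G\<^esub> g \<otimes>\<^bsub>path_algebra G\<^esub> h = f \<otimes>\<^bsub>path_algebra G\<^esub> (g \<otimes>\<^bsub>path_algebra G\<^esub> h)"
proof (rule ext, clarify)
  fix u :: 'a and p :: "'b list"
  let ?n = "length p"
  \<comment> \<open>The contribution of the cuts at positions \<open>j \<le> i\<close>, shared by
    both bracketings.\<close>
  define F where "F j i = f (u, take j p) * g (end_vertex G u (take j p), take (i - j) (drop j p)) *
    h (end_vertex G u (take i p), drop i p)" for j i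
  have "(f \<otimes>\<^bsub>path_algebra G\<^esub> g \<otimes>\<^bsub>path_algebra G\<^esub> h) (u, p) = (\<Sum>i\<le>?n. \<Sum>j\<le>i. F j i)"
    unfolding path_algebra_simps sum_distrib_right
    by (intro sum.cong refl) (auto simp: F_def min_def drop_take)
  also have "\<dots> = (\<Sum>j\<le>?n. \<Sum>k\<le>?n - j. F j (j + k))" by (rule sum_triangle_reindex)
  also have "\<dots> = (f \<otimes>\<^bsub>path_algebra G\<^esub> (g \<otimes>\<^bsub>path_algebra G\<^esub> h)) (u, p)"
    unfolding path_algebra_simps sum_distrib_left
    by (intro sum.cong refl)
      (auto simp: F_def take_add end_vertex_append add.commute mult.assoc)
  finally show "(f \<otimes>\<^bsub>path_algebra G\<^esub> g \<otimes>\<^bsub>path_algebra G\<^esub> h) (u, p) =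
    (f \<otimes>\<^bsub>path_algebra G\<^esub> (g \<otimes>\<^bsub>path_algebra G\<^esub> h)) (u, p)" .
qed

lemma single_mult:
  fixes c d :: "'k::field"
  shows "single c (u, p) \<otimes>\<^bsub>path_algebra G\<^esub> single d (w, q) =
    (if end_vertex G u p = w then single (c * d) (u, p @ q) else (\<lambda>_. 0))"
proof (rule ext, clarify)
  fix x :: 'a and r :: "'b list"
  \<comment> \<open>Only the cut right after \<open>p\<close> can contribute.\<close>
  have "single c (u, p) (x, take i r) * single d (w, q) (end_vertex G x (take i r), drop i r) =
    (if i = length p then if end_vertex G u p = w \<and> (x, r) = (u, p @ q) then c * d else 0 else 0)"
    if i: "i \<le> length r" for i
  proof (cases "x = u \<and> take i r = p")
    case True
    then have "i = length p" "r = p @ drop i r" using i by auto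
    then have "(x, r) = (u, p @ q) \<longleftrightarrow> drop i r = q" using True by (metis Pair_inject append_same_eq same_append_eq)
    then show ?thesis using True \<open>i = length p\<close> by (simp add: single_def)
  next
    case False
    then have "single c (u, p) (x, take i r) = 0" by (auto simp: single_def)
    moreover have "\<not> (i = length p \<and> (x, r) = (u, p @ q))" using False by auto
    ultimately show ?thesis by (simp only: mult_zero_left) auto
  qed
  then have "(single c (u, p) \<otimes>\<^bsub>path_algebra G\<^esub> single d (w, q)) (x, r) =
    (\<Sum>i\<le>length r. if i = length p then if end_vertex G u p = w \<and> (x, r) = (u, p @ q) then c * d else 0 else 0)"
    unfolding path_algebra_simps by (intro sum.cong refl) auto
  also have "\<dots> = (if end_vertex G u p = w then single (c * d) (u, p @ q) else (\<lambda>_. 0)) (x, r)"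
    by (auto simp: single_def)
  finally show "(single c (u, p) \<otimes>\<^bsub>path_algebra G\<^esub> single d (w, q)) (x, r) =
    (if end_vertex G u p = w then single (c * d) (u, p @ q) else (\<lambda>_. 0)) (x, r)" .
qed

lemma single_carrier: "p \<in> paths G \<Longrightarrow> single c p \<in> carrier (path_algebra G)"
  by (auto simp: path_algebra_simps single_def)

lemma path_algebra_ring: "ring (path_algebra G :: (('a, 'b) path \<Rightarrow> 'k::field) ring)"
proof (rule ringI)
  let ?B = "path_algebra G :: (('a, 'b) path \<Rightarrow> 'k) ring"
  have fin: "finite {p. f p + g p \<noteq> (0::'k)}" if "finite {p. f p \<noteq> 0}" "finite {p. g p \<noteq> 0}"
    for f g :: "('a, 'b) path \<Rightarrow> 'k"
    by (rule finite_subset[OF _ finite_UnI[OF that]]) auto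
  show "abelian_group ?B"
  proof (rule abelian_groupI)
    fix f g assume fg: "f \<in> carrier ?B" "g \<in> carrier ?B"
    have "p \<in> paths G" if "f p + g p \<noteq> 0" for p
      using that fg by (cases "f p = 0") (auto simp: path_algebra_simps)
    then show "f \<oplus>\<^bsub>?B\<^esub> g \<in> carrier ?B" using fin[of f g] fg by (auto simp: path_algebra_simps)
  next
    fix f assume "f \<in> carrier ?B"
    then show "\<exists>g\<in>carrier ?B. g \<oplus>\<^bsub>?B\<^esub> f = \<zero>\<^bsub>?B\<^esub>"
      by (intro bexI[of _ "\<lambda>p. - f p"]) (auto simp: path_algebra_simps)
  qed (auto simp: path_algebra_simps algebra_simps)
  show "monoid ?B"
  proof (rule monoidI)
    show "\<one>\<^bsub>?B\<^esub> \<in> carrier ?B"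
    proof -
      have "{p. \<one>\<^bsub>?B\<^esub> p \<noteq> 0} \<subseteq> (\<lambda>u. (u, [])) ` verts G"
        by (auto simp: path_algebra_simps split: if_splits)
      then show ?thesis
        using finite_subset[OF _ finite_imageI[OF finite_verts]] by (auto simp: path_algebra_simps(1) paths_iff)
    qed
    fix f assume f: "f \<in> carrier ?B"
    show "\<one>\<^bsub>?B\<^esub> \<otimes>\<^bsub>?B\<^esub> f = f"
    proof (rule ext, clarify)
      fix u p
      have "(\<one>\<^bsub>?B\<^esub> \<otimes>\<^bsub>?B\<^esub> f) (u, p) = (\<Sum>i\<le>length p. if i = 0 then f (u, p) else 0)"
        unfolding path_algebra_simps(2)
      proof (rule sum.cong[OF refl])
        fix i assume "i \<in> {..length p}"
        then show "\<one>\<^bsub>?B\<^esub> (u, take i p) * f (end_vertex G u (take i p), drop i p) = (if i = 0 then f (u, p) else 0)"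
          using f by (auto simp: path_algebra_simps end_vertex_eq paths_iff)
      qed
      then show "(\<one>\<^bsub>?B\<^esub> \<otimes>\<^bsub>?B\<^esub> f) (u, p) = f (u, p)" by simp
    qed
    show "f \<otimes>\<^bsub>?B\<^esub> \<one>\<^bsub>?B\<^esub> = f"
    proof (rule ext, clarify)
      fix u p
      have "(f \<otimes>\<^bsub>?B\<^esub> \<one>\<^bsub>?B\<^esub>) (u, p) = (\<Sum>i\<le>length p. if i = length p then f (u, p) else 0)"
        unfolding path_algebra_simps(2)
      proof (rule sum.cong[OF refl])
        fix i assume i: "i \<in> {..length p}"
        have "end_vertex G u p \<in> verts G" if "f (u, p) \<noteq> 0"
        proof -
          have "(u, p) \<in> paths G" using that f by (auto simp: path_algebra_simps)
          then have "(end_vertex G u p, []) \<in> paths G" using paths_append_iff[of u p "[]"] by simp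
          then show ?thesis by (simp only: paths_iff)
        qed
        then show "f (u, take i p) * \<one>\<^bsub>?B\<^esub> (end_vertex G u (take i p), drop i p) = (if i = length p then f (u, p) else 0)"
          using i by (auto simp: path_algebra_simps)
      qed
      then show "(f \<otimes>\<^bsub>?B\<^esub> \<one>\<^bsub>?B\<^esub>) (u, p) = f (u, p)" by simp
    qed
  qed (rule path_mult_closed path_mult_assoc; assumption)+
qed (auto simp: path_algebra_simps fun_eq_iff algebra_simps sum.distrib)

end

section \<open>Monomial quadratic algebras\<close>

locale quadratic_algebra = fin_digraph Q for Q :: "('v, 'e) pre_digraph" +
  fixes R :: "('v, 'e) path set" and I :: "(('v, 'e) path \<Rightarrow> 'k::field) set"
  assumes relations: "R \<subseteq> {p \<in> paths Q. length (snd p) = 2}"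
    and ideal_eq: "I = Idl\<^bsub>path_algebra Q\<^esub> (path_element ` R)"
begin

text \<open>The relation that the product of two arrows is nonzero. It refers to the generators
  \<open>R\<close> rather than to \<open>I\<close>, so that nonzero paths can be named before the
  ideal is determined.\<close>

definition step :: "'e \<Rightarrow> 'e \<Rightarrow> bool" where
  "step a b \<longleftrightarrow> a \<in> arcs Q \<and> b \<in> arcs Q \<and> head Q a = tail Q b \<and> (tail Q a, [a, b]) \<notin> R"

text \<open>The paths without a relation as a segment: the standard monomial basis of the
  quotient.\<close>

definition nz_paths :: "('v, 'e) path set" where
  "nz_paths = {(u, p). u \<in> verts Q \<and> set p \<subseteq> arcs Q \<and> successively step p \<and> (p \<noteq> [] \<longrightarrow> u = tail Q (hd p))}"

abbreviation "PA \<equiv> path_algebra Q :: (('v, 'e) path \<Rightarrow> 'k) ring"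

lemma nz_paths_iff: "(u, p) \<in> nz_paths \<longleftrightarrow> u \<in> verts Q \<and> set p \<subseteq> arcs Q \<and> successively step p \<and> (p \<noteq> [] \<longrightarrow> u = tail Q (hd p))"
  by (simp add: nz_paths_def)

lemma nz_paths_subset: "nz_paths \<subseteq> paths Q"
  by (auto simp: nz_paths_iff paths_iff step_def elim: successively_mono)

text \<open>Relations have length 2, so joining two composable nonzero paths can fail only at the
  junction.\<close>

lemma nz_paths_append_iff:
  "(u, p @ q) \<in> nz_paths \<longleftrightarrow> (u, p) \<in> nz_paths \<and> (end_vertex Q u p, q) \<in> nz_paths \<and>
     (p \<noteq> [] \<longrightarrow> q \<noteq> [] \<longrightarrow> step (last p) (hd q))"
  by (auto simp: nz_paths_iff end_vertex_eq successively_append_iff hd_append step_def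
      dest: last_in_set split: if_splits)

lemma nz_paths_take: "(u, p) \<in> nz_paths \<Longrightarrow> (u, take i p) \<in> nz_paths"
  and nz_paths_drop: "(u, p) \<in> nz_paths \<Longrightarrow> (end_vertex Q u (take i p), drop i p) \<in> nz_paths"
  using nz_paths_append_iff[of u "take i p" "drop i p"] by auto

lemma zero_path_factor:
  assumes "(u, p) \<in> paths Q" "(u, p) \<notin> nz_paths"
  obtains x a b y where "p = x @ [a, b] @ y" "(tail Q a, [a, b]) \<in> R"
    "(u, x) \<in> paths Q" "end_vertex Q u x = tail Q a" "(head Q b, y) \<in> paths Q"
proof -
  have "\<not> successively step p" using assms by (auto simp: nz_paths_iff paths_iff)
  then obtain x a b y where p: "p = x @ a # b # y" "\<not> step a b" using successively_cex by blast
  have *: "(u, x @ [a, b] @ y) \<in> paths Q" using assms(1) p by simp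
  then have "(u, x) \<in> paths Q" "(end_vertex Q u x, [a, b]) \<in> paths Q" "(head Q b, y) \<in> paths Q"
    unfolding paths_append_iff by (auto simp: end_vertex_eq)
  moreover from this have "end_vertex Q u x = tail Q a" "(tail Q a, [a, b]) \<in> R"
    using p(2) by (auto simp: paths_iff step_def)
  ultimately show ?thesis using that p by auto
qed

lemma relations_not_nz: "r \<in> R \<Longrightarrow> r \<notin> nz_paths"
proof
  assume r: "r \<in> R" "r \<in> nz_paths"
  then obtain u a b where "r = (u, [a, b])"
    using relations by (cases r) (auto simp: length_Suc_conv numeral_2_eq_2)
  then show False using r by (auto simp: nz_paths_iff step_def)
qed

sublocale B: ring PA by (rule path_algebra_ring)

text \<open>Such a path has a forbidden pair of consecutive arrows, so it is a relation multiplied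
  by a path on each side.\<close>

lemma single_in_ideal:
  assumes "p \<in> paths Q" "p \<notin> nz_paths"
  shows "single c p \<in> I"
proof -
  have gens: "path_element ` R \<subseteq> carrier PA"
    using relations by (auto simp: path_element_single intro: single_carrier)
  interpret I: ideal I PA unfolding ideal_eq by (rule B.genideal_ideal[OF gens])
  obtain u q where p: "p = (u, q)" by fastforce
  obtain x a b y where q: "q = x @ [a, b] @ y" "(tail Q a, [a, b]) \<in> R"
    "(u, x) \<in> paths Q" "end_vertex Q u x = tail Q a" "(head Q b, y) \<in> paths Q"
    using zero_path_factor assms p by metis
  have "single 1 (tail Q a, [a, b]) \<in> I"
    unfolding ideal_eq using B.genideal_self[OF gens] q(2) by (auto simp: path_element_single)
  then have "single c (u, x) \<otimes>\<^bsub>PA\<^esub> single 1 (tail Q a, [a, b]) \<otimes>\<^bsub>PA\<^esub> single 1 (head Q b, y) \<in> I"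
    using q by (intro I.I_l_closed I.I_r_closed single_carrier)
  then show ?thesis using q by (simp add: single_mult p end_vertex_eq)
qed

text \<open>\<open>I\<close> is a monomial ideal. The functions vanishing on \<open>nz_paths\<close>
  form an ideal, since the segments of a nonzero path are nonzero, and it contains the generators.
  Conversely, a finitely supported function off \<open>nz_paths\<close> is a sum of multiples of
  paths that factor through a relation.\<close>

lemma ideal_iff: "f \<in> I \<longleftrightarrow> f \<in> carrier PA \<and> (\<forall>p\<in>nz_paths. f p = 0)"
proof
  have gens: "path_element ` R \<subseteq> carrier PA"
    using relations by (auto simp: path_element_single intro: single_carrier)
  interpret I: ideal I PA unfolding ideal_eq by (rule B.genideal_ideal[OF gens])
  let ?J = "{f \<in> carrier PA. \<forall>p\<in>nz_paths. f p = 0}"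
  have neg: "\<ominus>\<^bsub>PA\<^esub> f = (\<lambda>p. - f p)" if "f \<in> carrier PA" for f
    using that by (intro B.minus_equality) (auto simp: path_algebra_simps)
  have "ideal ?J PA"
  proof (intro idealI B.ring_axioms B.add.subgroupI)
    fix f g assume f: "f \<in> ?J" and g: "g \<in> carrier PA"
    have "(g \<otimes>\<^bsub>PA\<^esub> f) (u, p) = 0" "(f \<otimes>\<^bsub>PA\<^esub> g) (u, p) = 0" if "(u, p) \<in> nz_paths" for u p
      using f nz_paths_take[OF that] nz_paths_drop[OF that] by (auto simp: path_algebra_simps)
    then show "g \<otimes>\<^bsub>PA\<^esub> f \<in> ?J" "f \<otimes>\<^bsub>PA\<^esub> g \<in> ?J" using f g by auto
  next
    fix f assume f: "f \<in> ?J"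
    then show "\<ominus>\<^bsub>PA\<^esub> f \<in> ?J" using B.a_inv_closed[of f] neg[of f] by auto
  next
    fix f g assume "f \<in> ?J" "g \<in> ?J"
    then show "f \<oplus>\<^bsub>PA\<^esub> g \<in> ?J" using B.a_closed[of f g] by (auto simp: path_algebra_simps)
  qed (use B.zero_closed in \<open>auto simp: path_algebra_simps\<close>)
  moreover have "path_element ` R \<subseteq> ?J"
    using gens relations_not_nz by (auto simp: path_element_single single_def)
  ultimately have "I \<subseteq> ?J" unfolding ideal_eq by (rule B.genideal_minimal)
  then show "f \<in> I \<Longrightarrow> f \<in> carrier PA \<and> (\<forall>p\<in>nz_paths. f p = 0)" by blast
  assume f: "f \<in> carrier PA \<and> (\<forall>p\<in>nz_paths. f p = 0)"
  have "finite S \<Longrightarrow> S \<subseteq> paths Q - nz_paths \<Longrightarrow> (\<lambda>p. if p \<in> S then f p else 0) \<in> I" for S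
  proof (induction S rule: finite_induct)
    case empty then show ?case using I.zero_closed by (simp add: path_algebra_simps)
  next
    case (insert s S)
    then have "single (f s) s \<oplus>\<^bsub>PA\<^esub> (\<lambda>p. if p \<in> S then f p else 0) \<in> I"
      by (intro I.a_closed single_in_ideal) auto
    moreover have "single (f s) s \<oplus>\<^bsub>PA\<^esub> (\<lambda>p. if p \<in> S then f p else 0) = (\<lambda>p. if p \<in> insert s S then f p else 0)"
      using insert by (auto simp: path_algebra_simps single_def)
    ultimately show ?case by simp
  qed
  from this[of "{p. f p \<noteq> 0}"] have "(\<lambda>p. if p \<in> {p. f p \<noteq> 0} then f p else 0) \<in> I"
    using f by (auto simp: path_algebra_simps)
  moreover have "(\<lambda>p. if p \<in> {p. f p \<noteq> 0} then f p else 0) = f" by auto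
  ultimately show "f \<in> I" by simp
qed

sublocale I: ideal I PA
  unfolding ideal_eq
  by (rule B.genideal_ideal) (use relations in \<open>auto simp: path_element_single intro: single_carrier\<close>)

lemma path_element_in_ideal_iff: "p \<in> paths Q \<Longrightarrow> path_element p \<in> I \<longleftrightarrow> p \<notin> nz_paths"
  by (auto simp: ideal_iff path_element_single single_carrier) (auto simp: single_def)

subsection \<open>Coordinates with respect to the nonzero paths\<close>

abbreviation "AA \<equiv> quiver_algebra Q I"

definition cls :: "(('v, 'e) path \<Rightarrow> 'k) \<Rightarrow> (('v, 'e) path \<Rightarrow> 'k) set" where
  "cls f = I +>\<^bsub>PA\<^esub> f"

text \<open>Coordinates are read from an arbitrary representative and restricted to
  \<open>nz_paths\<close>, where by \<open>ideal_iff\<close> all representatives agree. Equations in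
  the quotient become equations of functions.\<close>

definition coord :: "(('v, 'e) path \<Rightarrow> 'k) set \<Rightarrow> ('v, 'e) path \<Rightarrow> 'k" where
  "coord X = (\<lambda>p. if p \<in> nz_paths then (SOME f. f \<in> X) p else 0)"

lemma coord_cls:
  assumes "f \<in> carrier PA"
  shows "coord (cls f) p = (if p \<in> nz_paths then f p else 0)"
proof -
  have "f \<in> cls f" unfolding cls_def by (rule I.a_rcos_self[OF assms])
  then have "(SOME g. g \<in> cls f) \<in> cls f" by (rule someI[of "\<lambda>g. g \<in> cls f"])
  then obtain i where "i \<in> I" "(SOME g. g \<in> cls f) = i \<oplus>\<^bsub>PA\<^esub> f"
    by (auto simp: cls_def a_r_coset_def')
  then show ?thesis by (auto simp: coord_def path_algebra_simps ideal_iff)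
qed

lemma quiver_algebra_simps:
  "carrier AA = cls ` carrier PA"
  "\<zero>\<^bsub>AA\<^esub> = cls \<zero>\<^bsub>PA\<^esub>" "\<one>\<^bsub>AA\<^esub> = cls \<one>\<^bsub>PA\<^esub>"
  "f \<in> carrier PA \<Longrightarrow> g \<in> carrier PA \<Longrightarrow> cls f \<oplus>\<^bsub>AA\<^esub> cls g = cls (f \<oplus>\<^bsub>PA\<^esub> g)"
  "f \<in> carrier PA \<Longrightarrow> g \<in> carrier PA \<Longrightarrow> cls f \<otimes>\<^bsub>AA\<^esub> cls g = cls (f \<otimes>\<^bsub>PA\<^esub> g)"
proof -
  have unf: "carrier AA = a_rcosets\<^bsub>PA\<^esub> I" "\<zero>\<^bsub>AA\<^esub> = I" "\<one>\<^bsub>AA\<^esub> = I +>\<^bsub>PA\<^esub> \<one>\<^bsub>PA\<^esub>"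
    "X \<oplus>\<^bsub>AA\<^esub> Y = X <+>\<^bsub>PA\<^esub> Y" "X \<otimes>\<^bsub>AA\<^esub> Y = rcoset_mult PA I X Y" for X Y
    by (simp_all add: quiver_algebra_def Let_def FactRing_def)
  show "carrier AA = cls ` carrier PA"
    unfolding unf(1) by (auto simp: cls_def A_RCOSETS_def RCOSETS_def a_r_coset_def)
  show "\<zero>\<^bsub>AA\<^esub> = cls \<zero>\<^bsub>PA\<^esub>"
    unfolding unf(2) cls_def by (rule B.a_coset_add_zero[OF I.a_subset, symmetric])
  show "\<one>\<^bsub>AA\<^esub> = cls \<one>\<^bsub>PA\<^esub>" unfolding unf(3) cls_def ..
  show "cls f \<oplus>\<^bsub>AA\<^esub> cls g = cls (f \<oplus>\<^bsub>PA\<^esub> g)" if "f \<in> carrier PA" "g \<in> carrier PA"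
    unfolding unf(4) cls_def by (rule I.a_rcos_sum[OF that])
  show "cls f \<otimes>\<^bsub>AA\<^esub> cls g = cls (f \<otimes>\<^bsub>PA\<^esub> g)" if "f \<in> carrier PA" "g \<in> carrier PA"
    unfolding unf(5) cls_def by (rule I.rcoset_mult_add[OF that])
qed

lemma quiver_algebra_ring: "ring AA"
proof -
  interpret QR: ring "PA Quot I" by (rule I.quotient_is_ring)
  have eqs: "carrier AA = carrier (PA Quot I)" "\<zero>\<^bsub>AA\<^esub> = \<zero>\<^bsub>PA Quot I\<^esub>" "\<one>\<^bsub>AA\<^esub> = \<one>\<^bsub>PA Quot I\<^esub>"
    "\<And>x y. x \<oplus>\<^bsub>AA\<^esub> y = x \<oplus>\<^bsub>PA Quot I\<^esub> y" "\<And>x y. x \<otimes>\<^bsub>AA\<^esub> y = x \<otimes>\<^bsub>PA Quot I\<^esub> y"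
    by (simp_all add: quiver_algebra_def Let_def)
  show ?thesis
    by (intro ringI abelian_groupI monoidI; (unfold eqs)?)
      (auto simp: QR.a_ac QR.m_assoc QR.l_distr QR.r_distr intro: QR.l_neg bexI[of _ "\<ominus>\<^bsub>PA Quot I\<^esub> x" for x])
qed

sublocale AA: ring AA by (rule quiver_algebra_ring)

lemma coord_support:
  assumes "X \<in> carrier AA"
  shows "finite {p. coord X p \<noteq> 0}" "coord X p \<noteq> 0 \<Longrightarrow> p \<in> nz_paths"
proof -
  obtain f where f: "f \<in> carrier PA" "X = cls f" using assms by (auto simp: quiver_algebra_simps)
  have "{p. coord X p \<noteq> 0} \<subseteq> {p. f p \<noteq> 0}" using f by (auto simp: coord_cls)
  then show "finite {p. coord X p \<noteq> 0}"
    by (rule finite_subset) (use f in \<open>simp add: path_algebra_simps\<close>)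
qed (auto simp: coord_def split: if_splits)

lemma coord_outside: "p \<notin> nz_paths \<Longrightarrow> coord X p = 0"
  by (simp add: coord_def)

lemma coord_inj:
  assumes "X \<in> carrier AA" "Y \<in> carrier AA" "\<And>p. p \<in> nz_paths \<Longrightarrow> coord X p = coord Y p"
  shows "X = Y"
proof -
  obtain f g where f: "f \<in> carrier PA" "X = cls f" and g: "g \<in> carrier PA" "Y = cls g"
    using assms by (auto simp: quiver_algebra_simps)
  have neg: "\<ominus>\<^bsub>PA\<^esub> g = (\<lambda>p. - g p)"
    using g by (intro B.minus_equality) (auto simp: path_algebra_simps)
  have eq: "f p = g p" if "p \<in> nz_paths" for p
    using assms(3)[OF that] f g that by (simp add: coord_cls)
  have "f \<ominus>\<^bsub>PA\<^esub> g = (\<lambda>p. f p - g p)"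
    by (simp add: a_minus_def neg path_algebra_simps)
  then have "f \<ominus>\<^bsub>PA\<^esub> g \<in> I"
    using eq f g B.minus_closed[OF f(1) g(1)] by (simp add: ideal_iff)
  then have "f \<in> I +>\<^bsub>PA\<^esub> g" using I.a_rcos_module_minus[OF B.ring_axioms g(1) f(1)] by simp
  then show ?thesis
    unfolding f(2) g(2) cls_def using I.a_repr_independence' g(1) by blast
qed

text \<open>The same map as \<open>cls\<close>; the separate name marks its use on functions
  supported in \<open>nz_paths\<close>, where \<open>coord\<close> inverts it.\<close>

definition of_coord :: "(('v, 'e) path \<Rightarrow> 'k) \<Rightarrow> (('v, 'e) path \<Rightarrow> 'k) set" where
  "of_coord f = cls f"

lemma of_coord:
  assumes "finite {p. f p \<noteq> 0}" "\<And>p. f p \<noteq> 0 \<Longrightarrow> p \<in> nz_paths"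
  shows "of_coord f \<in> carrier AA" "coord (of_coord f) = f"
proof -
  have f: "f \<in> carrier PA" using assms nz_paths_subset by (auto simp: path_algebra_simps)
  show "of_coord f \<in> carrier AA" using f by (auto simp: of_coord_def quiver_algebra_simps)
  show "coord (of_coord f) = f"
    using assms(2) by (auto simp: of_coord_def coord_cls[OF f] fun_eq_iff)
qed

lemma coord_add: "X \<in> carrier AA \<Longrightarrow> Y \<in> carrier AA \<Longrightarrow> coord (X \<oplus>\<^bsub>AA\<^esub> Y) p = coord X p + coord Y p"
  by (auto simp: quiver_algebra_simps(1,4) coord_cls B.a_closed) (auto simp: path_algebra_simps)

lemma coord_zero: "coord \<zero>\<^bsub>AA\<^esub> p = 0"
  by (auto simp: quiver_algebra_simps coord_cls) (auto simp: path_algebra_simps)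

lemma coord_one: "coord \<one>\<^bsub>AA\<^esub> (u, p) = (if u \<in> verts Q \<and> p = [] then 1 else 0)"
  by (auto simp: quiver_algebra_simps coord_cls) (auto simp: path_algebra_simps nz_paths_iff)

text \<open>The formula of the path algebra survives in the quotient because every segment of a
  nonzero path is nonzero and can be read off in coordinates.\<close>

lemma coord_mult:
  assumes "X \<in> carrier AA" "Y \<in> carrier AA" "(u, p) \<in> nz_paths"
  shows "coord (X \<otimes>\<^bsub>AA\<^esub> Y) (u, p) =
    (\<Sum>i\<le>length p. coord X (u, take i p) * coord Y (end_vertex Q u (take i p), drop i p))"
proof -
  obtain f g where f: "f \<in> carrier PA" "X = cls f" and g: "g \<in> carrier PA" "Y = cls g"
    using assms by (auto simp: quiver_algebra_simps)
  have "coord (X \<otimes>\<^bsub>AA\<^esub> Y) (u, p) = (f \<otimes>\<^bsub>PA\<^esub> g) (u, p)"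
    using f g assms(3) by (simp add: quiver_algebra_simps coord_cls)
  also have "\<dots> = (\<Sum>i\<le>length p. coord X (u, take i p) * coord Y (end_vertex Q u (take i p), drop i p))"
    unfolding path_algebra_simps(2)
    using f g nz_paths_take[OF assms(3)] nz_paths_drop[OF assms(3)] by (simp add: coord_cls)
  finally show ?thesis .
qed

lemma coord_uminus:
  assumes "X \<in> carrier AA" shows "coord (\<ominus>\<^bsub>AA\<^esub> X) p = - coord X p"
  using coord_add[OF AA.a_inv_closed[OF assms] assms, of p] coord_zero[of p] assms
  by (simp add: AA.l_neg eq_neg_iff_add_eq_0)

lemma coord_minus:
  "X \<in> carrier AA \<Longrightarrow> Y \<in> carrier AA \<Longrightarrow> coord (X \<ominus>\<^bsub>AA\<^esub> Y) p = coord X p - coord Y p"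
  by (simp add: AA.minus_eq coord_add coord_uminus)

lemma coord_finsum:
  assumes "finite F" "g \<in> F \<rightarrow> carrier AA"
  shows "coord (finsum AA g F) p = (\<Sum>i\<in>F. coord (g i) p)"
  using assms by (induction F rule: finite_induct) (auto simp: coord_zero coord_add AA.finsum_insert Pi_iff)

lemma rgrade_iff:
  "X \<in> rgrade AA i \<longleftrightarrow> X \<in> carrier AA \<and> (\<forall>p. coord X p \<noteq> 0 \<longrightarrow> int (length (snd p)) = i)"
proof
  assume "X \<in> rgrade AA i"
  then obtain f where "f \<in> carrier PA" "\<And>p. f p \<noteq> 0 \<Longrightarrow> int (length (snd p)) = i" "X = cls f"
    by (auto simp: quiver_algebra_def Let_def cls_def)
  then show "X \<in> carrier AA \<and> (\<forall>p. coord X p \<noteq> 0 \<longrightarrow> int (length (snd p)) = i)"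
    by (auto simp: quiver_algebra_simps coord_cls split: if_splits)
next
  assume X: "X \<in> carrier AA \<and> (\<forall>p. coord X p \<noteq> 0 \<longrightarrow> int (length (snd p)) = i)"
  then have "coord X \<in> carrier PA"
    using coord_support[of X] nz_paths_subset by (auto simp: path_algebra_simps)
  moreover have "X = cls (coord X)"
    using X coord_support[of X] of_coord[of "coord X"] by (intro coord_inj) (auto simp: of_coord_def)
  ultimately show "X \<in> rgrade AA i"
    using X by (auto simp: quiver_algebra_def Let_def cls_def)
qed

lemma scalars_iff:
  "X \<in> scalars Q I \<longleftrightarrow> X \<in> carrier AA \<and> (\<exists>c. \<forall>p. coord X p = c * coord \<one>\<^bsub>AA\<^esub> p)"
proof
  have one: "(\<lambda>p. c * \<one>\<^bsub>PA\<^esub> p) \<in> carrier PA" for c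
    using B.one_closed by (auto simp: path_algebra_simps(1) elim: finite_subset[rotated])
  have cc: "coord (cls (\<lambda>p. c * \<one>\<^bsub>PA\<^esub> p)) p = c * coord \<one>\<^bsub>AA\<^esub> p" for c p
    by (simp add: coord_cls[OF one] quiver_algebra_simps coord_cls[OF B.one_closed])
  have in_A: "cls (\<lambda>p. c * \<one>\<^bsub>PA\<^esub> p) \<in> carrier AA" for c
    using one by (auto simp: quiver_algebra_simps)
  show "X \<in> carrier AA \<and> (\<exists>c. \<forall>p. coord X p = c * coord \<one>\<^bsub>AA\<^esub> p)" if "X \<in> scalars Q I"
    using that cc in_A unfolding scalars_def cls_def by auto
  assume X: "X \<in> carrier AA \<and> (\<exists>c. \<forall>p. coord X p = c * coord \<one>\<^bsub>AA\<^esub> p)"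
  then obtain c where c: "\<And>p. coord X p = c * coord \<one>\<^bsub>AA\<^esub> p" by blast
  have "X = cls (\<lambda>p. c * \<one>\<^bsub>PA\<^esub> p)"
    by (rule coord_inj) (use X in_A cc c in auto)
  then show "X \<in> scalars Q I" unfolding scalars_def cls_def by blast
qed

end

section \<open>The grading by path length\<close>

text \<open>A vertex guarantees \<open>\<one> \<noteq> \<zero>\<close>, hence that the scalars form
  a field inside the algebra.\<close>

locale nonempty_quadratic_algebra = quadratic_algebra Q R I
  for Q :: "('v, 'e) pre_digraph" and R and I :: "(('v, 'e) path \<Rightarrow> 'k::field) set" +
  assumes verts_nonempty: "verts Q \<noteq> {}"
begin

definition truncate :: "(('v, 'e) path \<Rightarrow> bool) \<Rightarrow> (('v, 'e) path \<Rightarrow> 'k) set \<Rightarrow> (('v, 'e) path \<Rightarrow> 'k) set" where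
  "truncate P X = of_coord (\<lambda>p. if P p then coord X p else 0)"

lemma truncate:
  assumes "X \<in> carrier AA"
  shows "truncate P X \<in> carrier AA" "coord (truncate P X) p = (if P p then coord X p else 0)"
proof -
  have "finite {p. (if P p then coord X p else 0) \<noteq> 0}"
    by (rule finite_subset[OF _ coord_support(1)[OF assms]]) auto
  moreover have "(if P p then coord X p else 0) \<noteq> 0 \<Longrightarrow> p \<in> nz_paths" for p
    using coord_support(2)[OF assms] by (auto split: if_splits)
  ultimately have "truncate P X \<in> carrier AA \<and> coord (truncate P X) = (\<lambda>p. if P p then coord X p else 0)"
    unfolding truncate_def using of_coord[of "\<lambda>p. if P p then coord X p else 0"] by blast
  then show "truncate P X \<in> carrier AA" "coord (truncate P X) p = (if P p then coord X p else 0)"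
    by simp_all
qed

lemma coord_mult_nonzero:
  assumes "X \<in> carrier AA" "Y \<in> carrier AA" "coord (X \<otimes>\<^bsub>AA\<^esub> Y) (u, p) \<noteq> 0"
  obtains i where "i \<le> length p" "coord X (u, take i p) \<noteq> 0" "coord Y (end_vertex Q u (take i p), drop i p) \<noteq> 0"
proof -
  have "(u, p) \<in> nz_paths" using coord_support(2)[OF AA.m_closed[OF assms(1,2)] assms(3)] .
  from coord_mult[OF assms(1,2) this] assms(3)
  have "(\<Sum>i\<le>length p. coord X (u, take i p) * coord Y (end_vertex Q u (take i p), drop i p)) \<noteq> 0" by simp
  then obtain i where "i \<in> {..length p}" "coord X (u, take i p) * coord Y (end_vertex Q u (take i p), drop i p) \<noteq> 0"
    by (rule sum.not_neutral_contains_not_neutral)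
  then show ?thesis using that by auto
qed

lemma rgrade_subgroup: "additive_subgroup (rgrade AA i) AA"
proof (intro additive_subgroup.intro AA.add.subgroupI)
  have "\<zero>\<^bsub>AA\<^esub> \<in> rgrade AA i" by (simp add: rgrade_iff coord_zero)
  then show "rgrade AA i \<noteq> {}" by blast
next
  fix X assume "X \<in> rgrade AA i"
  then show "\<ominus>\<^bsub>AA\<^esub> X \<in> rgrade AA i" by (auto simp: rgrade_iff coord_uminus)
next
  fix X Y assume "X \<in> rgrade AA i" "Y \<in> rgrade AA i"
  then show "X \<oplus>\<^bsub>AA\<^esub> Y \<in> rgrade AA i" by (simp add: rgrade_iff coord_add) (metis add.right_neutral)
qed (auto simp: rgrade_iff)

lemma rgrade_D:
  assumes "X \<in> rgrade AA i"
  shows "X \<in> carrier AA" "int (length (snd p)) \<noteq> i \<Longrightarrow> coord X p = 0"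
  using assms unfolding rgrade_iff by blast+

text \<open>The projections keep the coordinates at the paths of one length.\<close>

lemma rgrade_internal_direct_sum: "internal_direct_sum AA (rgrade AA)"
proof -
  define pr where "pr i = truncate (\<lambda>p. int (length (snd p)) = i)" for i
  have pr: "pr i X \<in> carrier AA" "coord (pr i X) p = (if int (length (snd p)) = i then coord X p else 0)"
    if "X \<in> carrier AA" for X i p using truncate[OF that] by (auto simp: pr_def)
  have fin: "finite {i. pr i X \<noteq> \<zero>\<^bsub>AA\<^esub>}" if X: "X \<in> carrier AA" for X
  proof (rule finite_subset[OF _ finite_imageI[OF coord_support(1)[OF X]]])
    show "{i. pr i X \<noteq> \<zero>\<^bsub>AA\<^esub>} \<subseteq> (\<lambda>p. int (length (snd p))) ` {p. coord X p \<noteq> 0}"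
    proof
      fix i assume i: "i \<in> {i. pr i X \<noteq> \<zero>\<^bsub>AA\<^esub>}"
      have "\<exists>p. coord (pr i X) p \<noteq> 0"
      proof (rule ccontr)
        assume "\<nexists>p. coord (pr i X) p \<noteq> 0"
        then have "pr i X = \<zero>\<^bsub>AA\<^esub>" using pr(1)[OF X] by (intro coord_inj) (simp_all only: coord_zero AA.zero_closed not_ex not_not)
        then show False using i by simp
      qed
      then obtain p where "coord (pr i X) p \<noteq> 0" by blast
      then have "int (length (snd p)) = i" "coord X p \<noteq> 0" using pr(2)[OF X] by (auto split: if_splits)
      then show "i \<in> (\<lambda>p. int (length (snd p))) ` {p. coord X p \<noteq> 0}" by blast
    qed
  qed
  show ?thesis
  proof (rule AA.internal_direct_sumI[where p = pr])
    fix X assume X: "X \<in> carrier AA"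
    show "finite {i. pr i X \<noteq> \<zero>\<^bsub>AA\<^esub>}" by (rule fin[OF X])
    have sc: "(\<lambda>i. pr i X) \<in> {i. pr i X \<noteq> \<zero>\<^bsub>AA\<^esub>} \<rightarrow> carrier AA" using pr X by auto
    show "X = (\<Oplus>\<^bsub>AA\<^esub>i\<in>{i. pr i X \<noteq> \<zero>\<^bsub>AA\<^esub>}. pr i X)"
    proof (rule coord_inj[OF X AA.finsum_closed[OF sc]])
      fix p
      let ?J = "{i. pr i X \<noteq> \<zero>\<^bsub>AA\<^esub>}"
      have "coord (\<Oplus>\<^bsub>AA\<^esub>i\<in>?J. pr i X) p = (\<Sum>i\<in>?J. if i = int (length (snd p)) then coord X p else 0)"
        using coord_finsum[OF fin[OF X] sc] pr(2)[OF X] by (simp add: eq_commute)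
      also have "\<dots> = (if int (length (snd p)) \<in> ?J then coord X p else 0)"
        using fin[OF X] by simp
      also have "\<dots> = coord X p"
        using pr(2)[OF X, of "int (length (snd p))" p] coord_zero[of p] by auto
      finally show "coord X p = coord (\<Oplus>\<^bsub>AA\<^esub>i\<in>?J. pr i X) p" by simp
    qed
  next
    fix i X assume "X \<in> carrier AA"
    then show "pr i X \<in> rgrade AA i" by (auto simp: rgrade_iff pr split: if_splits)
  next
    fix i X Y assume "X \<in> carrier AA" "Y \<in> carrier AA"
    then show "pr i (X \<oplus>\<^bsub>AA\<^esub> Y) = pr i X \<oplus>\<^bsub>AA\<^esub> pr i Y"
      by (intro coord_inj) (auto simp: pr coord_add)
  next
    fix i X assume "X \<in> rgrade AA i"
    note X = rgrade_D[OF this]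
    show "pr i X = X" by (rule coord_inj) (use X(1) X(2)[symmetric] in \<open>simp_all add: pr del: split_paired_All\<close>)
  next
    fix i j X assume X: "X \<in> rgrade AA j" and ij: "i \<noteq> j"
    show "pr i X = \<zero>\<^bsub>AA\<^esub>"
      by (rule coord_inj) (use rgrade_D(1)[OF X] rgrade_D(2)[OF X] ij in \<open>simp_all add: pr coord_zero\<close>)
  qed (rule rgrade_subgroup)
qed

lemma one_not_zero: "\<one>\<^bsub>AA\<^esub> \<noteq> \<zero>\<^bsub>AA\<^esub>"
proof
  obtain v where "v \<in> verts Q" using verts_nonempty by blast
  moreover assume "\<one>\<^bsub>AA\<^esub> = \<zero>\<^bsub>AA\<^esub>"
  ultimately show False using coord_one[of v "[]"] coord_zero[of "(v, [])"] by simp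
qed

sublocale gr: nonneg_graded_ring AA
proof unfold_locales
  show "internal_direct_sum AA (rgrade AA)" by (rule rgrade_internal_direct_sum)
  show "\<one>\<^bsub>AA\<^esub> \<in> rgrade AA 0" by (auto simp: rgrade_iff coord_one split: if_splits)
  show "rgrade AA i = {\<zero>\<^bsub>AA\<^esub>}" if "i < 0" for i
  proof (intro subset_antisym subsetI)
    fix X assume X: "X \<in> rgrade AA i"
    then have "coord X p = 0" for p using rgrade_D(2)[OF X, of p] that by auto
    then have "X = \<zero>\<^bsub>AA\<^esub>" using X by (intro coord_inj) (auto simp: rgrade_iff coord_zero)
    then show "X \<in> {\<zero>\<^bsub>AA\<^esub>}" by simp
  qed (auto simp: rgrade_iff coord_zero)
  show "\<one>\<^bsub>AA\<^esub> \<noteq> \<zero>\<^bsub>AA\<^esub>" by (rule one_not_zero)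
  fix X Y i j assume X: "X \<in> rgrade AA i" and Y: "Y \<in> rgrade AA j"
  have "int (length p) = i + j" if nz: "coord (X \<otimes>\<^bsub>AA\<^esub> Y) (u, p) \<noteq> 0" for u p
  proof -
    obtain k where k: "k \<le> length p" "coord X (u, take k p) \<noteq> 0" "coord Y (end_vertex Q u (take k p), drop k p) \<noteq> 0"
      using coord_mult_nonzero[OF _ _ nz] X Y by (auto simp: rgrade_iff)
    then have "int (length (take k p)) = i" "int (length (drop k p)) = j"
      using rgrade_D(2)[OF X, of "(u, take k p)"] rgrade_D(2)[OF Y, of "(end_vertex Q u (take k p), drop k p)"]
      by auto
    then show ?thesis using k(1) by simp
  qed
  then show "X \<otimes>\<^bsub>AA\<^esub> Y \<in> rgrade AA (i + j)" using X Y by (auto simp: rgrade_iff)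
qed

lemma component_coord:
  assumes X: "X \<in> carrier AA"
  shows "coord (component AA (rgrade AA) i X) p = (if int (length (snd p)) = i then coord X p else 0)"
proof -
  have deg: "coord (gr.G.cmp j X) p = 0" if "int (length (snd p)) \<noteq> j" for j
    using rgrade_D(2)[OF gr.G.component_in[OF X]] that by simp
  show ?thesis
  proof (cases "int (length (snd p)) = i")
    case True
    let ?J = "insert i {j. gr.G.cmp j X \<noteq> \<zero>\<^bsub>AA\<^esub>}"
    have J: "finite ?J" using gr.G.component_finite[OF X] by simp
    have "coord X p = (\<Sum>j\<in>?J. coord (gr.G.cmp j X) p)"
      using gr.G.component_sum'[OF X J subset_insertI] coord_finsum[OF J, of "\<lambda>j. gr.G.cmp j X" p]
        gr.G.component_carrier[OF X] by simp
    also have "\<dots> = (\<Sum>j\<in>?J. if j = i then coord (gr.G.cmp i X) p else 0)"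
      by (rule sum.cong[OF refl]) (use True deg in simp)
    also have "\<dots> = coord (gr.G.cmp i X) p" using J by simp
    finally show ?thesis using True by simp
  qed (use deg in simp)
qed

lemma positive_part_coord:
  "X \<in> positive_part AA \<longleftrightarrow> X \<in> carrier AA \<and> (\<forall>u. coord X (u, []) = 0)"
proof -
  have "component AA (rgrade AA) 0 X = \<zero>\<^bsub>AA\<^esub> \<longleftrightarrow> (\<forall>u. coord X (u, []) = 0)" if X: "X \<in> carrier AA"
  proof
    assume "component AA (rgrade AA) 0 X = \<zero>\<^bsub>AA\<^esub>"
    then show "\<forall>u. coord X (u, []) = 0"
      using component_coord[OF X, of 0 "(u, [])" for u] coord_zero by simp
  next
    assume "\<forall>u. coord X (u, []) = 0"
    then show "component AA (rgrade AA) 0 X = \<zero>\<^bsub>AA\<^esub>"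
      by (intro coord_inj) (use gr.G.component_carrier[OF X] in \<open>auto simp: component_coord[OF X] coord_zero\<close>)
  qed
  then show ?thesis using gr.positive_part_iff by blast
qed

section \<open>Dimension and Gelfand--Kirillov dimension\<close>

abbreviation "KK \<equiv> scalars Q I"

definition scal :: "'k \<Rightarrow> (('v, 'e) path \<Rightarrow> 'k) set" where
  "scal c = of_coord (\<lambda>p. c * coord \<one>\<^bsub>AA\<^esub> p)"

lemma scal: "scal c \<in> carrier AA" "coord (scal c) p = c * coord \<one>\<^bsub>AA\<^esub> p"
proof -
  have "finite {p. c * coord \<one>\<^bsub>AA\<^esub> p \<noteq> 0}"
    by (rule finite_subset[OF _ coord_support(1)[OF AA.one_closed]]) auto
  moreover have "c * coord \<one>\<^bsub>AA\<^esub> p \<noteq> 0 \<Longrightarrow> p \<in> nz_paths" for p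
    using coord_support(2)[OF AA.one_closed] by auto
  ultimately have "scal c \<in> carrier AA \<and> coord (scal c) = (\<lambda>p. c * coord \<one>\<^bsub>AA\<^esub> p)"
    unfolding scal_def using of_coord[of "\<lambda>p. c * coord \<one>\<^bsub>AA\<^esub> p"] by blast
  then show "scal c \<in> carrier AA" "coord (scal c) p = c * coord \<one>\<^bsub>AA\<^esub> p" by simp_all
qed

lemma scalars_eq: "KK = range scal"
proof (intro subset_antisym subsetI)
  fix X assume "X \<in> KK"
  then obtain c where "X \<in> carrier AA" "\<And>p. coord X p = c * coord \<one>\<^bsub>AA\<^esub> p" by (auto simp: scalars_iff)
  then have "X = scal c" by (intro coord_inj) (auto simp: scal)
  then show "X \<in> range scal" by blast
qed (auto simp: scalars_iff scal)

text \<open>The unit is the sum of the trivial paths, so only the cut at position 0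
  contributes.\<close>

lemma coord_scal_l:
  assumes X: "X \<in> carrier AA" shows "coord (scal c \<otimes>\<^bsub>AA\<^esub> X) p = c * coord X p"
proof (cases "p \<in> nz_paths")
  case True
  obtain u q where p: "p = (u, q)" by fastforce
  have "coord (scal c \<otimes>\<^bsub>AA\<^esub> X) (u, q) = (\<Sum>i\<le>length q. if i = 0 then c * coord X (u, q) else 0)"
    unfolding coord_mult[OF scal(1) X True[unfolded p]]
  proof (rule sum.cong[OF refl])
    fix i assume "i \<in> {..length q}"
    then show "coord (scal c) (u, take i q) * coord X (end_vertex Q u (take i q), drop i q) =
      (if i = 0 then c * coord X (u, q) else 0)"
      using True p by (cases "i = 0") (auto simp: scal coord_one nz_paths_iff end_vertex_eq)
  qed
  then show ?thesis using p by simp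
qed (simp add: coord_outside)

lemma coord_scal_r:
  assumes X: "X \<in> carrier AA" shows "coord (X \<otimes>\<^bsub>AA\<^esub> scal c) p = c * coord X p"
proof (cases "p \<in> nz_paths")
  case True
  obtain u q where p: "p = (u, q)" by fastforce
  have "(end_vertex Q u q, []) \<in> nz_paths" using nz_paths_append_iff[of u q "[]"] True p by simp
  then have e: "end_vertex Q u q \<in> verts Q" by (simp add: nz_paths_iff)
  have "coord (X \<otimes>\<^bsub>AA\<^esub> scal c) (u, q) = (\<Sum>i\<le>length q. if i = length q then c * coord X (u, q) else 0)"
    unfolding coord_mult[OF X scal(1) True[unfolded p]]
  proof (rule sum.cong[OF refl])
    fix i assume "i \<in> {..length q}"
    then show "coord X (u, take i q) * coord (scal c) (end_vertex Q u (take i q), drop i q) =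
      (if i = length q then c * coord X (u, q) else 0)"
      using e by (cases "i = length q") (auto simp: scal coord_one)
  qed
  then show ?thesis using p by simp
qed (simp add: coord_outside)

lemma scal_add: "scal c \<oplus>\<^bsub>AA\<^esub> scal d = scal (c + d)"
  by (rule coord_inj) (auto simp: scal coord_add algebra_simps)

lemma scal_mult: "scal c \<otimes>\<^bsub>AA\<^esub> scal d = scal (c * d)"
  by (rule coord_inj) (auto simp: scal coord_scal_l algebra_simps)

lemma scal_one: "scal 1 = \<one>\<^bsub>AA\<^esub>"
  by (rule coord_inj) (auto simp: scal)

lemma scal_zero: "scal 0 = \<zero>\<^bsub>AA\<^esub>"
  by (rule coord_inj) (auto simp: scal coord_zero)

lemma scal_uminus: "\<ominus>\<^bsub>AA\<^esub> scal c = scal (- c)"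
  by (rule coord_inj) (auto simp: scal coord_uminus)

lemma scal_eq_zero: "scal c = \<zero>\<^bsub>AA\<^esub> \<longleftrightarrow> c = 0"
proof
  obtain v where v: "v \<in> verts Q" using verts_nonempty by blast
  assume "scal c = \<zero>\<^bsub>AA\<^esub>"
  then have "coord (scal c) (v, []) = 0" by (simp add: coord_zero)
  then show "c = 0" using v by (simp add: scal coord_one)
qed (simp add: scal_zero)

lemma scalars_subfield: "subfield KK AA"
proof (rule AA.subfieldI)
  have "subring KK AA"
    by (rule AA.subringI)
      (auto simp: scalars_eq scal scal_one[symmetric] scal_uminus scal_mult scal_add)
  then show "subcring KK AA"
    by (rule AA.subcringI) (auto simp: scalars_eq scal_mult mult.commute)
  show "Units (AA\<lparr>carrier := KK\<rparr>) = KK - {\<zero>\<^bsub>AA\<^esub>}"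
  proof (intro subset_antisym subsetI)
    fix X assume "X \<in> Units (AA\<lparr>carrier := KK\<rparr>)"
    then obtain Y where "X \<in> KK" "Y \<in> KK" "Y \<otimes>\<^bsub>AA\<^esub> X = \<one>\<^bsub>AA\<^esub>" by (auto simp: Units_def)
    then show "X \<in> KK - {\<zero>\<^bsub>AA\<^esub>}" using one_not_zero by (auto simp: scalars_eq scal AA.r_null)
  next
    fix X assume X: "X \<in> KK - {\<zero>\<^bsub>AA\<^esub>}"
    then have "X \<in> range scal" unfolding scalars_eq by (rule DiffD1)
    then obtain c where Xc: "X = scal c" by (rule rangeE)
    have c: "X = scal c" "c \<noteq> 0" using X Xc scal_zero by auto
    then have "scal (inverse c) \<otimes>\<^bsub>AA\<^esub> X = \<one>\<^bsub>AA\<^esub>" "X \<otimes>\<^bsub>AA\<^esub> scal (inverse c) = \<one>\<^bsub>AA\<^esub>"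
      by (simp_all add: scal_mult scal_one)
    moreover have "X \<in> KK" "scal (inverse c) \<in> KK" using c by (auto simp: scalars_eq)
    ultimately show "X \<in> Units (AA\<lparr>carrier := KK\<rparr>)"
      unfolding Units_def mem_Collect_eq
      by (intro conjI bexI[of _ "scal (inverse c)"]) simp_all
  qed
qed

text \<open>The span of the classes of the paths in \<open>T\<close>, described by coordinates. For
  a finite set of nonzero paths its dimension is \<open>card T\<close>, which turns questions of
  dimension into counting paths.\<close>

definition supported :: "('v, 'e) path set \<Rightarrow> (('v, 'e) path \<Rightarrow> 'k) set set" where
  "supported T = {X \<in> carrier AA. \<forall>p. coord X p \<noteq> 0 \<longrightarrow> p \<in> T}"

definition path_class :: "('v, 'e) path \<Rightarrow> (('v, 'e) path \<Rightarrow> 'k) set" where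
  "path_class p = of_coord (single 1 p)"

lemma path_class:
  assumes "p \<in> nz_paths"
  shows "path_class p \<in> carrier AA" "coord (path_class p) q = (if q = p then 1 else 0)"
proof -
  have "finite {q. single (1::'k) p q \<noteq> 0}" by (simp add: single_def)
  moreover have "single (1::'k) p q \<noteq> 0 \<Longrightarrow> q \<in> nz_paths" for q
    using assms by (cases "q = p") (auto simp: single_def)
  ultimately have "path_class p \<in> carrier AA \<and> coord (path_class p) = single 1 p"
    unfolding path_class_def using of_coord[of "single 1 p"] by blast
  then show "path_class p \<in> carrier AA" "coord (path_class p) q = (if q = p then 1 else 0)"
    by (simp_all add: single_def)
qed

lemma supported_mono: "S \<subseteq> T \<Longrightarrow> supported S \<subseteq> supported T"
  by (auto simp: supported_def)

lemma supported_subalgebra: "subalgebra KK (supported T) AA"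
proof (intro subalgebra.intro AA.add.subgroupI)
  have "\<zero>\<^bsub>AA\<^esub> \<in> supported T" by (simp add: supported_def coord_zero)
  then show "supported T \<noteq> {}" by blast
  fix X Y assume XY: "X \<in> supported T" "Y \<in> supported T"
  show "\<ominus>\<^bsub>AA\<^esub> X \<in> supported T" using XY by (auto simp: supported_def coord_uminus)
  show "X \<oplus>\<^bsub>AA\<^esub> Y \<in> supported T" using XY by (simp add: supported_def coord_add) (metis add.right_neutral)
next
  show "subalgebra_axioms KK (supported T) AA"
    by unfold_locales (auto simp: supported_def scalars_eq scal coord_scal_l)
qed (auto simp: supported_def)

text \<open>Matches the inductive definition of \<open>dimension\<close>, which adjoins one vector
  at a time.\<close>

lemma supported_insert:
  assumes t: "t \<in> nz_paths" "t \<notin> T"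
  shows "supported (insert t T) = AA.line_extension KK (path_class t) (supported T)"
proof (intro subset_antisym subsetI)
  fix X assume X: "X \<in> supported (insert t T)"
  then have Xc: "X \<in> carrier AA" by (simp add: supported_def)
  let ?Y = "truncate (\<lambda>p. p \<noteq> t) X"
  note Y = truncate[OF Xc, of "\<lambda>p. p \<noteq> t"]
  have "X = scal (coord X t) \<otimes>\<^bsub>AA\<^esub> path_class t \<oplus>\<^bsub>AA\<^esub> ?Y"
    by (rule coord_inj) (use Xc Y path_class[OF t(1)] in \<open>auto simp: scal coord_add coord_scal_l\<close>)
  moreover have "?Y \<in> supported T" using X Y by (auto simp: supported_def split: if_splits)
  ultimately show "X \<in> AA.line_extension KK (path_class t) (supported T)"
    unfolding AA.line_extension_mem_iff scalars_eq by blast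
next
  fix X assume "X \<in> AA.line_extension KK (path_class t) (supported T)"
  then obtain c Y where X: "X = scal c \<otimes>\<^bsub>AA\<^esub> path_class t \<oplus>\<^bsub>AA\<^esub> Y" "Y \<in> supported T"
    unfolding AA.line_extension_mem_iff scalars_eq by blast
  then have Yc: "Y \<in> carrier AA" by (simp add: supported_def)
  show "X \<in> supported (insert t T)"
    using X Yc path_class[OF t(1)]
    by (auto simp: supported_def scal coord_add coord_scal_l split: if_splits)
qed

lemma supported_empty: "supported {} = {\<zero>\<^bsub>AA\<^esub>}"
proof (intro subset_antisym subsetI)
  fix X assume X: "X \<in> supported {}"
  then have "X = \<zero>\<^bsub>AA\<^esub>" by (intro coord_inj) (auto simp: supported_def coord_zero)
  then show "X \<in> {\<zero>\<^bsub>AA\<^esub>}" by simp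
qed (auto simp: supported_def coord_zero)

lemma supported_dimension:
  assumes "finite T" "T \<subseteq> nz_paths"
  shows "AA.dimension (card T) KK (supported T)"
  using assms
proof (induction T rule: finite_induct)
  case empty
  show ?case unfolding supported_empty by (simp add: AA.zero_dim)
next
  case (insert t T)
  have "path_class t \<notin> supported T"
  proof
    assume "path_class t \<in> supported T"
    moreover have "coord (path_class t) t \<noteq> 0" using insert by (simp add: path_class(2))
    ultimately have "t \<in> T" unfolding supported_def by blast
    then show False using insert by simp
  qed
  then have "AA.dimension (Suc (card T)) KK (AA.line_extension KK (path_class t) (supported T))"
    using insert path_class(1)[of t] by (intro AA.Suc_dim) auto
  then show ?case using insert by (simp add: supported_insert)
qed

text \<open>The source of lower bounds: a finite-dimensional subspace containing the classes of the
  paths in \<open>T\<close> has dimension at least \<open>card T\<close>.\<close>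

lemma supported_minimal:
  assumes "subalgebra KK W AA" "finite T" "T \<subseteq> nz_paths" "path_class ` T \<subseteq> W"
  shows "supported T \<subseteq> W"
  using assms(2-4)
proof (induction T rule: finite_induct)
  case empty
  show ?case unfolding supported_empty
    using assms(1) subgroup.one_closed[OF subalgebra.axioms(1)[OF assms(1)]] by simp
next
  case (insert t T)
  show ?case
  proof
    fix X assume "X \<in> supported (insert t T)"
    then have "X \<in> AA.line_extension KK (path_class t) (supported T)"
      using supported_insert[of t T] insert by auto
    then obtain k Y where X: "k \<in> KK" "Y \<in> supported T" "X = k \<otimes>\<^bsub>AA\<^esub> path_class t \<oplus>\<^bsub>AA\<^esub> Y"
      unfolding AA.line_extension_mem_iff by blast
    have "k \<otimes>\<^bsub>AA\<^esub> path_class t \<in> W" using X insert subalgebra.smult_closed[OF assms(1)] by auto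
    moreover have "Y \<in> W" using X insert by auto
    ultimately show "X \<in> W"
      using X(3) subgroup.m_closed[OF subalgebra.axioms(1)[OF assms(1)]] by simp
  qed
qed

lemma dimension_mono:
  assumes "AA.dimension m KK E" "AA.dimension n KK F" "E \<subseteq> F"
  shows "m \<le> n"
proof -
  obtain Us where "set Us \<subseteq> carrier AA" "AA.independent KK Us" "length Us = m" "AA.Span KK Us = E"
    using AA.exists_base[OF scalars_subfield assms(1)] by blast
  then show ?thesis
    using AA.independent_length_le_dimension[OF scalars_subfield assms(2), of Us]
      AA.Span_base_incl[OF scalars_subfield, of Us] assms(3) by auto
qed

end

section \<open>Logarithmic growth estimates\<close>

lemma log_linear_tendsto:
  assumes "C > 0"
  shows "(\<lambda>n. log (real n) (C * real n)) \<longlonglongrightarrow> 1"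
proof -
  have "(\<lambda>n. ln C / ln (real n) + 1) \<longlonglongrightarrow> 0 + 1"
    by (intro tendsto_add tendsto_const tendsto_divide_0[OF tendsto_const]
        filterlim_at_top_imp_at_infinity filterlim_compose[OF ln_at_top filterlim_real_sequentially])
  moreover have "eventually (\<lambda>n. ln C / ln (real n) + 1 = log (real n) (C * real n)) sequentially"
    using eventually_ge_at_top[of 2]
    by eventually_elim (use assms in \<open>simp add: log_def ln_mult field_simps\<close>)
  ultimately show ?thesis using Lim_transform_eventually by fastforce
qed

lemma log_const_tendsto: "(\<lambda>n. log (real n) C) \<longlonglongrightarrow> 0"
  unfolding log_def
  by (intro tendsto_divide_0[OF tendsto_const] filterlim_at_top_imp_at_infinity
      filterlim_compose[OF ln_at_top filterlim_real_sequentially])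

text \<open>\<open>n \<ge> 2\<close> makes the base of the logarithm exceed 1 and
  \<open>1 \<le> d n\<close> keeps its argument positive, so \<open>log\<close> is monotone.\<close>

lemma limsup_log_le:
  assumes le: "\<And>n. n \<ge> 2 \<Longrightarrow> 1 \<le> d n \<and> real (d n) \<le> c n"
    and lim: "(\<lambda>n. log (real n) (c n)) \<longlonglongrightarrow> l"
  shows "limsup (\<lambda>n. ereal (log (real n) (real (d n)))) \<le> ereal l"
proof -
  have "limsup (\<lambda>n. ereal (log (real n) (real (d n)))) \<le> limsup (\<lambda>n. ereal (log (real n) (c n)))"
  proof (rule Limsup_mono)
    show "eventually (\<lambda>n. ereal (log (real n) (real (d n))) \<le> ereal (log (real n) (c n))) sequentially"
      using eventually_ge_at_top[of 2]
    proof eventually_elim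
      case (elim n)
      then show ?case using le[of n] by simp
    qed
  qed
  also have "\<dots> = ereal l"
    using lim by (intro lim_imp_Limsup) auto
  finally show ?thesis .
qed

lemma le_limsup_log:
  assumes "\<And>n. n \<ge> 2 \<Longrightarrow> real n powr a \<le> real (d n)"
  shows "ereal a \<le> limsup (\<lambda>n. ereal (log (real n) (real (d n))))"
proof (rule le_Limsup)
  show "eventually (\<lambda>n. ereal a \<le> ereal (log (real n) (real (d n)))) sequentially"
    using eventually_ge_at_top[of 2]
  proof eventually_elim
    case (elim n)
    have "real n powr a > 0" using elim by simp
    then have "0 < real (d n)" using assms[OF elim] by (rule order.strict_trans2)
    then have "a \<le> log (real n) (real (d n))"
      using assms[OF elim] elim by (subst le_log_iff) auto
    then show ?case by simp
  qed
qed simp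

section \<open>Growth of the power spaces\<close>

context nonempty_quadratic_algebra
begin

abbreviation nz_paths_le :: "nat \<Rightarrow> ('v, 'e) path set" where
  "nz_paths_le m \<equiv> {p \<in> nz_paths. length (snd p) \<le> m}"

lemma finite_nz_paths_le: "finite (nz_paths_le m)"
proof (rule finite_subset)
  show "nz_paths_le m \<subseteq> verts Q \<times> {xs. set xs \<subseteq> arcs Q \<and> length xs \<le> m}"
    by (auto simp: nz_paths_iff)
  show "finite (verts Q \<times> {xs. set xs \<subseteq> arcs Q \<and> length xs \<le> m})"
    using finite_verts finite_arcs by (intro finite_cartesian_product finite_lists_length_le)
qed

lemma supported_le_finite_dimension: "AA.finite_dimension KK (supported (nz_paths_le m))"
  by (rule AA.finite_dimensionI[OF supported_dimension[OF finite_nz_paths_le]]) auto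

lemma supported_le_mult:
  assumes X: "X \<in> supported (nz_paths_le a)" and Y: "Y \<in> supported (nz_paths_le b)"
  shows "X \<otimes>\<^bsub>AA\<^esub> Y \<in> supported (nz_paths_le (a + b))"
proof -
  have c: "X \<in> carrier AA" "Y \<in> carrier AA" using X Y by (auto simp: supported_def)
  have "p \<in> nz_paths_le (a + b)" if nz: "coord (X \<otimes>\<^bsub>AA\<^esub> Y) p \<noteq> 0" for p
  proof -
    obtain u q where p: "p = (u, q)" by fastforce
    obtain i where i: "i \<le> length q" "coord X (u, take i q) \<noteq> 0" "coord Y (end_vertex Q u (take i q), drop i q) \<noteq> 0"
      using coord_mult_nonzero[OF c] nz p by metis
    then have "length (take i q) \<le> a" "length (drop i q) \<le> b"
      using X Y unfolding supported_def by fastforce+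
    then show ?thesis using i(1) coord_support(2)[OF AA.m_closed[OF c] nz] p by simp
  qed
  then show ?thesis unfolding supported_def using c by blast
qed

lemma one_supported: "\<one>\<^bsub>AA\<^esub> \<in> supported (nz_paths_le m)"
  using coord_support(2)[OF AA.one_closed] by (auto simp: supported_def coord_one split: if_splits)

text \<open>Lengths add under multiplication, so a product of at most \<open>n\<close> elements
  supported in lengths up to \<open>m\<close> is supported in lengths up to
  \<open>m * n\<close>.\<close>

lemma power_space_upper:
  assumes V: "V \<subseteq> supported (nz_paths_le m)"
  shows "power_space KK AA V n \<subseteq> supported (nz_paths_le (m * n))"
proof -
  have prod: "foldr (monoid.mult AA) vs \<one>\<^bsub>AA\<^esub> \<in> supported (nz_paths_le (m * length vs))"
    if "set vs \<subseteq> V" for vs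
    using that
  proof (induction vs)
    case (Cons v vs)
    then have "v \<in> supported (nz_paths_le m)" using V by auto
    then show ?case using supported_le_mult[of v m _ "m * length vs"] Cons by (simp add: add.commute)
  next
    case Nil
    show ?case unfolding foldr.simps id_apply by (rule one_supported)
  qed
  have gens: "{foldr (monoid.mult AA) vs \<one>\<^bsub>AA\<^esub> |vs. set vs \<subseteq> V \<and> length vs \<le> n}
      \<subseteq> supported (nz_paths_le (m * n))"
  proof clarify
    fix vs assume vs: "set vs \<subseteq> V" "length vs \<le> n"
    have "nz_paths_le (m * length vs) \<subseteq> nz_paths_le (m * n)"
      using vs(2) by (auto intro: order_trans)
    then show "foldr (monoid.mult AA) vs \<one>\<^bsub>AA\<^esub> \<in> supported (nz_paths_le (m * n))"
      using prod[OF vs(1)] supported_mono by blast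
  qed
  show ?thesis
    unfolding power_space_def
  proof (rule UN_least)
    fix us assume "us \<in> {us. set us \<subseteq> {foldr (monoid.mult AA) vs \<one>\<^bsub>AA\<^esub> |vs. set vs \<subseteq> V \<and> length vs \<le> n}}"
    then have "set us \<subseteq> supported (nz_paths_le (m * n))" using gens by blast
    then show "AA.Span KK us \<subseteq> supported (nz_paths_le (m * n))"
      by (rule AA.subalgebra_Span_incl[OF scalars_subfield supported_subalgebra])
  qed
qed

text \<open>A union of spans of finite lists, closed under sums because two lists can be
  concatenated.\<close>

lemma power_space_subalgebra:
  assumes V: "V \<subseteq> carrier AA"
  shows "subalgebra KK (power_space KK AA V n) AA"
proof -
  define W where "W = {foldr (monoid.mult AA) vs \<one>\<^bsub>AA\<^esub> |vs. set vs \<subseteq> V \<and> length vs \<le> n}"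
  have fc: "foldr (monoid.mult AA) vs \<one>\<^bsub>AA\<^esub> \<in> carrier AA" if "set vs \<subseteq> carrier AA" for vs
    using that by (induction vs) auto
  have W: "W \<subseteq> carrier AA" unfolding W_def using V fc by blast
  have ps: "power_space KK AA V n = (\<Union>us\<in>{us. set us \<subseteq> W}. AA.Span KK us)"
    by (simp add: power_space_def W_def)
  note sub = AA.Span_subgroup_props[OF scalars_subfield] AA.Span_smult_closed[OF scalars_subfield]
  show ?thesis
    unfolding ps
  proof (intro subalgebra.intro AA.add.subgroupI)
    show "(\<Union>us\<in>{us. set us \<subseteq> W}. AA.Span KK us) \<subseteq> carrier AA"
      using W AA.Span_in_carrier[OF subfieldE(3)[OF scalars_subfield]] by blast
    show "(\<Union>us\<in>{us. set us \<subseteq> W}. AA.Span KK us) \<noteq> {}"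
      by (auto intro!: exI[of _ "[]"])
  next
    fix x assume "x \<in> (\<Union>us\<in>{us. set us \<subseteq> W}. AA.Span KK us)"
    then obtain us where us: "set us \<subseteq> W" "x \<in> AA.Span KK us" by blast
    then have "\<ominus>\<^bsub>AA\<^esub> x \<in> AA.Span KK us" using W by (intro sub(4)) auto
    then show "\<ominus>\<^bsub>AA\<^esub> x \<in> (\<Union>us\<in>{us. set us \<subseteq> W}. AA.Span KK us)"
      using us(1) by blast
  next
    fix x y assume "x \<in> (\<Union>us\<in>{us. set us \<subseteq> W}. AA.Span KK us)" "y \<in> (\<Union>us\<in>{us. set us \<subseteq> W}. AA.Span KK us)"
    then obtain us vs where *: "set us \<subseteq> W" "x \<in> AA.Span KK us" "set vs \<subseteq> W" "y \<in> AA.Span KK vs" by blast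
    have c: "set (us @ vs) \<subseteq> carrier AA" using * W by auto
    have base: "set (us @ vs) \<subseteq> AA.Span KK (us @ vs)" by (rule AA.Span_base_incl[OF scalars_subfield c])
    have "AA.Span KK us \<subseteq> AA.Span KK (us @ vs)" "AA.Span KK vs \<subseteq> AA.Span KK (us @ vs)"
      by (rule AA.mono_Span_subset[OF scalars_subfield _ c]; use base in \<open>simp del: AA.Span.simps\<close>)+
    then have "x \<oplus>\<^bsub>AA\<^esub> y \<in> AA.Span KK (us @ vs)"
      using *(2,4) by (intro sub(3)[OF c]) blast+
    then show "x \<oplus>\<^bsub>AA\<^esub> y \<in> (\<Union>us\<in>{us. set us \<subseteq> W}. AA.Span KK us)"
      using * by (intro UN_I[of "us @ vs"]) auto
  next
    have "k \<otimes>\<^bsub>AA\<^esub> v \<in> AA.Span KK us" if "k \<in> KK" "v \<in> AA.Span KK us" "set us \<subseteq> W" for k v us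
      by (rule sub(5)[OF subset_trans[OF that(3) W] that(1,2)])
    then show "subalgebra_axioms KK (\<Union>us\<in>{us. set us \<subseteq> W}. AA.Span KK us) AA"
      unfolding subalgebra_axioms_def by blast
  qed
qed

lemma power_space_contains:
  assumes "set vs \<subseteq> V" "length vs \<le> n" "V \<subseteq> carrier AA"
  shows "foldr (monoid.mult AA) vs \<one>\<^bsub>AA\<^esub> \<in> power_space KK AA V n"
proof -
  let ?x = "foldr (monoid.mult AA) vs \<one>\<^bsub>AA\<^esub>"
  have "set vs \<subseteq> carrier AA" using assms by auto
  then have "?x \<in> carrier AA" by (induction vs) auto
  then have "?x \<in> AA.Span KK [?x]"
    using AA.Span_base_incl[OF scalars_subfield, of "[?x]"] by simp
  then show ?thesis unfolding power_space_def using assms by (intro UN_I[of "[?x]"]) auto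
qed

text \<open>A finite spanning list involves only finitely many paths altogether, so their lengths
  are bounded.\<close>

lemma finite_dimension_supported:
  assumes "AA.finite_dimension KK V"
  obtains m where "V \<subseteq> supported (nz_paths_le m)"
proof -
  obtain d where "AA.dimension d KK V" using assms by (auto elim: AA.finite_dimensionE')
  then obtain Us where Us: "set Us \<subseteq> carrier AA" "AA.Span KK Us = V"
    using AA.exists_base[OF scalars_subfield] by blast
  have "\<exists>m. set Us \<subseteq> supported (nz_paths_le m)"
    using Us(1)
  proof (induction Us)
    case (Cons X Us)
    then obtain m where m: "set Us \<subseteq> supported (nz_paths_le m)" by auto
    let ?L = "(\<lambda>p. length (snd p)) ` {p. coord X p \<noteq> 0}"
    have Xc: "X \<in> carrier AA" using Cons by simp
    have L: "finite ?L" using coord_support(1)[OF Xc] by simp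
    let ?m = "max m (Max (insert 0 ?L))"
    have "X \<in> supported (nz_paths_le ?m)"
      unfolding supported_def
    proof (intro CollectI conjI allI impI Xc)
      fix p assume p: "coord X p \<noteq> 0"
      then have "length (snd p) \<le> Max (insert 0 ?L)" using L by (intro Max_ge) auto
      then show "p \<in> nz_paths" "length (snd p) \<le> ?m" using coord_support(2)[OF Xc p] by auto
    qed
    moreover have "set Us \<subseteq> supported (nz_paths_le ?m)"
      using m supported_mono[of "nz_paths_le m" "nz_paths_le ?m"] by fastforce
    ultimately show ?case by auto
  qed simp
  then obtain m where "set Us \<subseteq> supported (nz_paths_le m)" by blast
  then have "V \<subseteq> supported (nz_paths_le m)"
    using AA.subalgebra_Span_incl[OF scalars_subfield supported_subalgebra] Us(2) by blast
  then show ?thesis by (rule that)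
qed

text \<open>The first claim says that \<open>dim\<close> is meaningful here. The lower bound 1 comes
  from the empty product \<open>\<one>\<close> and keeps the argument of the logarithm in
  \<open>GKdim\<close> positive.\<close>

lemma power_space_dim:
  assumes V: "V \<subseteq> supported (nz_paths_le m)"
  shows "AA.dimension (ring.dim AA KK (power_space KK AA V n)) KK (power_space KK AA V n)"
    "1 \<le> ring.dim AA KK (power_space KK AA V n)"
    "ring.dim AA KK (power_space KK AA V n) \<le> card (nz_paths_le (m * n))"
proof -
  have Vc: "V \<subseteq> carrier AA" using V by (auto simp: supported_def)
  let ?P = "power_space KK AA V n"
  have fd: "AA.finite_dimension KK ?P"
    by (rule AA.subalbegra_incl_imp_finite_dimension[OF scalars_subfield supported_le_finite_dimension
          power_space_subalgebra[OF Vc] power_space_upper[OF V]])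
  then show d: "AA.dimension (ring.dim AA KK ?P) KK ?P"
    using AA.finite_dimensionE[OF scalars_subfield] by (simp add: over_def)
  show "ring.dim AA KK ?P \<le> card (nz_paths_le (m * n))"
    by (rule dimension_mono[OF d supported_dimension[OF finite_nz_paths_le] power_space_upper[OF V]]) auto
  have "\<one>\<^bsub>AA\<^esub> \<in> ?P" using power_space_contains[of "[]" V n] Vc by simp
  show "1 \<le> ring.dim AA KK ?P"
  proof (rule ccontr)
    assume "\<not> 1 \<le> ring.dim AA KK ?P"
    then have "?P = {\<zero>\<^bsub>AA\<^esub>}" using AA.dimension_zero[OF scalars_subfield] d by (simp add: not_le)
    then show False using \<open>\<one>\<^bsub>AA\<^esub> \<in> ?P\<close> one_not_zero by simp
  qed
qed

lemma GKdim_finite: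
  assumes "finite nz_paths"
  shows "GKdim KK AA = 0"
proof (rule antisym)
  show "GKdim KK AA \<le> 0"
    unfolding GKdim_def
  proof (rule SUP_least)
    fix V assume "V \<in> {V. AA.finite_dimension KK V}"
    then obtain m where m: "V \<subseteq> supported (nz_paths_le m)" using finite_dimension_supported by blast
    have "ring.dim AA KK (power_space KK AA V n) \<le> card nz_paths" for n
      using power_space_dim(3)[OF m, of n] card_mono[OF assms, of "nz_paths_le (m * n)"] by auto
    then show "limsup (\<lambda>n. ereal (log (real n) (real (ring.dim AA KK (power_space KK AA V n))))) \<le> 0"
      using limsup_log_le[OF _ log_const_tendsto, of "\<lambda>n. ring.dim AA KK (power_space KK AA V n)" "real (card nz_paths)"]
        power_space_dim(2)[OF m] by (simp add: zero_ereal_def)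
  qed
  \<comment> \<open>The zero space suffices for the lower bound, since its power spaces still
    contain \<open>\<one>\<close>.\<close>
  have Z: "{\<zero>\<^bsub>AA\<^esub>} \<in> {V. AA.finite_dimension KK V}"
    using AA.finite_dimensionI[OF AA.zero_dim] by simp
  have m: "{\<zero>\<^bsub>AA\<^esub>} \<subseteq> supported (nz_paths_le 0)" by (auto simp: supported_def coord_zero)
  have "0 \<le> limsup (\<lambda>n. ereal (log (real n) (real (ring.dim AA KK (power_space KK AA {\<zero>\<^bsub>AA\<^esub>} n)))))"
    using le_limsup_log[of 0 "\<lambda>n. ring.dim AA KK (power_space KK AA {\<zero>\<^bsub>AA\<^esub>} n)"] power_space_dim(2)[OF m]
    by (simp add: zero_ereal_def)
  also have "\<dots> \<le> GKdim KK AA" unfolding GKdim_def by (rule SUP_upper[OF Z])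
  finally show "0 \<le> GKdim KK AA" .
qed

text \<open>Only the cut after \<open>p\<close> contributes to the product.\<close>

lemma path_class_mult:
  assumes "(u, p @ q) \<in> nz_paths"
  shows "path_class (u, p) \<otimes>\<^bsub>AA\<^esub> path_class (end_vertex Q u p, q) = path_class (u, p @ q)"
proof -
  have pq: "(u, p) \<in> nz_paths" "(end_vertex Q u p, q) \<in> nz_paths"
    using assms nz_paths_append_iff by auto
  note c = path_class(1)[OF pq(1)] path_class(1)[OF pq(2)]
  show ?thesis
  proof (rule coord_inj)
    fix w assume w: "w \<in> nz_paths"
    obtain x r where xr: "w = (x, r)" by fastforce
    have "coord (path_class (u, p) \<otimes>\<^bsub>AA\<^esub> path_class (end_vertex Q u p, q)) (x, r) =
      (\<Sum>i\<le>length r. if i = length p then (if (x, r) = (u, p @ q) then 1 else 0) else 0)"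
      unfolding coord_mult[OF c w[unfolded xr]]
    proof (rule sum.cong[OF refl])
      fix i assume i: "i \<in> {..length r}"
      show "coord (path_class (u, p)) (x, take i r) *
          coord (path_class (end_vertex Q u p, q)) (end_vertex Q x (take i r), drop i r) =
        (if i = length p then (if (x, r) = (u, p @ q) then 1 else 0) else 0)"
      proof (cases "x = u \<and> take i r = p")
        case True
        then have "i = length p" using i by auto
        moreover have "(x, r) = (u, p @ q) \<longleftrightarrow> drop i r = q"
          using True \<open>i = length p\<close> by (metis append_eq_conv_conj prod.inject)
        ultimately show ?thesis using True by (simp add: path_class(2)[OF pq(1)] path_class(2)[OF pq(2)])
      next
        case False
        then have "coord (path_class (u, p)) (x, take i r) = 0"
          by (auto simp: path_class(2)[OF pq(1)])
        moreover have "\<not> (i = length p \<and> (x, r) = (u, p @ q))" using False by auto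
        ultimately show ?thesis by (simp only: mult_zero_left) auto
      qed
    qed
    also have "\<dots> = (if (x, r) = (u, p @ q) then 1 else 0)" by auto
    finally show "coord (path_class (u, p) \<otimes>\<^bsub>AA\<^esub> path_class (end_vertex Q u p, q)) w = coord (path_class (u, p @ q)) w"
      using xr by (simp add: path_class(2)[OF assms])
  qed (use c path_class(1)[OF assms] in auto)
qed

text \<open>A nontrivial path is the product of its arrows. A trivial path is a single factor, which
  is where \<open>1 \<le> n\<close> enters.\<close>

lemma path_class_in_power_space:
  assumes "(u, p) \<in> nz_paths" "length p \<le> n" "1 \<le> n"
  shows "path_class (u, p) \<in> power_space KK AA (supported (nz_paths_le 1)) n"
proof -
  have V: "supported (nz_paths_le 1) \<subseteq> carrier AA" by (auto simp: supported_def)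
  have small: "path_class w \<in> supported (nz_paths_le 1)" if "w \<in> nz_paths" "length (snd w) \<le> 1" for w
    using path_class[OF that(1)] that by (auto simp: supported_def split: if_splits)
  have "p \<noteq> [] \<Longrightarrow> (u, p) \<in> nz_paths \<Longrightarrow>
    \<exists>vs. set vs \<subseteq> supported (nz_paths_le 1) \<and> length vs = length p \<and>
      foldr (monoid.mult AA) vs \<one>\<^bsub>AA\<^esub> = path_class (u, p)" for u p
  proof (induction p arbitrary: u)
    case (Cons a p)
    have a: "(u, [a]) \<in> nz_paths" and p: "(head Q a, p) \<in> nz_paths"
      using Cons.prems nz_paths_append_iff[of u "[a]" p] by (auto simp: end_vertex_eq)
    note ac = path_class(1)[OF a]
    show ?case
    proof (cases "p = []")
      case True
      then show ?thesis
        using small[OF a] ac by (intro exI[of _ "[path_class (u, [a])]"]) simp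
    next
      case False
      then obtain vs where vs: "set vs \<subseteq> supported (nz_paths_le 1)" "length vs = length p"
        "foldr (monoid.mult AA) vs \<one>\<^bsub>AA\<^esub> = path_class (head Q a, p)"
        using Cons.IH[of "head Q a"] p by blast
      have "path_class (u, [a]) \<otimes>\<^bsub>AA\<^esub> path_class (head Q a, p) = path_class (u, a # p)"
        using path_class_mult[of u "[a]" p] Cons.prems by (simp add: end_vertex_eq)
      then show ?thesis
        using vs small[OF a] by (intro exI[of _ "path_class (u, [a]) # vs"]) simp
    qed
  qed simp
  then have "\<exists>vs. set vs \<subseteq> supported (nz_paths_le 1) \<and> length vs \<le> n \<and>
      foldr (monoid.mult AA) vs \<one>\<^bsub>AA\<^esub> = path_class (u, p)"
  proof (cases "p = []")
    case True
    then show ?thesis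
      using small[OF assms(1)] path_class(1)[OF assms(1)] assms(3)
      by (intro exI[of _ "[path_class (u, p)]"]) simp
  qed (use assms in fastforce)
  then obtain vs where vs: "set vs \<subseteq> supported (nz_paths_le 1)" "length vs \<le> n"
    "foldr (monoid.mult AA) vs \<one>\<^bsub>AA\<^esub> = path_class (u, p)" by blast
  show ?thesis using power_space_contains[OF vs(1,2) V] unfolding vs(3) .
qed

end

section \<open>Paths in gentle quivers\<close>

text \<open>The form in which gentleness is used: of two arrows that continue, or precede, a given
  one, exactly one gives a nonzero product. So \<open>step\<close> is a partial injection on the
  arrows.\<close>

locale gentle_quiver = nonempty_quadratic_algebra Q R I
  for Q :: "('v, 'e) pre_digraph" and R and I :: "(('v, 'e) path \<Rightarrow> 'k::field) set" +
  assumes step_det: "step a b \<Longrightarrow> step a b' \<Longrightarrow> b = b'"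
    and step_inj: "step b a \<Longrightarrow> step b' a \<Longrightarrow> b = b'"
begin

text \<open>The first arrow determines all later ones. A nontrivial nonzero path is thus encoded by
  its first arrow and its length, which makes growth at most linear.\<close>

lemma successively_step_eq:
  assumes "successively step p" "successively step q" "length p = length q" "p \<noteq> []" "hd p = hd q"
  shows "p = q"
  using assms(3,1,2,4,5)
proof (induction p q rule: list_induct2)
  case (Cons a p b q)
  show ?case
  proof (cases "p = []")
    case False
    then have q: "q \<noteq> []" using Cons.hyps by auto
    have "step a (hd p)" "successively step p" "step b (hd q)" "successively step q"
      using Cons.prems False q by (auto simp: successively_Cons)
    then have "hd p = hd q" using step_det Cons.prems by auto
    then show ?thesis using Cons False \<open>successively step p\<close> \<open>successively step q\<close> by auto
  qed (use Cons in auto)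
qed simp

text \<open>Trivial paths are counted by vertices, the others by pairs of a first arrow and a
  length.\<close>

lemma card_nz_paths_le: "card (nz_paths_le m) \<le> card (verts Q) + card (arcs Q) * m"
proof -
  have "nz_paths_le m \<subseteq> (\<lambda>u. (u, [])) ` verts Q \<union> {p \<in> nz_paths. snd p \<noteq> [] \<and> length (snd p) \<le> m}"
    by (auto simp: nz_paths_iff image_iff)
  moreover have fin: "finite {p \<in> nz_paths. snd p \<noteq> [] \<and> length (snd p) \<le> m}"
    by (rule finite_subset[OF _ finite_nz_paths_le[of m]]) auto
  ultimately have "card (nz_paths_le m) \<le>
      card ((\<lambda>u. (u, [] :: 'e list)) ` verts Q \<union> {p \<in> nz_paths. snd p \<noteq> [] \<and> length (snd p) \<le> m})"
    using finite_verts by (intro card_mono) auto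
  also have "\<dots> \<le> card (verts Q) + card {p \<in> nz_paths. snd p \<noteq> [] \<and> length (snd p) \<le> m}"
    by (rule order_trans[OF card_Un_le]) (use card_image_le[OF finite_verts] in simp)
  also have "card {p \<in> nz_paths. snd p \<noteq> [] \<and> length (snd p) \<le> m} \<le> card (arcs Q \<times> {1..m})"
  proof (rule card_inj_on_le)
    show "inj_on (\<lambda>p. (hd (snd p), length (snd p))) {p \<in> nz_paths. snd p \<noteq> [] \<and> length (snd p) \<le> m}"
      by (rule inj_onI) (auto simp: nz_paths_iff intro: successively_step_eq)
    show "(\<lambda>p. (hd (snd p), length (snd p))) ` {p \<in> nz_paths. snd p \<noteq> [] \<and> length (snd p) \<le> m} \<subseteq> arcs Q \<times> {1..m}"
      by (auto simp: nz_paths_iff Suc_le_eq intro: subsetD[OF _ hd_in_set])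
  qed (use finite_arcs in auto)
  also have "card (arcs Q \<times> {1..m}) = card (arcs Q) * m" by simp
  finally show ?thesis by simp
qed

text \<open>Only finitely many paths have bounded length, so an infinite supply contains arbitrarily
  long ones, and their prefixes realise every length.\<close>

lemma nz_path_of_length:
  assumes "infinite nz_paths"
  obtains u p where "(u, p) \<in> nz_paths" "length p = n"
proof -
  have "\<not> nz_paths \<subseteq> nz_paths_le n" using assms finite_nz_paths_le[of n] finite_subset by blast
  then obtain u p where "(u, p) \<in> nz_paths" "length p > n" by fastforce
  then show ?thesis using that[of u "take n p"] nz_paths_take[of u p n] by simp
qed

lemma GKdim_infinite:
  assumes inf: "infinite nz_paths"
  shows "GKdim KK AA = 1"
proof (rule antisym)
  show "GKdim KK AA \<le> 1"
    unfolding GKdim_def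
  proof (rule SUP_least)
    fix V assume "V \<in> {V. AA.finite_dimension KK V}"
    then obtain m where m: "V \<subseteq> supported (nz_paths_le m)" using finite_dimension_supported by blast
    let ?d = "\<lambda>n. ring.dim AA KK (power_space KK AA V n)"
    \<comment> \<open>For \<open>n \<ge> 2\<close> the constant term \<open>card (verts Q)\<close>
      of the path count is absorbed into the linear one; \<open>m\<close> bounds the lengths
      occurring in \<open>V\<close>.\<close>
    define C where "C = card (verts Q) + card (arcs Q) * m"
    have "card (verts Q) > 0" using verts_nonempty finite_verts by (simp add: card_gt_0_iff)
    then have C: "real C > 0" by (simp add: C_def add_pos_nonneg)
    have "1 \<le> ?d n \<and> real (?d n) \<le> real C * real n" if "n \<ge> 2" for n
    proof -
      have "?d n \<le> card (verts Q) + card (arcs Q) * (m * n)"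
        using power_space_dim(3)[OF m, of n] card_nz_paths_le[of "m * n"] by linarith
      also have "\<dots> \<le> card (verts Q) * n + card (arcs Q) * m * n" using that by simp
      also have "\<dots> = C * n" by (simp add: C_def algebra_simps)
      finally have "real (?d n) \<le> real (C * n)" by (rule of_nat_mono)
      then show ?thesis using power_space_dim(2)[OF m, of n] by simp
    qed
    then show "limsup (\<lambda>n. ereal (log (real n) (real (?d n)))) \<le> 1"
      using limsup_log_le[OF _ log_linear_tendsto[OF C], of ?d] by (simp add: one_ereal_def)
  qed
  let ?V = "supported (nz_paths_le 1)"
  let ?d = "\<lambda>n. ring.dim AA KK (power_space KK AA ?V n)"
  have V: "?V \<in> {V. AA.finite_dimension KK V}" using supported_le_finite_dimension by simp
  have sub: "subalgebra KK (power_space KK AA ?V n) AA" for n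
    by (rule power_space_subalgebra) (auto simp: supported_def)
  have "real n powr 1 \<le> real (?d n)" if n: "n \<ge> 2" for n
  proof -
    have "supported (nz_paths_le n) \<subseteq> power_space KK AA ?V n"
    proof (rule supported_minimal[OF sub finite_nz_paths_le])
      show "path_class ` nz_paths_le n \<subseteq> power_space KK AA ?V n"
        using path_class_in_power_space[of _ _ n] n by auto
    qed auto
    then have "card (nz_paths_le n) \<le> ?d n"
      by (intro dimension_mono[OF supported_dimension[OF finite_nz_paths_le] power_space_dim(1)[OF subset_refl]]) auto
    \<comment> \<open>One nonzero path of each length up to \<open>n\<close> already gives
      \<open>n + 1\<close> of them.\<close>
    moreover have "{..n} \<subseteq> (\<lambda>p. length (snd p)) ` nz_paths_le n"
    proof
      fix k assume "k \<in> {..n}"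
      moreover obtain u p where "(u, p) \<in> nz_paths" "length p = k" using nz_path_of_length[OF inf] by blast
      ultimately show "k \<in> (\<lambda>p. length (snd p)) ` nz_paths_le n" by (intro image_eqI[of _ _ "(u, p)"]) auto
    qed
    then have "card {..n} \<le> card (nz_paths_le n)" by (rule surj_card_le[OF finite_nz_paths_le])
    ultimately show ?thesis using n by simp
  qed
  then have "ereal 1 \<le> limsup (\<lambda>n. ereal (log (real n) (real (?d n))))" by (rule le_limsup_log)
  also have "\<dots> \<le> GKdim KK AA" unfolding GKdim_def by (rule SUP_upper[OF V])
  finally show "1 \<le> GKdim KK AA" by (simp add: one_ereal_def)
qed

subsection \<open>Maximal paths\<close>

lemma path_element_arrow_mult:
  "path_element (u, p) \<otimes>\<^bsub>PA\<^esub> path_element (arrow_path Q [a]) =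
     (if end_vertex Q u p = tail Q a then path_element (u, p @ [a]) else \<zero>\<^bsub>PA\<^esub>)"
  "path_element (arrow_path Q [a]) \<otimes>\<^bsub>PA\<^esub> path_element (u, p) =
     (if head Q a = u then path_element (tail Q a, a # p) else \<zero>\<^bsub>PA\<^esub>)"
  by (simp_all add: path_element_single arrow_path_def single_mult end_vertex_eq path_algebra_simps)

text \<open>An arrow that does not fit at an end gives the product zero, which lies in
  \<open>I\<close>, so only fitting arrows impose a condition.\<close>

lemma finite_maximal_path_iff:
  "(u, p) \<in> finite_maximal_paths Q I \<longleftrightarrow> (u, p) \<in> nz_paths \<and>
     (\<forall>a\<in>arcs Q. (end_vertex Q u p = tail Q a \<longrightarrow> (u, p @ [a]) \<notin> nz_paths) \<and>
                 (head Q a = u \<longrightarrow> (tail Q a, a # p) \<notin> nz_paths))"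
proof (cases "(u, p) \<in> paths Q")
  case True
  have 1: "path_element (u, p) \<otimes>\<^bsub>PA\<^esub> path_element (arrow_path Q [a]) \<in> I \<longleftrightarrow>
    (end_vertex Q u p = tail Q a \<longrightarrow> (u, p @ [a]) \<notin> nz_paths)" if a: "a \<in> arcs Q" for a
  proof (cases "end_vertex Q u p = tail Q a")
    case e: True
    have "(u, p @ [a]) \<in> paths Q"
      unfolding paths_append_iff using True a e by (simp add: paths_iff)
    then show ?thesis unfolding path_element_arrow_mult using e by (simp add: path_element_in_ideal_iff)
  next
    case False
    then show ?thesis unfolding path_element_arrow_mult using I.zero_closed by (simp only: if_False simp_thms)
  qed
  have 2: "path_element (arrow_path Q [a]) \<otimes>\<^bsub>PA\<^esub> path_element (u, p) \<in> I \<longleftrightarrow>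
    (head Q a = u \<longrightarrow> (tail Q a, a # p) \<notin> nz_paths)" if a: "a \<in> arcs Q" for a
  proof (cases "head Q a = u")
    case e: True
    have "(tail Q a, [a] @ p) \<in> paths Q"
      unfolding paths_append_iff using True a e by (simp add: paths_iff end_vertex_eq)
    then show ?thesis unfolding path_element_arrow_mult using e by (simp add: path_element_in_ideal_iff)
  next
    case False
    then show ?thesis unfolding path_element_arrow_mult using I.zero_closed by (simp only: if_False simp_thms)
  qed
  show ?thesis
    unfolding finite_maximal_paths_def using True 1 2 path_element_in_ideal_iff[OF True] by blast
next
  case False
  then show ?thesis using nz_paths_subset by (auto simp: finite_maximal_paths_def)
qed

text \<open>A nonzero coordinate of the product would sit at a nonzero path that properly prolongs
  \<open>p\<close> on the right.\<close>

lemma finite_maximal_annihilates: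
  assumes p: "(u, p) \<in> finite_maximal_paths Q I" and X: "X \<in> positive_part AA"
  shows "path_class (u, p) \<otimes>\<^bsub>AA\<^esub> X = \<zero>\<^bsub>AA\<^esub>"
proof (rule coord_inj)
  have nz: "(u, p) \<in> nz_paths" using p finite_maximal_path_iff by blast
  note c = path_class(1)[OF nz]
  have Xc: "X \<in> carrier AA" and X0: "\<And>v. coord X (v, []) = 0" using X by (auto simp: positive_part_coord)
  show "path_class (u, p) \<otimes>\<^bsub>AA\<^esub> X \<in> carrier AA" using c Xc by simp
  fix w assume w: "w \<in> nz_paths"
  obtain x r where xr: "w = (x, r)" by fastforce
  show "coord (path_class (u, p) \<otimes>\<^bsub>AA\<^esub> X) w = coord \<zero>\<^bsub>AA\<^esub> w"
  proof (rule ccontr)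
    assume "coord (path_class (u, p) \<otimes>\<^bsub>AA\<^esub> X) w \<noteq> coord \<zero>\<^bsub>AA\<^esub> w"
    then have "coord (path_class (u, p) \<otimes>\<^bsub>AA\<^esub> X) (x, r) \<noteq> 0" by (simp add: coord_zero xr)
    then obtain i where i: "i \<le> length r" "coord (path_class (u, p)) (x, take i r) \<noteq> 0"
      "coord X (end_vertex Q x (take i r), drop i r) \<noteq> 0"
      using coord_mult_nonzero[OF c Xc] by metis
    then have t: "x = u" "take i r = p" by (auto simp: path_class(2)[OF nz] split: if_splits)
    have "drop i r \<noteq> []" using i(3) X0 by metis
    then obtain a r' where a: "drop i r = a # r'" by (cases "drop i r") auto
    then have r: "r = p @ a # r'" using t by (metis append_take_drop_id)
    have "(u, (p @ [a]) @ r') \<in> nz_paths" using w xr t r by simp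
    then have "(u, p @ [a]) \<in> nz_paths" unfolding nz_paths_append_iff by blast
    moreover from this have "a \<in> arcs Q" "end_vertex Q u p = tail Q a"
      using nz_paths_append_iff[of u p "[a]"] by (auto simp: nz_paths_iff)
    ultimately show False using p finite_maximal_path_iff by blast
  qed
qed simp

lemma depth_finite_maximal:
  assumes "finite_maximal_paths Q I \<noteq> {}"
  shows "depth AA = 0"
proof -
  obtain u p where p: "(u, p) \<in> finite_maximal_paths Q I" using assms by auto
  have nz: "(u, p) \<in> nz_paths" using p finite_maximal_path_iff by blast
  show ?thesis
  proof (rule gr.depth_zero)
    show "path_class (u, p) \<in> rgrade AA (int (length p))"
      using path_class[OF nz] by (auto simp: rgrade_iff split: if_splits)
    show "path_class (u, p) \<noteq> \<zero>\<^bsub>AA\<^esub>"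
      using path_class(2)[OF nz, of "(u, p)"] coord_zero[of "(u, p)"] by auto
  qed (rule finite_maximal_annihilates[OF p])
qed

text \<open>A longest nonzero path cannot be prolonged on either side.\<close>

lemma finite_maximal_exists:
  assumes "finite nz_paths"
  shows "finite_maximal_paths Q I \<noteq> {}"
proof -
  obtain v where v: "v \<in> verts Q" using verts_nonempty by blast
  then have ne: "nz_paths \<noteq> {}" using nz_paths_iff[of v "[]"] by auto
  define M where "M = Max ((\<lambda>p. length (snd p)) ` nz_paths)"
  have "M \<in> (\<lambda>p. length (snd p)) ` nz_paths" unfolding M_def using assms ne by (intro Max_in) auto
  then obtain u p where p: "(u, p) \<in> nz_paths" "length p = M" by auto
  have le: "length q \<le> M" if "(x, q) \<in> nz_paths" for x q
    unfolding M_def using assms that by (intro Max_ge) force+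
  have "(u, p) \<in> finite_maximal_paths Q I"
    unfolding finite_maximal_path_iff using p le[of u "p @ [a]" for a] le[of "tail Q a" "a # p" for a] by auto
  then show ?thesis by blast
qed

lemma cycle_iff: "c \<in> cycles Q \<longleftrightarrow> c \<noteq> [] \<and> (tail Q (hd c), c) \<in> paths Q \<and> head Q (last c) = tail Q (hd c)"
proof -
  have "awalk u c v \<longleftrightarrow> (u, c) \<in> paths Q \<and> end_vertex Q u c = v" for u v
  proof
    assume "awalk u c v"
    then have "end_vertex Q u c = v" by (rule awlast_of_awalk) (simp add: NOMATCH_def)
    then show "(u, c) \<in> paths Q \<and> end_vertex Q u c = v"
      using \<open>awalk u c v\<close> unfolding paths_def by blast
  next
    assume *: "(u, c) \<in> paths Q \<and> end_vertex Q u c = v"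
    then obtain w where w: "awalk u c w" unfolding paths_def by blast
    then have "end_vertex Q u c = w" by (rule awlast_of_awalk) (simp add: NOMATCH_def)
    then show "awalk u c v" using w * by simp
  qed
  then show ?thesis by (auto simp: cycles_def end_vertex_eq)
qed

lemma infinite_maximal_cycle:
  "c \<in> primitive_cycles Q \<and> path_element (arrow_path Q (c @ c)) \<notin> I \<longleftrightarrow>
   c \<in> primitive_cycles Q \<and> (tail Q (hd c), c @ c) \<in> nz_paths"
proof -
  have "(tail Q (hd c), c @ c) \<in> paths Q" "c \<noteq> []" if "c \<in> primitive_cycles Q"
    using that unfolding primitive_cycles_def paths_append_iff by (auto simp: cycle_iff end_vertex_eq)
  then show ?thesis using path_element_in_ideal_iff by (auto simp: arrow_path_def)
qed

text \<open>That the square of \<open>c\<close> is nonzero says that the junction from its last to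
  its first arrow is allowed; relations having length 2, all powers of \<open>c\<close> are then
  nonzero.\<close>

lemma infinite_maximal_imp_infinite:
  assumes "infinite_maximal_paths Q I \<noteq> {}"
  shows "infinite nz_paths"
proof -
  obtain c where c: "c \<in> cycles Q" "(tail Q (hd c), c @ c) \<in> nz_paths"
    using assms infinite_maximal_cycle unfolding infinite_maximal_paths_def primitive_cycles_def by blast
  let ?u = "tail Q (hd c)"
  have ne: "c \<noteq> []" and e: "end_vertex Q ?u c = ?u" using c(1) by (auto simp: cycle_iff end_vertex_eq)
  have s: "(?u, c) \<in> nz_paths" "step (last c) (hd c)"
    using c(2) ne unfolding nz_paths_append_iff by auto
  have pow: "(?u, concat (replicate n c)) \<in> nz_paths" for n
  proof (induction n)
    case 0 then show ?case using s(1) by (simp add: nz_paths_iff)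
  next
    case (Suc n)
    have "hd (concat (replicate n c)) = hd c" if "concat (replicate n c) \<noteq> []"
      using that ne by (cases n) auto
    then show ?case using Suc s e by (simp add: nz_paths_append_iff)
  qed
  have "inj (\<lambda>n. (?u, concat (replicate n c)))"
  proof (rule injI)
    fix m n assume "(?u, concat (replicate m c)) = (?u, concat (replicate n c))"
    then have "length (concat (replicate m c)) = length (concat (replicate n c))" by simp
    then show "m = n" using ne by (simp add: length_concat sum_list_replicate)
  qed
  moreover have "range (\<lambda>n. (?u, concat (replicate n c))) \<subseteq> nz_paths" using pow by blast
  ultimately show ?thesis using infinite_iff_countable_subset by blast
qed

lemma infinite_maximal_exists:
  assumes "infinite nz_paths"
  shows "infinite_maximal_paths Q I \<noteq> {}"
proof -
  define C where "C c \<longleftrightarrow> c \<in> cycles Q \<and> (tail Q (hd c), c @ c) \<in> nz_paths" for c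
  \<comment> \<open>One arrow more than the quiver has, which forces a repetition.\<close>
  obtain u p where p: "(u, p) \<in> nz_paths" "length p = Suc (card (arcs Q))"
    using nz_path_of_length[OF assms] by blast
  have "\<not> distinct p"
  proof
    assume "distinct p"
    then have "length p = card (set p)" by (simp add: distinct_card)
    also have "\<dots> \<le> card (arcs Q)" using p(1) finite_arcs by (intro card_mono) (auto simp: nz_paths_iff)
    finally show False using p(2) by simp
  qed
  then obtain xs ys zs a where d: "p = xs @ [a] @ ys @ [a] @ zs" using not_distinct_decomp by blast
  \<comment> \<open>The segment from one occurrence of \<open>a\<close> to just before the next is a
    cycle whose junction back to \<open>a\<close> is allowed, so its square is a nonzero
    path.\<close>
  have "(end_vertex Q u xs, (a # ys) @ [a] @ zs) \<in> nz_paths"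
    using p(1) unfolding d nz_paths_append_iff[of u xs] by simp
  then have y: "(tail Q a, a # ys) \<in> nz_paths" "step (last (a # ys)) a"
    unfolding nz_paths_append_iff by (auto simp: nz_paths_iff)
  have "C (a # ys)"
    unfolding C_def cycle_iff nz_paths_append_iff
    using y nz_paths_subset by (auto simp: step_def end_vertex_eq)
  \<comment> \<open>A shortest such cycle is primitive: the root of a proper power would satisfy
    \<open>C\<close> as well and be shorter.\<close>
  then obtain c where c: "C c" "\<And>c'. C c' \<Longrightarrow> length c \<le> length c'"
    using ex_has_least_nat[of C "a # ys" length] by blast
  have "c \<in> primitive_cycles Q"
    unfolding primitive_cycles_def
  proof (intro CollectI conjI notI)
    show "c \<in> cycles Q" using c by (simp add: C_def)
    assume "\<exists>c'\<in>cycles Q. \<exists>k>1. c = concat (replicate k c')"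
    then obtain c' k where c': "c' \<in> cycles Q" "k > 1" "c = concat (replicate k c')" by blast
    then obtain j where "k = Suc (Suc j)" using less_iff_Suc_add[of 1 k] by auto
    then have eq: "c = c' @ c' @ concat (replicate j c')" using c' by simp
    have ne: "c' \<noteq> []" using c' by (simp add: cycle_iff)
    have "(tail Q (hd c), c) \<in> nz_paths" using c(1) unfolding C_def nz_paths_append_iff by blast
    then have "(tail Q (hd c'), (c' @ c') @ concat (replicate j c')) \<in> nz_paths" using eq ne by simp
    then have "(tail Q (hd c'), c' @ c') \<in> nz_paths" unfolding nz_paths_append_iff[of _ "c' @ c'"] by blast
    then have "C c'" using c' by (simp add: C_def)
    then show False using c(2)[of c'] eq ne by simp
  qed
  then show ?thesis
    using infinite_maximal_cycle[of c] c(1) unfolding infinite_maximal_paths_def C_def by blast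
qed

end

section \<open>Polynomials in one element\<close>

context nonempty_quadratic_algebra
begin

text \<open>Horner form with coefficients \<open>k 0\<close> up to \<open>k (n - 1)\<close>, so
  \<open>n\<close> counts coefficients. It splits off a constant term and leaves a multiple of
  \<open>x\<close>, the shape that division by \<open>x\<close> produces.\<close>

primrec horner :: "(('v, 'e) path \<Rightarrow> 'k) set \<Rightarrow> nat \<Rightarrow> (nat \<Rightarrow> 'k) \<Rightarrow> (('v, 'e) path \<Rightarrow> 'k) set" where
  "horner x 0 k = \<zero>\<^bsub>AA\<^esub>"
| "horner x (Suc n) k = scal (k 0) \<oplus>\<^bsub>AA\<^esub> horner x n (\<lambda>i. k (Suc i)) \<otimes>\<^bsub>AA\<^esub> x"

lemma horner_closed: "x \<in> carrier AA \<Longrightarrow> horner x n k \<in> carrier AA"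
  by (induction n arbitrary: k) (auto simp: scal)

lemma horner_cong: "(\<And>m. m < n \<Longrightarrow> k m = k' m) \<Longrightarrow> horner x n k = horner x n k'"
proof (induction n arbitrary: k k')
  case (Suc n)
  have "horner x n (\<lambda>i. k (Suc i)) = horner x n (\<lambda>i. k' (Suc i))" by (rule Suc.IH) (simp add: Suc.prems)
  then show ?case using Suc.prems[of 0] by simp
qed simp

lemma horner_sum:
  assumes x: "x \<in> carrier AA"
  shows "horner x n k = (\<Oplus>\<^bsub>AA\<^esub>m\<in>{..<n}. scal (k m) \<otimes>\<^bsub>AA\<^esub> x [^]\<^bsub>AA\<^esub> m)"
proof (induction n arbitrary: k)
  case (Suc n)
  let ?t = "\<lambda>k m. scal (k m) \<otimes>\<^bsub>AA\<^esub> x [^]\<^bsub>AA\<^esub> (m::nat)"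
  have tc: "?t k m \<in> carrier AA" for k m using x by (simp add: scal)
  have "finsum AA (?t k) {..<Suc n} = ?t k 0 \<oplus>\<^bsub>AA\<^esub> finsum AA (?t k) (Suc ` {..<n})"
    unfolding lessThan_Suc_eq_insert_0 by (rule AA.finsum_insert) (use tc x in \<open>auto simp: scal\<close>)
  also have "finsum AA (?t k) (Suc ` {..<n}) = finsum AA (\<lambda>m. ?t k (Suc m)) {..<n}"
    using tc by (subst AA.finsum_reindex) auto
  also have "\<dots> = finsum AA (\<lambda>m. ?t (\<lambda>i. k (Suc i)) m \<otimes>\<^bsub>AA\<^esub> x) {..<n}"
    by (rule AA.finsum_cong') (use x tc in \<open>auto simp: scal AA.m_assoc\<close>)
  also have "\<dots> = finsum AA (?t (\<lambda>i. k (Suc i))) {..<n} \<otimes>\<^bsub>AA\<^esub> x"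
    using x tc by (subst AA.finsum_ldistr) auto
  finally show ?case using Suc[of "\<lambda>i. k (Suc i)"] x by (simp add: scal)
qed simp

lemma monomial_value_singleton:
  "x \<in> carrier AA \<Longrightarrow> monomial_value AA [x] [m] = x [^]\<^bsub>AA\<^esub> m"
  by (simp add: monomial_value_def)

text \<open>In one variable only the exponent lists \<open>[m]\<close> carry coefficients;
  \<open>n\<close> is any bound beyond which they vanish.\<close>

lemma polynomial_value_horner:
  assumes x: "x \<in> carrier AA" and p: "p \<in> polynomials KK AA 1"
    and k: "\<And>m. p [m] = scal (k m)" "\<And>m. n \<le> m \<Longrightarrow> k m = 0"
  shows "polynomial_value AA [x] p = horner x n k"
proof -
  let ?t = "\<lambda>m. scal (k m) \<otimes>\<^bsub>AA\<^esub> x [^]\<^bsub>AA\<^esub> (m::nat)"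
  let ?J = "{m. p [m] \<noteq> \<zero>\<^bsub>AA\<^esub>}"
  have tc: "?t m \<in> carrier AA" for m using x by (simp add: scal)
  have J: "?J \<subseteq> {..<n}" using k scal_zero by (auto simp: not_le[symmetric])
  have "{e. p e \<noteq> \<zero>\<^bsub>AA\<^esub>} = (\<lambda>m. [m]) ` ?J"
  proof (intro subset_antisym subsetI)
    fix e assume e: "e \<in> {e. p e \<noteq> \<zero>\<^bsub>AA\<^esub>}"
    then have "length e = 1" using p by (auto simp: polynomials_def)
    then obtain m where "e = [m]" by (auto simp: length_Suc_conv)
    then show "e \<in> (\<lambda>m. [m]) ` ?J" using e by blast
  qed auto
  then have "polynomial_value AA [x] p = (\<Oplus>\<^bsub>AA\<^esub>e\<in>(\<lambda>m. [m]) ` ?J. p e \<otimes>\<^bsub>AA\<^esub> monomial_value AA [x] e)"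
    by (simp add: polynomial_value_def)
  also have "\<dots> = (\<Oplus>\<^bsub>AA\<^esub>m\<in>?J. p [m] \<otimes>\<^bsub>AA\<^esub> monomial_value AA [x] [m])"
    using tc x k(1) by (subst AA.finsum_reindex) (auto simp: inj_on_def monomial_value_singleton)
  also have "\<dots> = (\<Oplus>\<^bsub>AA\<^esub>m\<in>?J. ?t m)"
    by (rule AA.finsum_cong') (use tc x k(1) in \<open>auto simp: monomial_value_singleton\<close>)
  also have "\<dots> = (\<Oplus>\<^bsub>AA\<^esub>m\<in>{..<n}. ?t m)"
    using J tc x k(1) by (intro AA.add.finprod_mono_neutral_cong_left) auto
  also have "\<dots> = horner x n k" using horner_sum[OF x] by simp
  finally show ?thesis .
qed

lemma polynomial_coefficients:
  assumes p: "p \<in> polynomials KK AA 1"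
  shows "\<exists>k n. (\<forall>m. p [m] = scal (k m)) \<and> (\<forall>m\<ge>n. k m = 0)"
proof -
  have "p [m] \<in> range scal" for m using p unfolding polynomials_def scalars_eq by blast
  then have "\<exists>c. p [m] = scal c" for m by (rule rangeE) blast
  then obtain k where k: "\<And>m. p [m] = scal (k m)" by metis
  have "finite ((\<lambda>m. [m]) -` {e. p e \<noteq> \<zero>\<^bsub>AA\<^esub>})"
    using p by (intro finite_vimageI) (auto simp: polynomials_def inj_on_def)
  then have "finite {m. k m \<noteq> 0}"
    by (rule finite_subset[rotated]) (use k scal_eq_zero in auto)
  then obtain n where "\<And>m. m \<in> {m. k m \<noteq> 0} \<Longrightarrow> m < n"
    by (auto simp: finite_nat_set_iff_bounded)
  then have "k m = 0" if "n \<le> m" for m using that by (metis mem_Collect_eq not_le)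
  then show ?thesis using k by blast
qed

text \<open>Coefficients from \<open>n\<close> on are replaced by zero, so that the family has
  finite support whatever \<open>k\<close> is.\<close>

definition polynomial_of :: "nat \<Rightarrow> (nat \<Rightarrow> 'k) \<Rightarrow> nat list \<Rightarrow> (('v, 'e) path \<Rightarrow> 'k) set" where
  "polynomial_of n k e = (if length e = 1 \<and> hd e < n then scal (k (hd e)) else \<zero>\<^bsub>AA\<^esub>)"

lemma polynomial_of:
  "polynomial_of n k \<in> polynomials KK AA 1"
  "x \<in> carrier AA \<Longrightarrow> polynomial_value AA [x] (polynomial_of n k) = horner x n k"
proof -
  have "{e. polynomial_of n k e \<noteq> \<zero>\<^bsub>AA\<^esub>} \<subseteq> (\<lambda>m. [m]) ` {..<n}"
    by (auto simp: polynomial_of_def length_Suc_conv split: if_splits)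
  then have "finite {e. polynomial_of n k e \<noteq> \<zero>\<^bsub>AA\<^esub>}" by (rule finite_subset) simp
  moreover have "polynomial_of n k e \<in> KK" for e
    using scal_zero by (auto simp: polynomial_of_def scalars_eq intro: range_eqI[of _ _ 0])
  moreover have "polynomial_of n k e \<noteq> \<zero>\<^bsub>AA\<^esub> \<longrightarrow> length e = 1" for e
    by (auto simp: polynomial_of_def)
  ultimately show p: "polynomial_of n k \<in> polynomials KK AA 1" by (simp add: polynomials_def)
  let ?k = "\<lambda>m. if m < n then k m else 0"
  assume x: "x \<in> carrier AA"
  have "polynomial_value AA [x] (polynomial_of n k) = horner x n ?k"
    by (rule polynomial_value_horner[OF x p]) (auto simp: polynomial_of_def scal_zero)
  also have "\<dots> = horner x n k" by (rule horner_cong) simp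
  finally show "polynomial_value AA [x] (polynomial_of n k) = horner x n k" .
qed

lemma generated_algebra_singleton:
  assumes x: "x \<in> carrier AA"
  shows "carrier (generated_algebra KK AA [x]) = {horner x n k |n k. True}"
proof (intro subset_antisym subsetI)
  fix g assume "g \<in> carrier (generated_algebra KK AA [x])"
  then obtain p where p: "p \<in> polynomials KK AA 1" "g = polynomial_value AA [x] p"
    by (auto simp: generated_algebra_def)
  obtain k n where "\<forall>m. p [m] = scal (k m)" "\<forall>m\<ge>n. k m = 0"
    using polynomial_coefficients[OF p(1)] by blast
  then have k: "\<And>m. p [m] = scal (k m)" "\<And>m. n \<le> m \<Longrightarrow> k m = 0" by blast+
  have "g = horner x n k" using polynomial_value_horner[OF x p(1) k] p(2) by simp
  then show "g \<in> {horner x n k |n k. True}" by blast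
next
  fix g assume "g \<in> {horner x n k |n k. True}"
  then obtain n k where "g = horner x n k" by blast
  then have "g = polynomial_value AA [x] (polynomial_of n k)" using polynomial_of(2)[OF x] by simp
  then show "g \<in> carrier (generated_algebra KK AA [x])"
    using polynomial_of(1) by (simp add: generated_algebra_def)
qed

text \<open>Vanishing is asked only below \<open>n\<close>, since \<open>horner x n k\<close> reads
  no other coefficients.\<close>

lemma algebraically_independent_singleton:
  assumes x: "x \<in> carrier AA"
  shows "algebraically_independent KK AA [x] \<longleftrightarrow>
    (\<forall>n k. horner x n k = \<zero>\<^bsub>AA\<^esub> \<longrightarrow> (\<forall>m<n. k m = 0))"
proof
  assume *: "algebraically_independent KK AA [x]"
  show "\<forall>n k. horner x n k = \<zero>\<^bsub>AA\<^esub> \<longrightarrow> (\<forall>m<n. k m = 0)"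
  proof (intro allI impI)
    fix n k m assume h: "horner x n k = \<zero>\<^bsub>AA\<^esub>" and m: "m < (n::nat)"
    then have "polynomial_of n k [m] = \<zero>\<^bsub>AA\<^esub>"
      using * polynomial_of(1)[of n k] polynomial_of(2)[OF x, of n k]
      unfolding algebraically_independent_def by simp
    then show "k m = 0" using m by (simp add: polynomial_of_def scal_eq_zero)
  qed
next
  assume *: "\<forall>n k. horner x n k = \<zero>\<^bsub>AA\<^esub> \<longrightarrow> (\<forall>m<n. k m = 0)"
  show "algebraically_independent KK AA [x]"
    unfolding algebraically_independent_def
  proof (intro ballI impI allI)
    fix p e assume p: "p \<in> polynomials KK AA (length [x])" "polynomial_value AA [x] p = \<zero>\<^bsub>AA\<^esub>"
    then have p1: "p \<in> polynomials KK AA 1" by simp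
    obtain k n where "\<forall>m. p [m] = scal (k m)" "\<forall>m\<ge>n. k m = 0"
      using polynomial_coefficients[OF p1] by blast
    then have k: "\<And>m. p [m] = scal (k m)" "\<And>m. n \<le> m \<Longrightarrow> k m = 0" by blast+
    then have "horner x n k = \<zero>\<^bsub>AA\<^esub>" using polynomial_value_horner[OF x p1 k] p(2) by simp
    then have k0: "k m = 0" for m using * k(2) by (cases "m < n") auto
    show "p e = \<zero>\<^bsub>AA\<^esub>"
    proof (rule ccontr)
      assume e: "p e \<noteq> \<zero>\<^bsub>AA\<^esub>"
      then have "length e = 1" using p1 by (auto simp: polynomials_def)
      then obtain m where "e = [m]" by (auto simp: length_Suc_conv)
      then show False using e k(1) k0 scal_zero by simp
    qed
  qed
qed

end

section \<open>Locally gentle algebras without finite maximal paths\<close>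

locale no_finite_maximal = gentle_quiver Q R I
  for Q :: "('v, 'e) pre_digraph" and R and I :: "(('v, 'e) path \<Rightarrow> 'k::field) set" +
  assumes no_finite_maximal: "finite_maximal_paths Q I = {}"

context gentle_quiver
begin

text \<open>If an arrow occurred twice, determinism would make the arrows following both occurrences
  agree, and the repetition would propagate to the end, giving the last arrow a successor. Paths
  into a dead end therefore have bounded length.\<close>

lemma distinct_if_no_successor:
  assumes "successively step p" "p \<noteq> []" "\<And>b. \<not> step (last p) b"
  shows "distinct p"
  using assms
proof (induction p)
  case (Cons a q)
  show ?case
  proof (cases "q = []")
    case False
    then have sq: "successively step q" and aq: "step a (hd q)"
      using Cons.prems(1) by (auto simp: successively_Cons)
    have dq: "distinct q" using Cons.IH sq False Cons.prems(3) by auto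
    have "a \<notin> set q"
    proof
      assume "a \<in> set q"
      then obtain xs ys where q: "q = xs @ a # ys" using split_list by fastforce
      have ys: "ys \<noteq> []"
        using Cons.prems(3)[of "hd q"] aq q by auto
      then have "step a (hd ys)" using sq unfolding q by (auto simp: successively_append_iff successively_Cons)
      then have "hd ys = hd q" using aq step_det by blast
      moreover have "hd q \<in> set (xs @ [a])" unfolding q by (cases xs) auto
      moreover have "hd ys \<in> set ys" using ys by simp
      ultimately show False using dq unfolding q by auto
    qed
    then show ?thesis using dq by simp
  qed simp
qed simp

end

section \<open>The successor permutation and its period\<close>

context no_finite_maximal
begin

text \<open>If \<open>a\<close> had no successor, the nonzero paths ending in \<open>a\<close> would
  have bounded length, and a longest one could be prolonged neither to the left nor to the
  right.\<close>

lemma successor_exists: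
  assumes a: "a \<in> arcs Q"
  shows "\<exists>b. step a b"
proof (rule ccontr)
  assume no: "\<nexists>b. step a b"
  define S where "S p \<longleftrightarrow> p \<noteq> [] \<and> last p = a \<and> (tail Q (hd p), p) \<in> nz_paths" for p
  have Sa: "S [a]" using a by (simp add: S_def nz_paths_iff)
  have Sb: "\<forall>p. S p \<longrightarrow> length p \<le> card (arcs Q)"
  proof (intro allI impI)
    fix p assume p: "S p"
    then have "distinct p" using no by (intro distinct_if_no_successor) (auto simp: S_def nz_paths_iff)
    then have "length p = card (set p)" by (simp add: distinct_card)
    also have "\<dots> \<le> card (arcs Q)" using p finite_arcs by (intro card_mono) (auto simp: S_def nz_paths_iff)
    finally show "length p \<le> card (arcs Q)" .
  qed
  obtain p where pS: "S p \<and> (\<forall>q. S q \<longrightarrow> length q \<le> length p)"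
    using ex_has_greatest_nat[where P = S and f = length, OF Sa Sb[folded less_Suc_eq_le]] by (rule exE)
  then have p: "S p" "\<And>q. S q \<Longrightarrow> length q \<le> length p" by simp_all
  have "(tail Q (hd p), p) \<in> finite_maximal_paths Q I"
    unfolding finite_maximal_path_iff
  proof (intro conjI ballI impI)
    show "(tail Q (hd p), p) \<in> nz_paths" using p by (simp add: S_def)
    show "(tail Q (hd p), p @ [b]) \<notin> nz_paths" for b
      using p no by (auto simp: S_def nz_paths_append_iff)
    show "(tail Q b, b # p) \<notin> nz_paths" for b
      using p(2)[of "b # p"] p(1) by (auto simp: S_def)
  qed
  then show False using no_finite_maximal by blast
qed

text \<open>The identity off the arrows, so that \<open>succ\<close> is a permutation of the whole
  type and some power of it is the identity.\<close>

definition succ :: "'e \<Rightarrow> 'e" where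
  "succ a = (if a \<in> arcs Q then SOME b. step a b else a)"

lemma step_succ: "a \<in> arcs Q \<Longrightarrow> step a (succ a)"
  using someI_ex[OF successor_exists[of a]] by (simp add: succ_def)

lemma succ_arcs: "a \<in> arcs Q \<Longrightarrow> succ a \<in> arcs Q"
  using step_succ by (auto simp: step_def)

lemma succ_permutation: "permutation succ"
proof -
  have "inj_on succ (arcs Q)"
    by (rule inj_onI) (metis step_succ step_inj)
  then have "bij_betw succ (arcs Q) (arcs Q)"
    using finite_arcs succ_arcs by (intro bij_betw_imageI endo_inj_surj) auto
  then have "succ permutes arcs Q"
    by (rule bij_imp_permutes) (simp add: succ_def)
  then show ?thesis unfolding permutation_permutes using finite_arcs by blast
qed

text \<open>Any positive exponent that annihilates the permutation; the order of the permutation is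
  one. A single number for all arrows makes the central element homogeneous.\<close>

definition period :: nat where
  "period = (SOME n. succ ^^ n = id \<and> n > 0)"

lemma period: "succ ^^ period = id" "period > 0"
proof -
  have "\<exists>n. succ ^^ n = id \<and> n > 0" by (rule permutation_is_nilpotent[OF succ_permutation]) blast
  from someI_ex[OF this] show "succ ^^ period = id" "period > 0" unfolding period_def by auto
qed

text \<open>For an arrow \<open>a\<close>, this is the only nonzero path of length
  \<open>n > 0\<close> beginning with \<open>a\<close>.\<close>

definition orbit_path :: "'e \<Rightarrow> nat \<Rightarrow> 'e list" where
  "orbit_path a n = map (\<lambda>i. (succ ^^ i) a) [0..<n]"

lemma funpow_succ_arcs: "a \<in> arcs Q \<Longrightarrow> (succ ^^ i) a \<in> arcs Q"
  by (induction i) (auto simp: succ_arcs)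

lemma orbit_path_simps [simp]:
  "length (orbit_path a n) = n" "i < n \<Longrightarrow> orbit_path a n ! i = (succ ^^ i) a"
  "orbit_path a n = [] \<longleftrightarrow> n = 0"
  by (simp_all add: orbit_path_def)

lemma hd_orbit_path [simp]: "0 < n \<Longrightarrow> hd (orbit_path a n) = a"
  by (simp add: hd_conv_nth)

lemma successively_orbit_path: "a \<in> arcs Q \<Longrightarrow> successively step (orbit_path a n)"
  by (simp add: successively_conv_nth step_succ funpow_succ_arcs)

lemma orbit_path_nz: "a \<in> arcs Q \<Longrightarrow> (tail Q a, orbit_path a n) \<in> nz_paths"
  using successively_orbit_path[of a n] funpow_succ_arcs[of a]
  by (cases "n = 0") (auto simp: nz_paths_iff orbit_path_def hd_map)

lemma nz_path_eq_orbit: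
  assumes "(u, p) \<in> nz_paths" "p \<noteq> []"
  shows "p = orbit_path (hd p) (length p)" "hd p \<in> arcs Q" "u = tail Q (hd p)"
proof -
  show a: "hd p \<in> arcs Q" "u = tail Q (hd p)"
    using assms hd_in_set[of p] by (auto simp: nz_paths_iff)
  show "p = orbit_path (hd p) (length p)"
    using assms by (intro successively_step_eq successively_orbit_path[OF a(1)]) (auto simp: nz_paths_iff)
qed

lemma nz_path_nth: "(u, p) \<in> nz_paths \<Longrightarrow> i < length p \<Longrightarrow> p ! i = (succ ^^ i) (hd p)"
  using nz_path_eq_orbit(1)[of u p] orbit_path_simps(2)[of i "length p" "hd p"] by fastforce

text \<open>Moving \<open>period\<close> steps along a path returns to the same arrow. Cutting off
  the first or the last \<open>period\<close> arrows thus leaves the same path, which is the reason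
  for centrality.\<close>

lemma nz_path_rotate:
  assumes p: "(u, p) \<in> nz_paths" "period \<le> length p"
  shows "drop period p = take (length p - period) p" "end_vertex Q u (take period p) = u"
proof -
  have ne: "p \<noteq> []" using p(2) period(2) by auto
  note o = nz_path_eq_orbit[OF p(1) ne]
  show "drop period p = take (length p - period) p"
  proof (rule nth_equalityI)
    fix i assume "i < length (drop period p)"
    then have i: "period + i < length p" by simp
    have "(succ ^^ (period + i)) (hd p) = (succ ^^ i) (hd p)"
      using period(1) by (simp add: funpow_add)
    then show "drop period p ! i = take (length p - period) p ! i"
      using i nz_path_nth[OF p(1)] by simp
  qed simp
  have l: "last (take period p) = (succ ^^ (period - 1)) (hd p)"
    using ne p period(2) nz_path_nth[OF p(1), of "period - 1"] by (simp add: last_conv_nth)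
  have "succ ((succ ^^ (period - 1)) (hd p)) = (succ ^^ period) (hd p)"
    using period(2) by (cases period) auto
  then have "step ((succ ^^ (period - 1)) (hd p)) (hd p)"
    using step_succ[OF funpow_succ_arcs[OF o(2)], of "period - 1"] period(1) by simp
  then show "end_vertex Q u (take period p) = u"
    using l ne period(2) o(3) by (auto simp: end_vertex_eq step_def)
qed

definition out_arrow :: "'v \<Rightarrow> 'e" where
  "out_arrow v = (SOME a. a \<in> arcs Q \<and> tail Q a = v)"

text \<open>The trivial path at \<open>v\<close> is not maximal, so some arrow starts or ends at
  \<open>v\<close>; in the latter case its successor starts there.\<close>

lemma out_arrow:
  assumes v: "v \<in> verts Q"
  shows "out_arrow v \<in> arcs Q" "tail Q (out_arrow v) = v"
proof -
  have "(v, []) \<notin> finite_maximal_paths Q I" using no_finite_maximal by blast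
  moreover have "(v, []) \<in> nz_paths" using v by (simp add: nz_paths_iff)
  ultimately obtain a where "a \<in> arcs Q" "v = tail Q a \<or> head Q a = v"
    unfolding finite_maximal_path_iff by (auto simp: end_vertex_eq)
  then have "\<exists>a. a \<in> arcs Q \<and> tail Q a = v"
    using step_succ[of a] succ_arcs[of a] by (auto simp: step_def)
  from someI_ex[OF this] show "out_arrow v \<in> arcs Q" "tail Q (out_arrow v) = v"
    unfolding out_arrow_def by auto
qed

text \<open>On nonzero paths, a right inverse of cutting off the last \<open>period\<close> arrows.
  The extension is forced for a nontrivial path; for a trivial one \<open>out_arrow\<close> makes
  the choice.\<close>

definition extend_path :: "('v, 'e) path \<Rightarrow> ('v, 'e) path" where
  "extend_path p = (fst p, orbit_path (if snd p = [] then out_arrow (fst p) else hd (snd p)) (length (snd p) + period))"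

lemma extend_path:
  assumes "(u, q) \<in> nz_paths"
  obtains r where "extend_path (u, q) = (u, r)" "(u, r) \<in> nz_paths" "length r = length q + period"
    "take (length q) r = q" "q = [] \<longrightarrow> hd r = out_arrow u"
proof -
  let ?a = "if q = [] then out_arrow u else hd q"
  let ?r = "orbit_path ?a (length q + period)"
  have u: "u \<in> verts Q" using assms by (simp add: nz_paths_iff)
  have a: "?a \<in> arcs Q" "tail Q ?a = u"
    using out_arrow[OF u] nz_path_eq_orbit[OF assms] by auto
  have "(u, ?r) \<in> nz_paths" using orbit_path_nz[OF a(1)] a(2) by simp
  moreover have "take (length q) ?r = q"
  proof (rule nth_equalityI)
    fix i assume "i < length (take (length q) ?r)"
    then show "take (length q) ?r ! i = q ! i"
      using nz_path_nth[OF assms, of i] by auto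
  qed simp
  ultimately show ?thesis
    using period(2) by (intro that[of ?r]) (auto simp: extend_path_def)
qed

section \<open>The central element and division by it\<close>

definition period_sum :: "(('v, 'e) path \<Rightarrow> 'k) set" where
  "period_sum = of_coord (\<lambda>p. if p \<in> nz_paths \<and> length (snd p) = period then 1 else 0)"

lemma period_sum:
  "period_sum \<in> carrier AA"
  "coord period_sum p = (if p \<in> nz_paths \<and> length (snd p) = period then 1 else 0)"
proof -
  have "finite {p. (if p \<in> nz_paths \<and> length (snd p) = period then 1 else 0 :: 'k) \<noteq> 0}"
    by (rule finite_subset[OF _ finite_nz_paths_le[of period]]) auto
  moreover have "(if p \<in> nz_paths \<and> length (snd p) = period then 1 else 0 :: 'k) \<noteq> 0 \<Longrightarrow> p \<in> nz_paths" for p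
    by (auto split: if_splits)
  ultimately have "period_sum \<in> carrier AA \<and>
      coord period_sum = (\<lambda>p. if p \<in> nz_paths \<and> length (snd p) = period then 1 else 0)"
    unfolding period_sum_def
    using of_coord[of "\<lambda>p. if p \<in> nz_paths \<and> length (snd p) = period then 1 else 0"] by blast
  then show "period_sum \<in> carrier AA"
    "coord period_sum p = (if p \<in> nz_paths \<and> length (snd p) = period then 1 else 0)" by simp_all
qed

lemma period_sum_homogeneous: "period_sum \<in> rgrade AA (int period)"
  using period_sum by (auto simp: rgrade_iff)

lemma coord_mult_period_sum:
  assumes Y: "Y \<in> carrier AA" and p: "(u, p) \<in> nz_paths"
  shows "coord (Y \<otimes>\<^bsub>AA\<^esub> period_sum) (u, p) =
    (if period \<le> length p then coord Y (u, take (length p - period) p) else 0)"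
proof -
  have "coord (Y \<otimes>\<^bsub>AA\<^esub> period_sum) (u, p) =
    (\<Sum>i\<le>length p. if i = length p - period then
       (if period \<le> length p then coord Y (u, take (length p - period) p) else 0) else 0)"
    unfolding coord_mult[OF Y period_sum(1) p]
  proof (rule sum.cong[OF refl])
    fix i assume i: "i \<in> {..length p}"
    \<comment> \<open>Subtraction is truncated: for a path shorter than the period the index is 0
      and the term vanishes, hence the inner case distinction.\<close>
    have "length (drop i p) = period \<longleftrightarrow> i = length p - period \<and> period \<le> length p" using i by auto
    then show "coord Y (u, take i p) * coord period_sum (end_vertex Q u (take i p), drop i p) =
      (if i = length p - period then (if period \<le> length p then coord Y (u, take (length p - period) p) else 0) else 0)"
      using nz_paths_drop[OF p, of i] by (auto simp: period_sum(2))
  qed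
  then show ?thesis by simp
qed

text \<open>One product removes \<open>period\<close> arrows in front and the other removes them at
  the end; \<open>nz_path_rotate\<close> identifies the results.\<close>

lemma period_sum_central:
  assumes Y: "Y \<in> carrier AA"
  shows "period_sum \<otimes>\<^bsub>AA\<^esub> Y = Y \<otimes>\<^bsub>AA\<^esub> period_sum"
proof (rule coord_inj)
  fix w assume w: "w \<in> nz_paths"
  obtain u p where up: "w = (u, p)" by fastforce
  note p = w[unfolded up]
  have "coord (period_sum \<otimes>\<^bsub>AA\<^esub> Y) (u, p) = (\<Sum>i\<le>length p. if i = period then
       coord Y (end_vertex Q u (take period p), drop period p) else 0)"
    unfolding coord_mult[OF period_sum(1) Y p]
    by (rule sum.cong[OF refl]) (use nz_paths_take[OF p] in \<open>auto simp: period_sum(2) min_def\<close>)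
  also have "\<dots> = coord (Y \<otimes>\<^bsub>AA\<^esub> period_sum) (u, p)"
    using nz_path_rotate[OF p] by (simp add: coord_mult_period_sum[OF Y p])
  finally show "coord (period_sum \<otimes>\<^bsub>AA\<^esub> Y) w = coord (Y \<otimes>\<^bsub>AA\<^esub> period_sum) w" by (simp add: up)
qed (use Y period_sum in auto)

text \<open>The classes of these paths form a basis over the polynomial ring in \<open>period_sum\<close>. Multiplying
  a trivial path by \<open>period_sum\<close> gives the sum of all paths of length \<open>period\<close> that start there, so
  one such path per vertex has to be left out.\<close>

definition basis_paths :: "('v, 'e) path set" where
  "basis_paths = {(u, p) \<in> nz_paths. length p < period \<or> length p = period \<and> hd p \<noteq> out_arrow u}"

lemma finite_basis_paths: "finite basis_paths"
  by (rule finite_subset[OF _ finite_nz_paths_le[of period]]) (auto simp: basis_paths_def)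

lemma basis_paths_subset: "basis_paths \<subseteq> nz_paths"
  by (auto simp: basis_paths_def)

text \<open>Remainder and quotient of a division by \<open>period_sum\<close> are unique: at an
  extended path the remainder has coordinate zero, and the product shows the coordinate of
  \<open>Y\<close> at the path that was extended.\<close>

lemma period_sum_independent:
  assumes W: "W \<in> supported basis_paths" and Y: "Y \<in> carrier AA"
    and eq: "W \<oplus>\<^bsub>AA\<^esub> Y \<otimes>\<^bsub>AA\<^esub> period_sum = \<zero>\<^bsub>AA\<^esub>"
  shows "W = \<zero>\<^bsub>AA\<^esub>" "Y = \<zero>\<^bsub>AA\<^esub>"
proof -
  have Wc: "W \<in> carrier AA" using W by (simp add: supported_def)
  have sum: "coord W p + coord (Y \<otimes>\<^bsub>AA\<^esub> period_sum) p = 0" for p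
    using coord_add[OF Wc AA.m_closed[OF Y period_sum(1)], of p] eq coord_zero by simp
  show Y0: "Y = \<zero>\<^bsub>AA\<^esub>"
  proof (rule coord_inj[OF Y AA.zero_closed])
    fix w assume w: "w \<in> nz_paths"
    obtain u q where uq: "w = (u, q)" by fastforce
    have uq_nz: "(u, q) \<in> nz_paths" using w uq by simp
    obtain r where "extend_path (u, q) = (u, r)" and r: "(u, r) \<in> nz_paths" "length r = length q + period"
      "take (length q) r = q" "q = [] \<longrightarrow> hd r = out_arrow u"
      by (rule extend_path[OF uq_nz])
    \<comment> \<open>\<open>r\<close> is longer than the period, or \<open>q\<close> is trivial and
      \<open>r\<close> starts with the excluded arrow.\<close>
    have "(u, r) \<notin> basis_paths" using r by (auto simp: basis_paths_def)
    then have "coord W (u, r) = 0" using W unfolding supported_def by blast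
    then have "coord (Y \<otimes>\<^bsub>AA\<^esub> period_sum) (u, r) = 0" using sum[of "(u, r)"] by simp
    then show "coord Y w = coord \<zero>\<^bsub>AA\<^esub> w"
      using r uq by (simp add: coord_mult_period_sum[OF Y r(1)] coord_zero)
  qed
  show "W = \<zero>\<^bsub>AA\<^esub>" using eq Wc period_sum(1) by (simp add: Y0)
qed

lemma period_sum_regular:
  assumes "Y \<in> carrier AA" "Y \<otimes>\<^bsub>AA\<^esub> period_sum = \<zero>\<^bsub>AA\<^esub>"
  shows "Y = \<zero>\<^bsub>AA\<^esub>"
  by (rule period_sum_independent(2)[of "\<zero>\<^bsub>AA\<^esub>"]) (use assms in \<open>auto simp: supported_def coord_zero\<close>)

text \<open>The quotient reads the coordinates of \<open>Z\<close> at the extended paths; what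
  remains is supported on the paths that are no extensions, and these are
  \<open>basis_paths\<close>. The last two clauses record that the quotient involves shorter paths,
  so that repeated division ends, and that lengths above the period leave no remainder, which bounds
  a degree in the computation of the depth.\<close>

lemma divide_period_sum:
  assumes Z: "Z \<in> carrier AA"
  shows "\<exists>W\<in>supported basis_paths. \<exists>Y\<in>carrier AA. Z = W \<oplus>\<^bsub>AA\<^esub> Y \<otimes>\<^bsub>AA\<^esub> period_sum \<and>
    (\<forall>p. coord Y p \<noteq> 0 \<longrightarrow> (\<exists>q. coord Z q \<noteq> 0 \<and> length (snd q) = length (snd p) + period)) \<and>
    ((\<forall>p. coord Z p \<noteq> 0 \<longrightarrow> period < length (snd p)) \<longrightarrow> W = \<zero>\<^bsub>AA\<^esub>)"
proof -
  define f where "f p = (if p \<in> nz_paths then coord Z (extend_path p) else 0)" for p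
  have "{p. f p \<noteq> 0} \<subseteq> (\<lambda>(u, p). (u, take (length p - period) p)) ` {p. coord Z p \<noteq> 0}"
  proof
    fix w assume w: "w \<in> {p. f p \<noteq> 0}"
    obtain u q where uq: "w = (u, q)" by fastforce
    have nz: "(u, q) \<in> nz_paths" and Zq: "coord Z (extend_path (u, q)) \<noteq> 0"
      using w uq by (auto simp: f_def split: if_splits)
    obtain r where "extend_path (u, q) = (u, r)" "(u, r) \<in> nz_paths" "length r = length q + period"
      "take (length q) r = q" "q = [] \<longrightarrow> hd r = out_arrow u"
      by (rule extend_path[OF nz])
    then show "w \<in> (\<lambda>(u, p). (u, take (length p - period) p)) ` {p. coord Z p \<noteq> 0}"
      using Zq uq by (intro image_eqI[of _ _ "(u, r)"]) auto
  qed
  then have "finite {p. f p \<noteq> 0}"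
    using coord_support(1)[OF Z] finite_subset finite_imageI by blast
  moreover have "f p \<noteq> 0 \<Longrightarrow> p \<in> nz_paths" for p by (auto simp: f_def split: if_splits)
  ultimately have Yc: "of_coord f \<in> carrier AA" and Yf: "coord (of_coord f) = f"
    using of_coord[of f] by blast+
  let ?Y = "of_coord f"
  let ?W = "Z \<ominus>\<^bsub>AA\<^esub> ?Y \<otimes>\<^bsub>AA\<^esub> period_sum"
  have YX: "?Y \<otimes>\<^bsub>AA\<^esub> period_sum \<in> carrier AA" using Yc period_sum by simp
  have Wc: "?W \<in> carrier AA" using Z YX by simp
  have W: "coord ?W (u, p) = coord Z (u, p) -
      (if period \<le> length p then coord Z (extend_path (u, take (length p - period) p)) else 0)"
    if p: "(u, p) \<in> nz_paths" for u p
    using nz_paths_take[OF p, of "length p - period"]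
    by (simp add: coord_minus[OF Z YX] coord_mult_period_sum[OF Yc p] Yf f_def)
  \<comment> \<open>A path longer than the period keeps its first arrow under truncation, so
    extending the truncation gives the path back.\<close>
  have W_big: "coord ?W (u, p) = 0" if p: "(u, p) \<in> nz_paths" and l: "period < length p" for u p
  proof -
    let ?q = "take (length p - period) p"
    have ne: "?q \<noteq> []" "p \<noteq> []" using l by auto
    have "hd ?q = hd p" using l by (simp add: hd_take)
    then have "extend_path (u, ?q) = (u, p)"
      using ne l nz_path_eq_orbit(1)[OF p ne(2)] by (simp add: extend_path_def)
    then show ?thesis using W[OF p] l by simp
  qed
  \<comment> \<open>At length \<open>period\<close> the truncation is the trivial path, whose
    extension follows \<open>out_arrow u\<close>; the difference vanishes on that extension.\<close>
  have W_eq: "coord ?W (u, p) = coord Z (u, p) - coord Z (u, orbit_path (out_arrow u) period)"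
    if p: "(u, p) \<in> nz_paths" and l: "period = length p" for u p
    using W[OF p] l by (simp add: extend_path_def)
  have "?W \<in> supported basis_paths"
    unfolding supported_def
  proof (intro CollectI conjI Wc allI impI)
    fix w assume nzw: "coord ?W w \<noteq> 0"
    obtain u p where up: "w = (u, p)" by fastforce
    have p: "(u, p) \<in> nz_paths" using coord_support(2)[OF Wc nzw] up by simp
    have "\<not> period < length p" using W_big[OF p] nzw up by auto
    moreover have "hd p \<noteq> out_arrow u" if l: "period = length p"
    proof
      assume "hd p = out_arrow u"
      then have "p = orbit_path (out_arrow u) period"
        using nz_path_eq_orbit(1)[OF p] l period(2) by auto
      then show False using W_eq[OF p l] nzw up by simp
    qed
    ultimately show "w \<in> basis_paths" using p up by (auto simp: basis_paths_def)
  qed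
  moreover have "Z = ?W \<oplus>\<^bsub>AA\<^esub> ?Y \<otimes>\<^bsub>AA\<^esub> period_sum"
    by (rule coord_inj) (use Z YX Wc in \<open>auto simp: coord_add coord_minus\<close>)
  moreover have "\<exists>q. coord Z q \<noteq> 0 \<and> length (snd q) = length (snd w) + period" if nzw: "coord ?Y w \<noteq> 0" for w
  proof -
    obtain u q where uq: "w = (u, q)" by fastforce
    have nz: "(u, q) \<in> nz_paths" and Zq: "coord Z (extend_path (u, q)) \<noteq> 0"
      using nzw uq by (auto simp: Yf f_def split: if_splits)
    obtain r where "extend_path (u, q) = (u, r)" "(u, r) \<in> nz_paths" "length r = length q + period"
      "take (length q) r = q" "q = [] \<longrightarrow> hd r = out_arrow u"
      by (rule extend_path[OF nz])
    then show ?thesis using Zq uq by (intro exI[of _ "(u, r)"]) simp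
  qed
  moreover have "?W = \<zero>\<^bsub>AA\<^esub>" if big: "\<And>p. coord Z p \<noteq> 0 \<Longrightarrow> period < length (snd p)"
  proof (rule coord_inj[OF Wc AA.zero_closed])
    fix w assume w: "w \<in> nz_paths"
    obtain u p where up: "w = (u, p)" by fastforce
    have Z0: "coord Z q = 0" if "length (snd q) \<le> period" for q using big[of q] that by auto
    consider "period < length p" | "period = length p" | "length p < period" by linarith
    then show "coord ?W w = coord \<zero>\<^bsub>AA\<^esub> w"
    proof cases
      case 1 then show ?thesis using W_big w up by (simp add: coord_zero)
    next
      case 2 then show ?thesis using W_eq[of u p] w up Z0 by (simp add: coord_zero)
    next
      case 3 then show ?thesis using W[of u p] w up Z0 by (simp add: coord_zero)
    qed
  qed
  ultimately show ?thesis using Yc by blast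
qed

text \<open>A homogeneous element of largest degree outside the multiples of
  \<open>period_sum\<close> serves as \<open>y\<close>: products with A_+ have larger degree, hence
  are multiples.\<close>

lemma depth_no_finite_maximal: "depth AA = 1"
proof -
  define D where "D n \<longleftrightarrow> (\<exists>y\<in>rgrade AA (int n). \<forall>w\<in>carrier AA. y \<noteq> period_sum \<otimes>\<^bsub>AA\<^esub> w)" for n
  \<comment> \<open>The unit has coordinate 1 at trivial paths, where multiples of
    \<open>period_sum\<close> have coordinate 0.\<close>
  have D0: "D 0"
    unfolding D_def
  proof (intro bexI ballI notI)
    show "\<one>\<^bsub>AA\<^esub> \<in> rgrade AA (int 0)" using gr.rgrade_one by simp
    fix w assume w: "w \<in> carrier AA" and "\<one>\<^bsub>AA\<^esub> = period_sum \<otimes>\<^bsub>AA\<^esub> w"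
    then have eq: "\<one>\<^bsub>AA\<^esub> = w \<otimes>\<^bsub>AA\<^esub> period_sum" using period_sum_central by simp
    obtain v where "v \<in> verts Q" using verts_nonempty by blast
    then show False
      using coord_mult_period_sum[OF w, of v "[]"] period(2) eq coord_one[of v "[]"]
      by (simp add: nz_paths_iff)
  qed
  \<comment> \<open>Above the period division leaves no remainder, so the degrees in question are
    bounded.\<close>
  have Db: "\<forall>n. D n \<longrightarrow> n \<le> period"
  proof (intro allI impI, rule ccontr)
    fix n assume "D n" and n: "\<not> n \<le> period"
    then obtain y where y: "y \<in> rgrade AA (int n)" "\<And>w. w \<in> carrier AA \<Longrightarrow> y \<noteq> period_sum \<otimes>\<^bsub>AA\<^esub> w"
      by (auto simp: D_def)
    have yc: "y \<in> carrier AA" by (rule rgrade_D(1)[OF y(1)])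
    have big: "period < length (snd p)" if "coord y p \<noteq> 0" for p
    proof -
      have "int (length (snd p)) = int n" using rgrade_D(2)[OF y(1), of p] that by blast
      then show ?thesis using n by simp
    qed
    obtain W Y where WY: "Y \<in> carrier AA" "y = W \<oplus>\<^bsub>AA\<^esub> Y \<otimes>\<^bsub>AA\<^esub> period_sum"
      and W0: "(\<forall>p. coord y p \<noteq> 0 \<longrightarrow> period < length (snd p)) \<longrightarrow> W = \<zero>\<^bsub>AA\<^esub>"
      using divide_period_sum[OF yc] by blast
    have "W = \<zero>\<^bsub>AA\<^esub>" using W0 big by blast
    then have "y = period_sum \<otimes>\<^bsub>AA\<^esub> Y" using WY period_sum(1) by (simp add: period_sum_central)
    then show False using y(2) WY(1) by blast
  qed
  obtain n where "D n \<and> (\<forall>m. D m \<longrightarrow> m \<le> n)"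
    using ex_has_greatest_nat[where P = D and f = "\<lambda>n. n", OF D0 Db[folded less_Suc_eq_le]] by (rule exE)
  then have n: "D n" "\<And>m. D m \<Longrightarrow> m \<le> n" by simp_all
  obtain y where y: "y \<in> rgrade AA (int n)" "\<And>w. w \<in> carrier AA \<Longrightarrow> y \<noteq> period_sum \<otimes>\<^bsub>AA\<^esub> w"
    using n(1) by (auto simp: D_def)
  have yc: "y \<in> carrier AA" by (rule rgrade_D(1)[OF y(1)])
  show ?thesis
  proof (rule gr.depth_one[OF period_sum_homogeneous _ _ _ y])
    show "0 < int period" using period(2) by simp
    show "period_sum \<otimes>\<^bsub>AA\<^esub> a = a \<otimes>\<^bsub>AA\<^esub> period_sum" if "a \<in> carrier AA" for a
      by (rule period_sum_central[OF that])
    show "a = \<zero>\<^bsub>AA\<^esub>" if "a \<in> carrier AA" "period_sum \<otimes>\<^bsub>AA\<^esub> a = \<zero>\<^bsub>AA\<^esub>" for a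
      using period_sum_regular[OF that(1)] that period_sum_central by simp
    fix a assume a: "a \<in> positive_part AA"
    then have ac: "a \<in> carrier AA" and a0: "gr.G.cmp 0 a = \<zero>\<^bsub>AA\<^esub>"
      using gr.positive_part_iff by auto
    let ?M = "{period_sum \<otimes>\<^bsub>AA\<^esub> w |w. w \<in> carrier AA}"
    let ?J = "{i. gr.G.cmp i a \<noteq> \<zero>\<^bsub>AA\<^esub>}"
    note cc = gr.G.component_carrier[OF ac]
    have "(\<Oplus>\<^bsub>AA\<^esub>i\<in>?J. y \<otimes>\<^bsub>AA\<^esub> gr.G.cmp i a) \<in> ?M"
    proof (rule finsum_closed_in[OF AA.abelian_group_axioms])
      have "\<zero>\<^bsub>AA\<^esub> = period_sum \<otimes>\<^bsub>AA\<^esub> \<zero>\<^bsub>AA\<^esub>" using period_sum(1) by simp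
      then show "\<zero>\<^bsub>AA\<^esub> \<in> ?M" by blast
      show "s \<oplus>\<^bsub>AA\<^esub> t \<in> ?M" if s: "s \<in> ?M" and t: "t \<in> ?M" for s t
      proof -
        obtain v where v: "v \<in> carrier AA" "s = period_sum \<otimes>\<^bsub>AA\<^esub> v" using s by auto
        obtain w where w: "w \<in> carrier AA" "t = period_sum \<otimes>\<^bsub>AA\<^esub> w" using t by auto
        have "s \<oplus>\<^bsub>AA\<^esub> t = period_sum \<otimes>\<^bsub>AA\<^esub> (v \<oplus>\<^bsub>AA\<^esub> w)"
          using v w period_sum(1) by (simp add: AA.r_distr)
        moreover have "v \<oplus>\<^bsub>AA\<^esub> w \<in> carrier AA" using v w by simp
        ultimately show ?thesis by auto
      qed
      show "?M \<subseteq> carrier AA" using period_sum(1) by auto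
      show "finite ?J" by (rule gr.G.component_finite[OF ac])
      fix i assume i: "i \<in> ?J"
      have "\<not> i < 0" using gr.nonneg[of i] gr.G.component_in[OF ac, of i] i by auto
      moreover have "i \<noteq> 0" using a0 i by auto
      ultimately obtain k where k: "i = int k" "k > 0" using zero_less_imp_eq_int[of i] by auto
      have "y \<otimes>\<^bsub>AA\<^esub> gr.G.cmp i a \<in> rgrade AA (int (n + k))"
        using gr.rgrade_mult[OF y(1) gr.G.component_in[OF ac, of i]] k by simp
      \<comment> \<open>Maximality of \<open>n\<close>: in degree \<open>n + k\<close> every
        homogeneous element is a multiple of \<open>period_sum\<close>.\<close>
      moreover have "\<not> D (n + k)" using n(2)[of "n + k"] k by auto
      ultimately show "y \<otimes>\<^bsub>AA\<^esub> gr.G.cmp i a \<in> ?M" unfolding D_def by blast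
    qed
    also have "(\<Oplus>\<^bsub>AA\<^esub>i\<in>?J. y \<otimes>\<^bsub>AA\<^esub> gr.G.cmp i a) = y \<otimes>\<^bsub>AA\<^esub> (\<Oplus>\<^bsub>AA\<^esub>i\<in>?J. gr.G.cmp i a)"
      using cc yc gr.G.component_finite[OF ac] by (intro AA.finsum_rdistr[symmetric]) auto
    also have "\<dots> = y \<otimes>\<^bsub>AA\<^esub> a" using gr.G.component_sum[OF ac] by simp
    finally show "\<exists>w\<in>carrier AA. y \<otimes>\<^bsub>AA\<^esub> a = period_sum \<otimes>\<^bsub>AA\<^esub> w" by blast
  qed
qed

end

section \<open>Freeness\<close>

context nonempty_quadratic_algebra
begin

lemma path_class_inj: "inj_on path_class nz_paths"
proof (rule inj_onI)
  fix p q assume p: "p \<in> nz_paths" and q: "q \<in> nz_paths" and eq: "path_class p = path_class q"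
  have "coord (path_class q) p = 1" using path_class(2)[OF p, of p] eq by simp
  then show "p = q" using path_class(2)[OF q, of p] by (auto split: if_splits)
qed

lemma coord_path_sum:
  assumes T: "finite T" "T \<subseteq> nz_paths"
  shows "(\<Oplus>\<^bsub>AA\<^esub>t\<in>T. path_class t \<otimes>\<^bsub>AA\<^esub> scal (f t)) \<in> carrier AA"
    "coord (\<Oplus>\<^bsub>AA\<^esub>t\<in>T. path_class t \<otimes>\<^bsub>AA\<^esub> scal (f t)) p = (if p \<in> T then f p else 0)"
proof -
  have c: "(\<lambda>t. path_class t \<otimes>\<^bsub>AA\<^esub> scal (f t)) \<in> T \<rightarrow> carrier AA"
    using T path_class(1) scal(1) by auto
  then show "(\<Oplus>\<^bsub>AA\<^esub>t\<in>T. path_class t \<otimes>\<^bsub>AA\<^esub> scal (f t)) \<in> carrier AA" by (rule AA.finsum_closed)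
  have "coord (\<Oplus>\<^bsub>AA\<^esub>t\<in>T. path_class t \<otimes>\<^bsub>AA\<^esub> scal (f t)) p = (\<Sum>t\<in>T. if t = p then f t else 0)"
    unfolding coord_finsum[OF T(1) c]
  proof (rule sum.cong[OF refl])
    fix t assume "t \<in> T"
    then have t: "t \<in> nz_paths" using T by blast
    show "coord (path_class t \<otimes>\<^bsub>AA\<^esub> scal (f t)) p = (if t = p then f t else 0)"
      using coord_scal_r[OF path_class(1)[OF t]] path_class(2)[OF t, of p] by auto
  qed
  then show "coord (\<Oplus>\<^bsub>AA\<^esub>t\<in>T. path_class t \<otimes>\<^bsub>AA\<^esub> scal (f t)) p = (if p \<in> T then f p else 0)"
    using T(1) by simp
qed

lemma supported_path_sum:
  assumes T: "finite T" "T \<subseteq> nz_paths" and W: "W \<in> supported T"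
  shows "W = (\<Oplus>\<^bsub>AA\<^esub>t\<in>T. path_class t \<otimes>\<^bsub>AA\<^esub> scal (coord W t))"
proof (rule coord_inj)
  show "W \<in> carrier AA" using W by (simp add: supported_def)
  fix p show "coord W p = coord (\<Oplus>\<^bsub>AA\<^esub>t\<in>T. path_class t \<otimes>\<^bsub>AA\<^esub> scal (coord W t)) p"
  proof (cases "p \<in> T")
    case False
    then have "coord W p = 0" using W unfolding supported_def by blast
    then show ?thesis using False by (simp add: coord_path_sum(2)[OF T])
  qed (simp add: coord_path_sum(2)[OF T])
qed (rule coord_path_sum(1)[OF T])

text \<open>The sum over module elements is reindexed by paths, on which \<open>path_class\<close>
  is injective, and terms with coefficient zero are added.\<close>

lemma linear_combination_path_classes:
  assumes G: "carrier G \<subseteq> carrier AA" "\<zero>\<^bsub>G\<^esub> = \<zero>\<^bsub>AA\<^esub>"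
    and T: "finite T" "T \<subseteq> nz_paths" and c: "c \<in> coefficients_on G (path_class ` T)"
  shows "linear_combination G (regular_module AA) c = (\<Oplus>\<^bsub>AA\<^esub>t\<in>T. path_class t \<otimes>\<^bsub>AA\<^esub> c (path_class t))"
proof -
  have cc: "c b \<in> carrier AA" for b using c G(1) unfolding coefficients_on_def by blast
  have pc: "t \<in> T \<Longrightarrow> path_class t \<in> carrier AA" for t using T path_class(1) by blast
  have sub: "{b. c b \<noteq> \<zero>\<^bsub>AA\<^esub>} \<subseteq> path_class ` T" using c G(2) unfolding coefficients_on_def by simp
  have "linear_combination G (regular_module AA) c = (\<Oplus>\<^bsub>AA\<^esub>b\<in>{b. c b \<noteq> \<zero>\<^bsub>AA\<^esub>}. b \<otimes>\<^bsub>AA\<^esub> c b)"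
    by (simp add: linear_combination_def regular_module_finsum G(2))
  also have "\<dots> = (\<Oplus>\<^bsub>AA\<^esub>b\<in>path_class ` T. b \<otimes>\<^bsub>AA\<^esub> c b)"
    using T(1) sub cc pc by (intro AA.add.finprod_mono_neutral_cong_left) auto
  also have "\<dots> = (\<Oplus>\<^bsub>AA\<^esub>t\<in>T. path_class t \<otimes>\<^bsub>AA\<^esub> c (path_class t))"
    using cc pc inj_on_subset[OF path_class_inj T(2)] by (intro AA.finsum_reindex) auto
  finally show ?thesis .
qed

text \<open>A criterion with coefficients indexed by paths, applied to all nonzero paths over the
  ground field and to \<open>basis_paths\<close> over K[x].\<close>

lemma path_class_basis:
  assumes G: "carrier G \<subseteq> carrier AA" "\<zero>\<^bsub>G\<^esub> = \<zero>\<^bsub>AA\<^esub>" "\<zero>\<^bsub>G\<^esub> \<in> carrier G"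
    and T: "finite T" "T \<subseteq> nz_paths"
    and ex: "\<forall>Z\<in>carrier AA. \<exists>g. (\<forall>t. g t \<in> carrier G) \<and> Z = (\<Oplus>\<^bsub>AA\<^esub>t\<in>T. path_class t \<otimes>\<^bsub>AA\<^esub> g t)"
    and uniq: "\<forall>g h. (\<forall>t. g t \<in> carrier G) \<longrightarrow> (\<forall>t. h t \<in> carrier G) \<longrightarrow>
      (\<Oplus>\<^bsub>AA\<^esub>t\<in>T. path_class t \<otimes>\<^bsub>AA\<^esub> g t) = (\<Oplus>\<^bsub>AA\<^esub>t\<in>T. path_class t \<otimes>\<^bsub>AA\<^esub> h t) \<longrightarrow>
      (\<forall>t\<in>T. g t = h t)"
  shows "finitely_generated_module G (regular_module AA)" "free_module G (regular_module AA)"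
proof -
  let ?B = "path_class ` T"
  have B: "finite ?B" "?B \<subseteq> carrier (regular_module AA)" using T path_class(1) by auto
  note lc = linear_combination_path_classes[OF G(1,2) T]
  have exc: "\<exists>c\<in>coefficients_on G ?B. Z = linear_combination G (regular_module AA) c" if Z: "Z \<in> carrier AA" for Z
  proof -
    obtain g where g: "\<And>t. g t \<in> carrier G" "Z = (\<Oplus>\<^bsub>AA\<^esub>t\<in>T. path_class t \<otimes>\<^bsub>AA\<^esub> g t)"
      using bspec[OF ex Z] by blast
    define c where "c b = (if b \<in> ?B then g (inv_into T path_class b) else \<zero>\<^bsub>G\<^esub>)" for b
    have "{b. c b \<noteq> \<zero>\<^bsub>G\<^esub>} \<subseteq> ?B" by (auto simp: c_def)
    then have c: "c \<in> coefficients_on G ?B"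
      using finite_subset[OF _ B(1)] g(1) G(3) by (auto simp: coefficients_on_def c_def)
    have gc: "g t \<in> carrier AA" for t using g(1) G(1) by blast
    have pc: "t \<in> T \<Longrightarrow> path_class t \<in> carrier AA" for t using T(2) path_class(1) by blast
    have "c (path_class t) = g t" if "t \<in> T" for t
      using that inj_on_subset[OF path_class_inj T(2)] by (simp add: c_def)
    then have "Z = (\<Oplus>\<^bsub>AA\<^esub>t\<in>T. path_class t \<otimes>\<^bsub>AA\<^esub> c (path_class t))"
      unfolding g(2) using gc pc by (intro AA.finsum_cong') auto
    then have "Z = linear_combination G (regular_module AA) c" using lc[OF c] by simp
    then show ?thesis using c by blast
  qed
  then show "finitely_generated_module G (regular_module AA)"
    unfolding finitely_generated_module_def using B by (intro exI[of _ ?B]) simp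
  have "module_basis G (regular_module AA) ?B"
    unfolding module_basis_def
  proof (intro conjI ballI B)
    fix Z assume "Z \<in> carrier (regular_module AA)"
    then obtain c where c: "c \<in> coefficients_on G ?B" "Z = linear_combination G (regular_module AA) c"
      using exc by auto
    show "\<exists>!c. c \<in> coefficients_on G ?B \<and> Z = linear_combination G (regular_module AA) c"
    proof (rule ex1I[of _ c])
      fix d assume d: "d \<in> coefficients_on G ?B \<and> Z = linear_combination G (regular_module AA) d"
      have mem: "c b \<in> carrier G" "d b \<in> carrier G" for b using c(1) d unfolding coefficients_on_def by blast+
      have sum_eq: "(\<Oplus>\<^bsub>AA\<^esub>t\<in>T. path_class t \<otimes>\<^bsub>AA\<^esub> d (path_class t)) = (\<Oplus>\<^bsub>AA\<^esub>t\<in>T. path_class t \<otimes>\<^bsub>AA\<^esub> c (path_class t))"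
        using lc[OF c(1)] lc[OF conjunct1[OF d]] c(2) conjunct2[OF d] by simp
      have mem': "\<forall>t. d (path_class t) \<in> carrier G" "\<forall>t. c (path_class t) \<in> carrier G"
        using mem by simp_all
      have "\<forall>t\<in>T. d (path_class t) = c (path_class t)"
        by (rule mp[OF mp[OF mp[OF spec[OF spec[OF uniq, of "\<lambda>t. d (path_class t)"], of "\<lambda>t. c (path_class t)"]
            mem'(1)] mem'(2)] sum_eq])
      then have eq: "d (path_class t) = c (path_class t)" if "t \<in> T" for t
        using that by (rule bspec)
      show "d = c"
      proof
        fix b show "d b = c b"
        proof (cases "b \<in> ?B")
          case False
          then have "d b = \<zero>\<^bsub>G\<^esub>" "c b = \<zero>\<^bsub>G\<^esub>" using c(1) d unfolding coefficients_on_def by blast+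
          then show ?thesis by simp
        qed (use eq in auto)
      qed
    qed (use c in blast)
  qed
  then show "free_module G (regular_module AA)" unfolding free_module_def by blast
qed

section \<open>Polynomials in no variables\<close>

lemma polynomials_0_value:
  assumes p: "p \<in> polynomials KK AA 0"
  shows "polynomial_value AA [] p = p []" "e \<noteq> [] \<Longrightarrow> p e = \<zero>\<^bsub>AA\<^esub>"
proof -
  have pc: "p [] \<in> carrier AA" using p subfieldE(3)[OF scalars_subfield] unfolding polynomials_def by blast
  show e: "p e = \<zero>\<^bsub>AA\<^esub>" if "e \<noteq> []" for e using p that unfolding polynomials_def by fastforce
  have mv: "monomial_value AA [] [] = \<one>\<^bsub>AA\<^esub>" by (simp add: monomial_value_def)
  show "polynomial_value AA [] p = p []"
  proof (cases "p [] = \<zero>\<^bsub>AA\<^esub>")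
    case True
    have "p x = \<zero>\<^bsub>AA\<^esub>" for x using e[of x] True by (cases "x = []") simp_all
    then have "{e. p e \<noteq> \<zero>\<^bsub>AA\<^esub>} = {}" by simp
    then show ?thesis using True unfolding polynomial_value_def by simp
  next
    case False
    have "p x \<noteq> \<zero>\<^bsub>AA\<^esub> \<longleftrightarrow> x = []" for x using e[of x] False by (cases "x = []") simp_all
    then have "{e. p e \<noteq> \<zero>\<^bsub>AA\<^esub>} = {[]}" by simp
    then show ?thesis
      unfolding polynomial_value_def using pc mv
        AA.finsum_single[of "{[]}" "\<lambda>e. p e \<otimes>\<^bsub>AA\<^esub> monomial_value AA [] e" "[]"] by simp
  qed
qed

lemma generated_algebra_Nil: "carrier (generated_algebra KK AA []) = KK"
proof (intro subset_antisym subsetI)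
  fix g assume "g \<in> carrier (generated_algebra KK AA [])"
  then obtain p where "p \<in> polynomials KK AA 0" "g = polynomial_value AA [] p"
    by (auto simp: generated_algebra_def)
  then show "g \<in> KK" using polynomials_0_value(1) by (simp add: polynomials_def)
next
  fix g assume g: "g \<in> KK"
  let ?p = "\<lambda>e :: nat list. if e = [] then g else \<zero>\<^bsub>AA\<^esub>"
  have "{e. ?p e \<noteq> \<zero>\<^bsub>AA\<^esub>} \<subseteq> {[]}" by auto
  then have "finite {e. ?p e \<noteq> \<zero>\<^bsub>AA\<^esub>}" by (rule finite_subset) simp
  moreover have "\<zero>\<^bsub>AA\<^esub> \<in> KK" unfolding scalars_eq scal_zero[symmetric] by (rule rangeI)
  ultimately have p: "?p \<in> polynomials KK AA 0"
    using g by (simp add: polynomials_def)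
  then have "g = polynomial_value AA [] ?p" using polynomials_0_value(1) by simp
  then show "g \<in> carrier (generated_algebra KK AA [])"
    using p by (auto simp: generated_algebra_def)
qed

text \<open>With no variables the generated algebra is the ground field, over which the nonzero
  paths form a finite basis.\<close>

lemma finite_free_over_scalars:
  assumes fin: "finite nz_paths"
  shows "algebraically_independent KK AA []"
    "finitely_generated_module (generated_algebra KK AA []) (regular_module AA)"
    "free_module (generated_algebra KK AA []) (regular_module AA)"
proof -
  show "algebraically_independent KK AA []"
    unfolding algebraically_independent_def
  proof (intro ballI impI allI)
    fix p e assume "p \<in> polynomials KK AA (length [])" "polynomial_value AA [] p = \<zero>\<^bsub>AA\<^esub>"
    then show "p e = \<zero>\<^bsub>AA\<^esub>" using polynomials_0_value[of p] by (cases "e = []") auto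
  qed
  let ?G = "generated_algebra KK AA []"
  have G: "carrier ?G \<subseteq> carrier AA" "\<zero>\<^bsub>?G\<^esub> = \<zero>\<^bsub>AA\<^esub>" "\<zero>\<^bsub>?G\<^esub> \<in> carrier ?G"
  proof -
    show "carrier ?G \<subseteq> carrier AA" unfolding generated_algebra_Nil by (rule subfieldE(3)[OF scalars_subfield])
    show z: "\<zero>\<^bsub>?G\<^esub> = \<zero>\<^bsub>AA\<^esub>" by (simp add: generated_algebra_def)
    show "\<zero>\<^bsub>?G\<^esub> \<in> carrier ?G" unfolding generated_algebra_Nil z unfolding scalars_eq scal_zero[symmetric] by (rule rangeI)
  qed
  have ex: "\<forall>Z\<in>carrier AA. \<exists>g. (\<forall>t. g t \<in> carrier ?G) \<and> Z = (\<Oplus>\<^bsub>AA\<^esub>t\<in>nz_paths. path_class t \<otimes>\<^bsub>AA\<^esub> g t)"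
  proof
    fix Z assume Z: "Z \<in> carrier AA"
    have "Z \<in> supported nz_paths" using Z coord_support(2)[OF Z] unfolding supported_def by blast
    from supported_path_sum[OF fin subset_refl this]
    show "\<exists>g. (\<forall>t. g t \<in> carrier ?G) \<and> Z = (\<Oplus>\<^bsub>AA\<^esub>t\<in>nz_paths. path_class t \<otimes>\<^bsub>AA\<^esub> g t)" unfolding generated_algebra_Nil unfolding scalars_eq by (intro exI[of _ "\<lambda>t. scal (coord Z t)"]) simp
  qed
  have uniq: "\<forall>g h. (\<forall>t. g t \<in> carrier ?G) \<longrightarrow> (\<forall>t. h t \<in> carrier ?G) \<longrightarrow>
      (\<Oplus>\<^bsub>AA\<^esub>t\<in>nz_paths. path_class t \<otimes>\<^bsub>AA\<^esub> g t) = (\<Oplus>\<^bsub>AA\<^esub>t\<in>nz_paths. path_class t \<otimes>\<^bsub>AA\<^esub> h t) \<longrightarrow>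
      (\<forall>t\<in>nz_paths. g t = h t)"
  proof (intro allI impI ballI)
    fix g h t assume g: "\<forall>t. g t \<in> carrier ?G" and h: "\<forall>t. h t \<in> carrier ?G"
      and eq: "(\<Oplus>\<^bsub>AA\<^esub>t\<in>nz_paths. path_class t \<otimes>\<^bsub>AA\<^esub> g t) = (\<Oplus>\<^bsub>AA\<^esub>t\<in>nz_paths. path_class t \<otimes>\<^bsub>AA\<^esub> h t)"
      and t: "t \<in> nz_paths"
    note gh = spec[OF g] spec[OF h] eq
    have "\<forall>t. \<exists>c. g t = scal c" "\<forall>t. \<exists>c. h t = scal c"
      using gh(1,2) unfolding generated_algebra_Nil unfolding scalars_eq by blast+
    then obtain c d where c: "\<And>t. g t = scal (c t)" and d: "\<And>t. h t = scal (d t)" by metis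
    have "c t = d t"
      using coord_path_sum(2)[OF fin subset_refl, of c t] coord_path_sum(2)[OF fin subset_refl, of d t] gh(3) t
      by (simp add: c d)
    then show "g t = h t" by (simp add: c d)
  qed
  show "finitely_generated_module ?G (regular_module AA)" "free_module ?G (regular_module AA)"
    by (rule path_class_basis[OF G fin subset_refl[of nz_paths] ex uniq])+
qed

lemma horner_zero: "x \<in> carrier AA \<Longrightarrow> horner x n (\<lambda>_. 0) = \<zero>\<^bsub>AA\<^esub>"
  by (induction n) (auto simp: scal_zero)

lemma horner_pad: "horner x (n + n') (\<lambda>m. if m < n then k m else 0) = horner x n k" if "x \<in> carrier AA"
proof (induction n arbitrary: k)
  case 0 then show ?case using horner_zero[OF that] by simp
next
  case (Suc n)
  then show ?case using Suc[of "\<lambda>i. k (Suc i)"] by simp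
qed

lemma horner_diff:
  assumes x: "x \<in> carrier AA"
  shows "horner x n k \<ominus>\<^bsub>AA\<^esub> horner x n k' = horner x n (\<lambda>i. k i - k' i)"
proof (induction n arbitrary: k k')
  case (Suc n)
  let ?a = "horner x n (\<lambda>i. k (Suc i))" and ?b = "horner x n (\<lambda>i. k' (Suc i))"
  have c: "?a \<in> carrier AA" "?b \<in> carrier AA" using horner_closed[OF x] by auto
  have "horner x (Suc n) (\<lambda>i. k i - k' i) = (scal (k 0) \<ominus>\<^bsub>AA\<^esub> scal (k' 0)) \<oplus>\<^bsub>AA\<^esub> (?a \<ominus>\<^bsub>AA\<^esub> ?b) \<otimes>\<^bsub>AA\<^esub> x"
    using Suc[of "\<lambda>i. k (Suc i)" "\<lambda>i. k' (Suc i)"]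
    by (simp add: AA.minus_eq scal_uminus scal_add)
  also have "\<dots> = horner x (Suc n) k \<ominus>\<^bsub>AA\<^esub> horner x (Suc n) k'"
    using c x scal(1)[of "k 0"] scal(1)[of "k' 0"]
    by (simp add: AA.minus_eq AA.l_distr AA.l_minus AA.minus_add AA.a_ac)
  finally show ?case by simp
qed (simp add: AA.minus_eq)

text \<open>Padding by zero coefficients gives one length for all \<open>t\<close>, and all larger
  lengths work too, so two families can be compared at the sum of their bounds.\<close>

lemma common_horner:
  assumes x: "x \<in> carrier AA" and T: "finite T"
    and g: "\<And>t. t \<in> T \<Longrightarrow> g t \<in> carrier (generated_algebra KK AA [x])"
  shows "\<exists>n k. \<forall>t\<in>T. \<forall>n'\<ge>n. g t = horner x n' (k t)"
proof -
  have "\<forall>t\<in>T. \<exists>n k. g t = horner x n k" using g unfolding generated_algebra_singleton[OF x] by blast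
  then obtain n k where nk: "\<And>t. t \<in> T \<Longrightarrow> g t = horner x (n t) (k t)" by metis
  have le: "n t \<le> sum n T" if "t \<in> T" for t using member_le_sum[OF that _ T, of n] by simp
  show ?thesis
  proof (intro exI[of _ "sum n T"] exI[of _ "\<lambda>t m. if m < n t then k t m else 0"] ballI allI impI)
    fix t n' assume t: "t \<in> T" and n': "sum n T \<le> n'"
    then have "n' = n t + (n' - n t)" using le[OF t] by simp
    then show "g t = horner x n' (\<lambda>m. if m < n t then k t m else 0)"
      using horner_pad[OF x, of "n t" "n' - n t" "k t"] nk[OF t] by metis
  qed
qed

text \<open>Elements of degree 0 multiply vertexwise, so \<open>horner\<close> evaluates the
  polynomial at each vertex coordinate.\<close>

lemma horner_grade_0:
  assumes x: "x \<in> rgrade AA 0"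
  shows "horner x n k \<in> rgrade AA 0"
    "v \<in> verts Q \<Longrightarrow> coord (horner x n k) (v, []) = (\<Sum>m<n. k m * coord x (v, []) ^ m)"
proof -
  have xc: "x \<in> carrier AA" by (rule rgrade_D(1)[OF x])
  have sc: "scal c \<in> rgrade AA 0" for c
    by (auto simp: rgrade_iff scal coord_one split: if_splits)
  show "horner x n k \<in> rgrade AA 0"
  proof (induction n arbitrary: k)
    case (Suc n)
    have "horner x n (\<lambda>i. k (Suc i)) \<otimes>\<^bsub>AA\<^esub> x \<in> rgrade AA 0"
      using gr.rgrade_mult[OF Suc x] by simp
    then show ?case using sc gr.G.grade_add by simp
  qed (simp add: gr.G.grade_zero)
  show "coord (horner x n k) (v, []) = (\<Sum>m<n. k m * coord x (v, []) ^ m)" if v: "v \<in> verts Q"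
  proof (induction n arbitrary: k)
    case (Suc n)
    let ?h = "horner x n (\<lambda>i. k (Suc i))"
    have hc: "?h \<in> carrier AA" by (rule horner_closed[OF xc])
    have "(v, []) \<in> nz_paths" using v by (simp add: nz_paths_iff)
    then have "coord (horner x (Suc n) k) (v, []) = k 0 + coord ?h (v, []) * coord x (v, [])"
      using hc xc v by (simp add: coord_add scal coord_mult coord_one)
    also have "\<dots> = (\<Sum>m<Suc n. k m * coord x (v, []) ^ m)"
      unfolding sum.lessThan_Suc_shift Suc by (simp add: sum_distrib_left sum_distrib_right mult_ac)
    finally show ?case .
  qed (simp add: coord_zero)
qed

text \<open>The part of degree 0 is a product of copies of the field, one per vertex. Hence
  \<open>x\<close> is annihilated by the product over the vertices of the linear polynomials with
  root the coordinate of \<open>x\<close> there.\<close>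

lemma grade_0_algebraic:
  assumes x: "x \<in> rgrade AA 0"
  shows "\<not> algebraically_independent KK AA [x]"
proof
  assume "algebraically_independent KK AA [x]"
  then have ind: "horner x n k = \<zero>\<^bsub>AA\<^esub> \<Longrightarrow> m < n \<Longrightarrow> k m = 0" for n k m
    using algebraically_independent_singleton[OF rgrade_D(1)[OF x]] by blast
  define f where "f = (\<Prod>v\<in>verts Q. [:- coord x (v, []), 1:])"
  have f: "f \<noteq> 0" using finite_verts by (simp add: f_def)
  have "horner x (Suc (degree f)) (coeff f) = \<zero>\<^bsub>AA\<^esub>"
  proof (rule coord_inj)
    show "horner x (Suc (degree f)) (coeff f) \<in> carrier AA" by (rule horner_closed[OF rgrade_D(1)[OF x]])
    fix w assume w: "w \<in> nz_paths"
    obtain u p where up: "w = (u, p)" by fastforce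
    show "coord (horner x (Suc (degree f)) (coeff f)) w = coord \<zero>\<^bsub>AA\<^esub> w"
    proof (cases "p = []")
      case True
      have u: "u \<in> verts Q" using w up by (simp add: nz_paths_iff)
      have "coord (horner x (Suc (degree f)) (coeff f)) w = poly f (coord x (u, []))"
        unfolding up True horner_grade_0(2)[OF x u] poly_altdef lessThan_Suc_atMost ..
      also have "\<dots> = 0" unfolding f_def poly_prod using finite_verts u by (intro prod_zero) auto
      finally show ?thesis by (simp add: coord_zero)
    next
      case False
      then show ?thesis
        using rgrade_D(2)[OF horner_grade_0(1)[OF x], of w] up by (simp add: coord_zero del: horner.simps)
    qed
  qed simp
  from ind[OF this, of "degree f"] show False using f by simp
qed

text \<open>If \<open>z\<close> has coefficients \<open>c b\<close>, then
  \<open>z \<otimes> x\<close> has coefficients \<open>c b \<otimes> x\<close>, which vanish by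
  uniqueness of the expansion of zero. As \<open>c b\<close> is a polynomial in \<open>x\<close>,
  independence of \<open>x\<close> gives \<open>c b = \<zero>\<close>.\<close>

lemma free_torsion_free:
  assumes x: "x \<in> carrier AA" and ind: "algebraically_independent KK AA [x]"
    and free: "free_module (generated_algebra KK AA [x]) (regular_module AA)"
    and z: "z \<in> carrier AA" "z \<otimes>\<^bsub>AA\<^esub> x = \<zero>\<^bsub>AA\<^esub>"
  shows "z = \<zero>\<^bsub>AA\<^esub>"
proof -
  let ?G = "generated_algebra KK AA [x]"
  have zero: "\<zero>\<^bsub>?G\<^esub> = \<zero>\<^bsub>AA\<^esub>" by (simp add: generated_algebra_def)
  have Gc: "g \<in> carrier AA" if "g \<in> carrier ?G" for g
    using that horner_closed[OF x] unfolding generated_algebra_singleton[OF x] by blast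
  \<comment> \<open>Prefixing a zero coefficient multiplies the polynomial by its variable.\<close>
  have mult: "horner x (Suc n) (case_nat 0 k) = horner x n k \<otimes>\<^bsub>AA\<^esub> x" for n k
    using horner_closed[OF x, of n k] x by (simp add: scal_zero)
  obtain B where B: "B \<subseteq> carrier AA"
    "\<And>m. m \<in> carrier AA \<Longrightarrow> \<exists>!c. c \<in> coefficients_on ?G B \<and> m = linear_combination ?G (regular_module AA) c"
    using free unfolding free_module_def module_basis_def by auto
  obtain c where c: "c \<in> coefficients_on ?G B" "z = linear_combination ?G (regular_module AA) c"
    using B(2)[OF z(1)] by blast
  let ?J = "{b. c b \<noteq> \<zero>\<^bsub>AA\<^esub>}"
  have cG: "\<And>b. c b \<in> carrier ?G" and J: "finite ?J" "?J \<subseteq> B"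
    using c(1) unfolding coefficients_on_def zero by auto
  have cA: "c b \<in> carrier AA" for b using Gc[OF cG] .
  define c' where "c' b = c b \<otimes>\<^bsub>AA\<^esub> x" for b
  have c'0: "c' b = \<zero>\<^bsub>AA\<^esub>" if "c b = \<zero>\<^bsub>AA\<^esub>" for b using that x by (simp add: c'_def)
  then have J': "{b. c' b \<noteq> \<zero>\<^bsub>AA\<^esub>} \<subseteq> ?J" by blast
  have c'G: "c' b \<in> carrier ?G" for b
  proof -
    obtain n k where "c b = horner x n k" using cG[of b] unfolding generated_algebra_singleton[OF x] by blast
    then have "c' b = horner x (Suc n) (case_nat 0 k)" unfolding c'_def mult by simp
    then show ?thesis unfolding generated_algebra_singleton[OF x] by blast
  qed
  have c': "c' \<in> coefficients_on ?G B"
    unfolding coefficients_on_def zero using c'G finite_subset[OF J' J(1)] J' J(2) by blast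
  have "linear_combination ?G (regular_module AA) c' = (\<Oplus>\<^bsub>AA\<^esub>b\<in>{b. c' b \<noteq> \<zero>\<^bsub>AA\<^esub>}. b \<otimes>\<^bsub>AA\<^esub> c' b)"
    by (simp add: linear_combination_def regular_module_finsum zero)
  also have "\<dots> = (\<Oplus>\<^bsub>AA\<^esub>b\<in>?J. (b \<otimes>\<^bsub>AA\<^esub> c b) \<otimes>\<^bsub>AA\<^esub> x)"
  proof (rule AA.add.finprod_mono_neutral_cong_left[OF J(1) J'])
    have bc: "b \<in> carrier AA" if "b \<in> ?J" for b using that J(2) B(1) by blast
    show eq: "b \<otimes>\<^bsub>AA\<^esub> c' b = b \<otimes>\<^bsub>AA\<^esub> c b \<otimes>\<^bsub>AA\<^esub> x" if "b \<in> {b. c' b \<noteq> \<zero>\<^bsub>AA\<^esub>}" for b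
      using bc[OF subsetD[OF J' that]] cA[of b] x by (simp add: c'_def AA.m_assoc)
    show "b \<otimes>\<^bsub>AA\<^esub> c b \<otimes>\<^bsub>AA\<^esub> x = \<zero>\<^bsub>AA\<^esub>" if b: "b \<in> ?J - {b. c' b \<noteq> \<zero>\<^bsub>AA\<^esub>}" for b
    proof -
      have "b \<in> carrier AA" "c' b = \<zero>\<^bsub>AA\<^esub>" using b bc by blast+
      then show ?thesis using cA[of b] x by (simp add: c'_def AA.m_assoc)
    qed
    show "(\<lambda>b. b \<otimes>\<^bsub>AA\<^esub> c b \<otimes>\<^bsub>AA\<^esub> x) \<in> ?J \<rightarrow> carrier AA"
      using bc cA x by (intro Pi_I AA.m_closed)
  qed
  also have "\<dots> = (\<Oplus>\<^bsub>AA\<^esub>b\<in>?J. b \<otimes>\<^bsub>AA\<^esub> c b) \<otimes>\<^bsub>AA\<^esub> x"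
  proof (rule AA.finsum_ldistr[OF J(1) x, symmetric])
    show "(\<lambda>b. b \<otimes>\<^bsub>AA\<^esub> c b) \<in> ?J \<rightarrow> carrier AA"
      using subsetD[OF B(1) subsetD[OF J(2)]] cA by (intro Pi_I AA.m_closed)
  qed
  also have "\<dots> = z \<otimes>\<^bsub>AA\<^esub> x"
    unfolding c(2) by (simp add: linear_combination_def regular_module_finsum zero)
  finally have lc': "linear_combination ?G (regular_module AA) c' = \<zero>\<^bsub>AA\<^esub>" using z(2) by simp
  let ?o = "\<lambda>_. \<zero>\<^bsub>AA\<^esub>"
  have "\<zero>\<^bsub>AA\<^esub> \<in> carrier ?G"
    unfolding generated_algebra_singleton[OF x] by (auto intro!: exI[of _ 0])
  then have o: "?o \<in> coefficients_on ?G B" by (simp add: coefficients_on_def zero)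
  have lco: "linear_combination ?G (regular_module AA) ?o = \<zero>\<^bsub>AA\<^esub>"
    by (simp add: linear_combination_def regular_module_finsum zero)
  obtain c0 where c0: "\<And>c. c \<in> coefficients_on ?G B \<and> \<zero>\<^bsub>AA\<^esub> = linear_combination ?G (regular_module AA) c \<Longrightarrow> c = c0"
    using B(2)[OF AA.zero_closed] by (elim ex1E) blast
  have "c' = c0" by (rule c0) (use c' lc' in simp)
  moreover have "?o = c0" by (rule c0) (use o lco in simp)
  ultimately have "c' = ?o" by simp
  have "c b = \<zero>\<^bsub>AA\<^esub>" for b
  proof -
    obtain n k where nk: "c b = horner x n k" using cG[of b] unfolding generated_algebra_singleton[OF x] by blast
    have "horner x (Suc n) (case_nat 0 k) = \<zero>\<^bsub>AA\<^esub>"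
      unfolding mult nk[symmetric] using fun_cong[OF \<open>c' = ?o\<close>, of b] by (simp add: c'_def)
    then have "\<forall>m<Suc n. case_nat 0 k m = (0::'k)"
      using ind unfolding algebraically_independent_singleton[OF x] by blast
    then have "k m = 0" if "m < n" for m using that by (metis Suc_less_eq nat.case(2))
    then have "horner x n k = horner x n (\<lambda>_. 0)" by (rule horner_cong)
    then show ?thesis using nk horner_zero[OF x] by simp
  qed
  then have "c = ?o" by blast
  then show ?thesis using c(2) lco by simp
qed

end

lemma (in gentle_quiver) not_free_finite_maximal:
  assumes "finite_maximal_paths Q I \<noteq> {}" and x: "x \<in> rgrade AA i"
    and ind: "algebraically_independent KK AA [x]"
  shows "\<not> free_module (generated_algebra KK AA [x]) (regular_module AA)"
proof
  assume free: "free_module (generated_algebra KK AA [x]) (regular_module AA)"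
  have xc: "x \<in> carrier AA" by (rule rgrade_D(1)[OF x])
  obtain u p where p: "(u, p) \<in> finite_maximal_paths Q I" using assms by auto
  then have nz: "(u, p) \<in> nz_paths" using finite_maximal_path_iff by blast
  consider "i > 0" | "i = 0" | "i < 0" by linarith
  then show False
  proof cases
    case 1
    then have "path_class (u, p) \<otimes>\<^bsub>AA\<^esub> x = \<zero>\<^bsub>AA\<^esub>"
      using finite_maximal_annihilates[OF p] gr.grade_in_positive_part[OF _ x] by blast
    then have "path_class (u, p) = \<zero>\<^bsub>AA\<^esub>"
      by (rule free_torsion_free[OF xc ind free path_class(1)[OF nz]])
    then show False using path_class(2)[OF nz, of "(u, p)"] coord_zero[of "(u, p)"] by simp
  next
    case 2
    then show False using grade_0_algebraic x ind by simp
  next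
    case 3
    \<comment> \<open>Negative degrees contain only zero, and zero also counts as an element of
      degree 0.\<close>
    then have "x = \<zero>\<^bsub>AA\<^esub>" using gr.nonneg x by blast
    then show False using grade_0_algebraic[OF gr.G.grade_zero] ind by simp
  qed
qed

section \<open>The basis over K[x] in the absence of finite maximal paths\<close>

context no_finite_maximal
begin

text \<open>One Horner step in all coefficients at once: the constant terms form a remainder
  supported on \<open>basis_paths\<close>, the rest is a multiple of
  \<open>period_sum\<close>.\<close>

lemma path_horner_sum_Suc:
  fixes k :: "('v, 'e) path \<Rightarrow> nat \<Rightarrow> 'k"
  shows "(\<Oplus>\<^bsub>AA\<^esub>t\<in>basis_paths. path_class t \<otimes>\<^bsub>AA\<^esub> horner period_sum (Suc n) (k t)) =
    (\<Oplus>\<^bsub>AA\<^esub>t\<in>basis_paths. path_class t \<otimes>\<^bsub>AA\<^esub> scal (k t 0)) \<oplus>\<^bsub>AA\<^esub>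
    (\<Oplus>\<^bsub>AA\<^esub>t\<in>basis_paths. path_class t \<otimes>\<^bsub>AA\<^esub> horner period_sum n (\<lambda>i. k t (Suc i))) \<otimes>\<^bsub>AA\<^esub> period_sum"
proof -
  let ?h = "\<lambda>t. horner period_sum n (\<lambda>i. k t (Suc i))"
  have c: "t \<in> basis_paths \<Longrightarrow> path_class t \<in> carrier AA" "?h t \<in> carrier AA" "scal (k t 0) \<in> carrier AA" for t
    using basis_paths_subset path_class(1) horner_closed[OF period_sum(1)] scal(1) by blast+
  have "(\<Oplus>\<^bsub>AA\<^esub>t\<in>basis_paths. path_class t \<otimes>\<^bsub>AA\<^esub> horner period_sum (Suc n) (k t)) =
    (\<Oplus>\<^bsub>AA\<^esub>t\<in>basis_paths. path_class t \<otimes>\<^bsub>AA\<^esub> scal (k t 0) \<oplus>\<^bsub>AA\<^esub> (path_class t \<otimes>\<^bsub>AA\<^esub> ?h t) \<otimes>\<^bsub>AA\<^esub> period_sum)"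
    using c period_sum(1) by (intro AA.finsum_cong') (auto simp: AA.r_distr AA.m_assoc)
  also have "\<dots> = (\<Oplus>\<^bsub>AA\<^esub>t\<in>basis_paths. path_class t \<otimes>\<^bsub>AA\<^esub> scal (k t 0)) \<oplus>\<^bsub>AA\<^esub>
      (\<Oplus>\<^bsub>AA\<^esub>t\<in>basis_paths. (path_class t \<otimes>\<^bsub>AA\<^esub> ?h t) \<otimes>\<^bsub>AA\<^esub> period_sum)"
    using c period_sum(1) by (intro AA.finsum_addf) auto
  also have "(\<Oplus>\<^bsub>AA\<^esub>t\<in>basis_paths. (path_class t \<otimes>\<^bsub>AA\<^esub> ?h t) \<otimes>\<^bsub>AA\<^esub> period_sum) =
      (\<Oplus>\<^bsub>AA\<^esub>t\<in>basis_paths. path_class t \<otimes>\<^bsub>AA\<^esub> ?h t) \<otimes>\<^bsub>AA\<^esub> period_sum"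
    using c period_sum(1) finite_basis_paths by (intro AA.finsum_ldistr[symmetric]) auto
  finally show ?thesis .
qed

lemma path_horner_sum_carrier:
  "(\<Oplus>\<^bsub>AA\<^esub>t\<in>basis_paths. path_class t \<otimes>\<^bsub>AA\<^esub> horner period_sum n (k t)) \<in> carrier AA"
  using basis_paths_subset path_class(1) horner_closed[OF period_sum(1)]
  by (intro AA.finsum_closed) auto

text \<open>By uniqueness of division both parts of a vanishing sum are zero. The remainder shows
  the constant terms, and the quotient is a sum of the same kind with one coefficient fewer.\<close>

lemma path_horner_sum_independent:
  fixes k :: "('v, 'e) path \<Rightarrow> nat \<Rightarrow> 'k"
  assumes "(\<Oplus>\<^bsub>AA\<^esub>t\<in>basis_paths. path_class t \<otimes>\<^bsub>AA\<^esub> horner period_sum n (k t)) = \<zero>\<^bsub>AA\<^esub>"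
    and "t \<in> basis_paths" "m < n"
  shows "k t m = 0"
  using assms(1,3)
proof (induction n arbitrary: k m)
  case (Suc n)
  let ?W = "\<Oplus>\<^bsub>AA\<^esub>t\<in>basis_paths. path_class t \<otimes>\<^bsub>AA\<^esub> scal (k t 0)"
  note W = coord_path_sum[OF finite_basis_paths basis_paths_subset, of "\<lambda>t. k t 0"]
  have "?W \<in> supported basis_paths"
    unfolding supported_def using W by (auto split: if_splits)
  note z = period_sum_independent[OF this path_horner_sum_carrier Suc.prems(1)[unfolded path_horner_sum_Suc]]
  show ?case
  proof (cases m)
    case 0
    then show ?thesis using W(2)[of t] z(1) assms(2) by (simp add: coord_zero)
  next
    case (Suc m')
    then show ?thesis using Suc.IH[OF z(2), of m'] Suc.prems(2) by simp
  qed
qed simp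

text \<open>Repeated division by \<open>period_sum\<close>; the bound on the lengths drops each time
  because \<open>period > 0\<close>.\<close>

lemma path_horner_sum_exists:
  assumes "Z \<in> carrier AA" "\<And>p. coord Z p \<noteq> 0 \<Longrightarrow> length (snd p) < N"
  shows "\<exists>n k. Z = (\<Oplus>\<^bsub>AA\<^esub>t\<in>basis_paths. path_class t \<otimes>\<^bsub>AA\<^esub> horner period_sum n (k t))"
  using assms
proof (induction N arbitrary: Z)
  case 0
  then have Z0: "Z = \<zero>\<^bsub>AA\<^esub>" by (intro coord_inj) (auto simp: coord_zero)
  have sum0: "(\<Oplus>\<^bsub>AA\<^esub>t\<in>basis_paths. path_class t \<otimes>\<^bsub>AA\<^esub> horner period_sum 0 (k t)) = \<zero>\<^bsub>AA\<^esub>" for k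
    using basis_paths_subset path_class(1) by (intro AA.add.finprod_one_eqI) auto
  show ?case
    unfolding Z0 by (intro exI[of _ 0] exI[of _ "\<lambda>_ _. 0"] sum0[symmetric])
next
  case (Suc N)
  obtain W Y where WY: "W \<in> supported basis_paths" "Y \<in> carrier AA" "Z = W \<oplus>\<^bsub>AA\<^esub> Y \<otimes>\<^bsub>AA\<^esub> period_sum"
    "\<forall>p. coord Y p \<noteq> 0 \<longrightarrow> (\<exists>q. coord Z q \<noteq> 0 \<and> length (snd q) = length (snd p) + period)"
    using divide_period_sum[OF Suc.prems(1)] by blast
  have "length (snd p) < N" if nz: "coord Y p \<noteq> 0" for p
  proof -
    obtain q where "coord Z q \<noteq> 0" "length (snd q) = length (snd p) + period" using WY(4) nz by blast
    then show ?thesis using Suc.prems(2)[of q] period(2) by linarith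
  qed
  then obtain n k where Y: "Y = (\<Oplus>\<^bsub>AA\<^esub>t\<in>basis_paths. path_class t \<otimes>\<^bsub>AA\<^esub> horner period_sum n (k t))"
    using Suc.IH[OF WY(2)] by blast
  have "Z = (\<Oplus>\<^bsub>AA\<^esub>t\<in>basis_paths. path_class t \<otimes>\<^bsub>AA\<^esub> scal (coord W t)) \<oplus>\<^bsub>AA\<^esub> Y \<otimes>\<^bsub>AA\<^esub> period_sum"
    using WY(3) supported_path_sum[OF finite_basis_paths basis_paths_subset WY(1)] by simp
  also have "\<dots> = (\<Oplus>\<^bsub>AA\<^esub>t\<in>basis_paths. path_class t \<otimes>\<^bsub>AA\<^esub>
      horner period_sum (Suc n) (case_nat (coord W t) (k t)))"
    unfolding path_horner_sum_Suc Y by simp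
  finally show ?case
    by (intro exI[of _ "Suc n"] exI[of _ "\<lambda>t. case_nat (coord W t) (k t)"])
qed

lemma free_over_period_sum:
  "algebraically_independent KK AA [period_sum]"
  "finitely_generated_module (generated_algebra KK AA [period_sum]) (regular_module AA)"
  "free_module (generated_algebra KK AA [period_sum]) (regular_module AA)"
proof -
  note x = period_sum(1)
  let ?G = "generated_algebra KK AA [period_sum]"
  have "k m = 0" if "horner period_sum n k = \<zero>\<^bsub>AA\<^esub>" "m < n" for n k m
    using that
  proof (induction n arbitrary: k m)
    case (Suc n)
    let ?h = "horner period_sum n (\<lambda>i. k (Suc i))"
    have hc: "?h \<in> carrier AA" by (rule horner_closed[OF x])
    obtain v where v: "v \<in> verts Q" using verts_nonempty by blast
    then have nz: "(v, []) \<in> nz_paths" by (simp add: nz_paths_iff)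
    \<comment> \<open>At a trivial path only the constant term is visible, since multiples of
      \<open>period_sum\<close> involve only paths of length at least \<open>period\<close>.\<close>
    have "coord (scal (k 0) \<oplus>\<^bsub>AA\<^esub> ?h \<otimes>\<^bsub>AA\<^esub> period_sum) (v, []) = k 0"
      using coord_mult_period_sum[OF hc nz] period(2) hc x v by (simp add: coord_add scal coord_one)
    then have k0: "k 0 = 0" using Suc.prems(1) by (simp add: coord_zero)
    then have "?h \<otimes>\<^bsub>AA\<^esub> period_sum = \<zero>\<^bsub>AA\<^esub>" using Suc.prems(1) hc x by (simp add: scal_zero)
    then have "?h = \<zero>\<^bsub>AA\<^esub>" by (rule period_sum_regular[OF hc])
    then show ?case using Suc.IH[of "\<lambda>i. k (Suc i)"] k0 Suc.prems(2) by (cases m) auto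
  qed simp
  then show "algebraically_independent KK AA [period_sum]"
    unfolding algebraically_independent_singleton[OF x] by blast
  have G: "carrier ?G \<subseteq> carrier AA" "\<zero>\<^bsub>?G\<^esub> = \<zero>\<^bsub>AA\<^esub>" "\<zero>\<^bsub>?G\<^esub> \<in> carrier ?G"
  proof -
    show "carrier ?G \<subseteq> carrier AA"
      unfolding generated_algebra_singleton[OF x] using horner_closed[OF x] by blast
    show z: "\<zero>\<^bsub>?G\<^esub> = \<zero>\<^bsub>AA\<^esub>" by (simp add: generated_algebra_def)
    show "\<zero>\<^bsub>?G\<^esub> \<in> carrier ?G"
      unfolding generated_algebra_singleton[OF x] z by (auto intro!: exI[of _ 0])
  qed
  have ex: "\<forall>Z\<in>carrier AA. \<exists>g. (\<forall>t. g t \<in> carrier ?G) \<and> Z = (\<Oplus>\<^bsub>AA\<^esub>t\<in>basis_paths. path_class t \<otimes>\<^bsub>AA\<^esub> g t)"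
  proof
    fix Z assume Z: "Z \<in> carrier AA"
    let ?L = "(\<lambda>p. length (snd p)) ` {p. coord Z p \<noteq> 0}"
    have "finite ?L" using coord_support(1)[OF Z] by simp
    then obtain N where "\<forall>l\<in>?L. l < N" unfolding finite_nat_set_iff_bounded by blast
    then have N: "\<And>p. coord Z p \<noteq> 0 \<Longrightarrow> length (snd p) < N" by blast
    have "\<exists>n k. Z = (\<Oplus>\<^bsub>AA\<^esub>t\<in>basis_paths. path_class t \<otimes>\<^bsub>AA\<^esub> horner period_sum n (k t))"
      by (rule path_horner_sum_exists[OF Z, of N]) (rule N)
    then obtain n k where nk: "Z = (\<Oplus>\<^bsub>AA\<^esub>t\<in>basis_paths. path_class t \<otimes>\<^bsub>AA\<^esub> horner period_sum n (k t))"
      by (elim exE)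
    have mem: "\<forall>t. horner period_sum n (k t) \<in> carrier ?G"
      unfolding generated_algebra_singleton[OF x] by blast
    show "\<exists>g. (\<forall>t. g t \<in> carrier ?G) \<and> Z = (\<Oplus>\<^bsub>AA\<^esub>t\<in>basis_paths. path_class t \<otimes>\<^bsub>AA\<^esub> g t)"
      by (rule exI[of _ "\<lambda>t. horner period_sum n (k t)"], rule conjI[OF mem nk])
  qed
  have uniq: "\<forall>g h. (\<forall>t. g t \<in> carrier ?G) \<longrightarrow> (\<forall>t. h t \<in> carrier ?G) \<longrightarrow>
      (\<Oplus>\<^bsub>AA\<^esub>t\<in>basis_paths. path_class t \<otimes>\<^bsub>AA\<^esub> g t) = (\<Oplus>\<^bsub>AA\<^esub>t\<in>basis_paths. path_class t \<otimes>\<^bsub>AA\<^esub> h t) \<longrightarrow>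
      (\<forall>t\<in>basis_paths. g t = h t)"
  proof (intro allI impI ballI)
    fix g h t assume g: "\<forall>t. g t \<in> carrier ?G" and h: "\<forall>t. h t \<in> carrier ?G"
      and eq: "(\<Oplus>\<^bsub>AA\<^esub>t\<in>basis_paths. path_class t \<otimes>\<^bsub>AA\<^esub> g t) = (\<Oplus>\<^bsub>AA\<^esub>t\<in>basis_paths. path_class t \<otimes>\<^bsub>AA\<^esub> h t)"
      and t: "t \<in> basis_paths"
    note gh = spec[OF g] spec[OF h] eq
    have "\<exists>n k. \<forall>t\<in>basis_paths. \<forall>n'\<ge>n. g t = horner period_sum n' (k t)"
      by (rule common_horner[OF x finite_basis_paths]) (rule gh(1))
    then obtain n1 k where "\<forall>t\<in>basis_paths. \<forall>n'\<ge>n1. g t = horner period_sum n' (k t)"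
      by (elim exE)
    then have k: "\<And>t n'. t \<in> basis_paths \<Longrightarrow> n1 \<le> n' \<Longrightarrow> g t = horner period_sum n' (k t)" by blast
    have "\<exists>n k. \<forall>t\<in>basis_paths. \<forall>n'\<ge>n. h t = horner period_sum n' (k t)"
      by (rule common_horner[OF x finite_basis_paths]) (rule gh(2))
    then obtain n2 l where "\<forall>t\<in>basis_paths. \<forall>n'\<ge>n2. h t = horner period_sum n' (l t)"
      by (elim exE)
    then have l: "\<And>t n'. t \<in> basis_paths \<Longrightarrow> n2 \<le> n' \<Longrightarrow> h t = horner period_sum n' (l t)" by blast
    let ?n = "n1 + n2"
    have gc: "g t \<in> carrier AA" "h t \<in> carrier AA" for t using gh(1,2) G(1) by blast+
    have pc: "t \<in> basis_paths \<Longrightarrow> path_class t \<in> carrier AA" for t using basis_paths_subset path_class(1) by blast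
    \<comment> \<open>The combination with these differences as coefficients, added to the one of
      \<open>h\<close>, gives the one of \<open>g\<close>. It is therefore zero, and independence
      applies to it.\<close>
    have d: "horner period_sum ?n (\<lambda>i. k t i - l t i) = g t \<ominus>\<^bsub>AA\<^esub> h t" if "t \<in> basis_paths" for t
      using k[OF that, of ?n] l[OF that, of ?n] horner_diff[OF x, of ?n "k t" "l t"] by simp
    have "(\<Oplus>\<^bsub>AA\<^esub>t\<in>basis_paths. path_class t \<otimes>\<^bsub>AA\<^esub> h t) \<oplus>\<^bsub>AA\<^esub>
        (\<Oplus>\<^bsub>AA\<^esub>t\<in>basis_paths. path_class t \<otimes>\<^bsub>AA\<^esub> horner period_sum ?n (\<lambda>i. k t i - l t i)) =
      (\<Oplus>\<^bsub>AA\<^esub>t\<in>basis_paths. path_class t \<otimes>\<^bsub>AA\<^esub> h t \<oplus>\<^bsub>AA\<^esub>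
        path_class t \<otimes>\<^bsub>AA\<^esub> horner period_sum ?n (\<lambda>i. k t i - l t i))"
      using gc pc horner_closed[OF x] by (intro AA.finsum_addf[symmetric]) auto
    also have "\<dots> = (\<Oplus>\<^bsub>AA\<^esub>t\<in>basis_paths. path_class t \<otimes>\<^bsub>AA\<^esub> g t)"
    proof (rule AA.finsum_cong'[OF refl])
      show "(\<lambda>t. path_class t \<otimes>\<^bsub>AA\<^esub> g t) \<in> basis_paths \<rightarrow> carrier AA" using gc pc by auto
      fix t assume "t \<in> basis_paths"
      then show "path_class t \<otimes>\<^bsub>AA\<^esub> h t \<oplus>\<^bsub>AA\<^esub> path_class t \<otimes>\<^bsub>AA\<^esub> horner period_sum ?n (\<lambda>i. k t i - l t i) =
          path_class t \<otimes>\<^bsub>AA\<^esub> g t"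
        using gc[of t] pc[of t] d[of t]
        by (simp add: AA.r_distr[symmetric] AA.minus_eq) (simp add: AA.a_ac AA.r_neg1 AA.r_neg2 AA.r_neg AA.l_neg)
    qed
    finally have "(\<Oplus>\<^bsub>AA\<^esub>t\<in>basis_paths. path_class t \<otimes>\<^bsub>AA\<^esub> horner period_sum ?n (\<lambda>i. k t i - l t i)) = \<zero>\<^bsub>AA\<^esub>"
      using gh(3) gc pc path_horner_sum_carrier[of ?n "\<lambda>t i. k t i - l t i"]
        AA.add.l_cancel_one[of "\<Oplus>\<^bsub>AA\<^esub>t\<in>basis_paths. path_class t \<otimes>\<^bsub>AA\<^esub> h t"] by (simp add: Pi_iff)
    then have "k t m - l t m = 0" if "m < ?n" for m
      using path_horner_sum_independent[of ?n "\<lambda>t i. k t i - l t i" t m] t that by blast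
    then have "horner period_sum ?n (k t) = horner period_sum ?n (l t)" by (intro horner_cong) simp
    then show "g t = h t" using k[OF t, of ?n] l[OF t, of ?n] by simp
  qed
  show "finitely_generated_module ?G (regular_module AA)" "free_module ?G (regular_module AA)"
    by (rule path_class_basis[OF G finite_basis_paths basis_paths_subset ex uniq])+
qed

end

section \<open>The theorem\<close>

text \<open>\<open>step a b\<close> keeps the path out of \<open>I\<close>, while the gentle
  conditions put exactly one of two competing products into \<open>I\<close>; so two competitors
  cannot both be steps.\<close>

lemma gentle_quiver_of_relations:
  fixes I :: "(('v, 'e) path \<Rightarrow> 'k::field) set"
  assumes Q: "quiver Q" and g: "gentle_relations Q I"
  shows "\<exists>R. gentle_quiver Q R I"
proof -
  obtain R where R: "R \<subseteq> {p \<in> paths Q. length (snd p) = 2}" "I = Idl\<^bsub>path_algebra Q\<^esub> (path_element ` R)"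
    using g unfolding gentle_relations_def by blast
  interpret fin_digraph Q using Q by (simp add: quiver_def)
  interpret quadratic_algebra Q R I by unfold_locales (use R in auto)
  have rel: "path_element (arrow_path Q [a, b]) \<notin> I" if "step a b" for a b
  proof -
    have "(tail Q a, [a, b]) \<in> nz_paths" using that by (auto simp: nz_paths_iff step_def)
    then show ?thesis
      using path_element_in_ideal_iff nz_paths_subset by (auto simp: arrow_path_def)
  qed
  have "gentle_quiver Q R I"
  proof unfold_locales
    obtain a where "a \<in> arcs Q" using Q by (auto simp: quiver_def)
    then show "verts Q \<noteq> {}" using tail_in_verts[of a] by blast
    show "b = b'" if s: "step a b" "step a b'" for a b b'
    proof (rule ccontr)
      assume "b \<noteq> b'"
      moreover have "a \<in> arcs Q" "b \<in> arcs Q" "b' \<in> arcs Q" "head Q a = tail Q b" "head Q a = tail Q b'"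
        using s by (auto simp: step_def)
      ultimately have "(path_element (arrow_path Q [a, b]) \<in> I) \<noteq> (path_element (arrow_path Q [a, b']) \<in> I)"
        using g unfolding gentle_relations_def by blast
      then show False using rel[OF s(1)] rel[OF s(2)] by blast
    qed
    show "b = b'" if s: "step b a" "step b' a" for a b b'
    proof (rule ccontr)
      assume "b \<noteq> b'"
      moreover have "a \<in> arcs Q" "b \<in> arcs Q" "b' \<in> arcs Q" "tail Q a = head Q b" "tail Q a = head Q b'"
        using s by (auto simp: step_def)
      ultimately have "(path_element (arrow_path Q [b, a]) \<in> I) \<noteq> (path_element (arrow_path Q [b', a]) \<in> I)"
        using g unfolding gentle_relations_def by blast
      then show False using rel[OF s(1)] rel[OF s(2)] by blast
    qed
  qed
  then show ?thesis ..
qed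

theorem theorem1p3:
  fixes Q :: "('v, 'e) pre_digraph"
    and I :: "(('v, 'e) path \<Rightarrow> 'k::field_char_0) set"
    and A :: "(('v, 'e) path \<Rightarrow> 'k) set graded_ring"
    and K :: "(('v, 'e) path \<Rightarrow> 'k) set set"
  assumes "quiver Q"
    and "gentle Q I \<or> locally_gentle Q I"
    and "A = quiver_algebra Q I"
    and "K = scalars Q I"
  shows "(GKdim K A = ereal_of_enat (depth A) \<longleftrightarrow>
          finite_maximal_paths Q I = {} \<or> infinite_maximal_paths Q I = {})
       \<and> ((\<exists>xs. ereal (real (length xs)) = GKdim K A \<and>
             (\<forall>x\<in>set xs. \<exists>i. x \<in> rgrade A i) \<and>
             pairwise_commuting A xs \<and>
             algebraically_independent K A xs \<and>
             finitely_generated_module (generated_algebra K A xs) (regular_module A) \<and>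
             free_module (generated_algebra K A xs) (regular_module A))
          \<longleftrightarrow>
          finite_maximal_paths Q I = {} \<or> infinite_maximal_paths Q I = {})"
    (is "(?gk \<longleftrightarrow> ?max) \<and> ((\<exists>xs. ?free xs) \<longleftrightarrow> ?max)")
proof -
  have "gentle_relations Q I" using assms(2) by (auto simp: gentle_def locally_gentle_def)
  then obtain R where "gentle_quiver Q R I" using gentle_quiver_of_relations assms(1) by blast
  then interpret gentle_quiver Q R I .
  \<comment> \<open>Infinitely many nonzero paths are equivalent to an infinite maximal path, so the
    third case is exactly the failure of \<open>?max\<close>.\<close>
  consider (fin) "finite nz_paths" | (periodic) "infinite nz_paths" "finite_maximal_paths Q I = {}"
    | (mixed) "infinite nz_paths" "finite_maximal_paths Q I \<noteq> {}" by blast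
  then show ?thesis
  proof cases
    case fin
    have m: ?max using infinite_maximal_imp_infinite fin by blast
    have gk: "GKdim K A = 0" unfolding assms(3,4) by (rule GKdim_finite[OF fin])
    have "depth A = 0" unfolding assms(3) by (rule depth_finite_maximal[OF finite_maximal_exists[OF fin]])
    then have ?gk using gk by (simp add: zero_enat_def)
    \<comment> \<open>Dimension 0 calls for the empty list, that is, for freeness over the ground
      field.\<close>
    moreover have "?free []"
      using gk finite_free_over_scalars[OF fin]
      by (simp add: assms(3,4) pairwise_commuting_def zero_ereal_def)
    ultimately show ?thesis using m by blast
  next
    case periodic
    interpret no_finite_maximal Q R I by unfold_locales (rule periodic(2))
    have gk: "GKdim K A = 1" unfolding assms(3,4) by (rule GKdim_infinite[OF periodic(1)])
    have "depth A = 1" unfolding assms(3) by (rule depth_no_finite_maximal)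
    then have ?gk using gk by (simp add: one_enat_def)
    moreover have "?free [period_sum]"
      using gk free_over_period_sum period_sum_homogeneous
      by (auto simp: assms(3,4) pairwise_commuting_def one_ereal_def)
    ultimately show ?thesis using periodic(2) by blast
  next
    case mixed
    have m: "\<not> ?max" using infinite_maximal_exists mixed by blast
    have gk: "GKdim K A = 1" unfolding assms(3,4) by (rule GKdim_infinite[OF mixed(1)])
    have "depth A = 0" unfolding assms(3) by (rule depth_finite_maximal[OF mixed(2)])
    then have "\<not> ?gk" using gk by (simp add: zero_enat_def)
    moreover have "\<not> ?free xs" for xs
    proof
      assume f: "?free xs"
      \<comment> \<open>The dimension is 1 here, which reduces the claim to a single homogeneous
        element.\<close>
      then have "length xs = 1" using gk by (simp add: one_ereal_def)
      then obtain x where xs: "xs = [x]" by (auto simp: length_Suc_conv)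
      then obtain i where "x \<in> rgrade AA i" using f by (auto simp: assms(3))
      then show False
        using not_free_finite_maximal[OF mixed(2)] f unfolding xs assms(3,4) by blast
    qed
    ultimately show ?thesis using m by blast
  qed
qed

end
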